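(* Let $N$ be a supernatural number, $n\in\mathbb Z$, and let $\delta$ be an $n$-covariant derivation in $B(N)$, with associated data $h_n,\tilde h_n,\tilde g_0,C_n$ as described in the context. For any covariant implementation $D_{\tau_{\mathrm{Haar}}}:\mathcal D_{\tau_{\mathrm{Haar}}}\to L^2(\mathbb Z\times\mathbb Z/N\mathbb Z)$ of $\delta$ there exists a function $\psi\in L^2(\mathbb Z/N\mathbb Z,d_Hx)$ such that, for $f\in\mathcal D_{\tau_{\mathrm{Haar}}}$: (i) if $N$ is infinite and $n\neq0$, or $N$ is finite and $N\nmid n$, $$(D_{\tau_{\mathrm{Haar}}}f)(m,x)=h_n(x+m-n)f(m-n,x)+(\psi(x)-h_n(x))f(m-n,x+n);$$ (ii) if $N$ is infinite and $n=0$, $$(D_{\tau_{\mathrm{Haar}}}f)(m,x)=\bigl(C_0m+(\tilde g_0(x+m-1)+\cdots+\tilde g_0(x))+\psi(x)\bigr)f(m,x);$$ (iii) if $N$ is finite and $N\mid n$, $$(D_{\tau_{\mathrm{Haar}}}f)(m,x)=\bigl(C_n\cdot(m-n)+\tilde h_n(x+m)-\tilde h_n(x)+\psi(x)\bigr)f(m-n,x).$$ For $N$ finite and $N\mid n$, a necessary and sufficient condition for $D_{\tau_{\mathrm{Haar}}}$ to have compact parametrices is $C_n\neq0$. In all other cases $D_{\tau_{\mathrm{Haar}}}$ does not have compact parametrices.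
   Context: A supernatural number is a formal product $N=\prod_{p\text{ prime}}p^{\epsilon_p}$ with $\epsilon_p\in\{0,1,\dots,\infty\}$; it is finite (an ordinary positive integer) if $\sum_p\epsilon_p<\infty$, and infinite otherwise. A positive integer $j$ divides $N$ ($j\mid N$) if for each prime $p$ the exponent of $p$ in $j$ is at most $\epsilon_p$. $\mathbb Z/N\mathbb Z=\varprojlim_{j\mid N,\,j<\infty}\mathbb Z/j\mathbb Z$ is a compact abelian group with normalized Haar measure $d_Hx$; $q:\mathbb Z\to\mathbb Z/N\mathbb Z$, $q(l)=\{l \bmod j\}_{j}$, has dense range, and for $x\in\mathbb Z/N\mathbb Z$, $m\in\mathbb Z$, $x+m$ means $x+q(m)$. On $\ell^2(\mathbb Z)$ with canonical basis $\{E_l\}_{l\in\mathbb Z}$ let $VE_l=E_{l+1}$, $\mathbb LE_l=lE_l$, $b(\mathbb L)E_l=b(l)E_l$. Let $\mathcal B_{\mathrm{diag}}(N)=\{b(\mathbb L): b(l+j)=b(l)\ \forall l,\text{ for some positive integer } j\mid N\}$ with norm closure $B_{\mathrm{diag}}(N)=\{g(q(\mathbb L)):g\in C(\mathbb Z/N\mathbb Z)\}\cong C(\mathbb Z/N\mathbb Z)$, where $g(q(\mathbb L))E_l=g(q(l))E_l$. The Bunce-Deddens algebra is (up to isomorphism) $B(N)=\mathrm C^*(V,\mathcal B_{\mathrm{diag}}(N))$; $\mathcal B(N)$ is the $^*$-subalgebra of finite sums $\sum_nV^nb_n(\mathbb L)$ with $b_n(\mathbb L)\in\mathcal B_{\mathrm{diag}}(N)$.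 A derivation in $B(N)$ is a linear map $\delta:\mathcal B(N)\to B(N)$ satisfying the Leibniz rule. Let $\rho_\theta(b)=e^{i\theta\mathbb L}be^{-i\theta\mathbb L}$. $\delta$ is $n$-covariant if $\rho_\theta^{-1}(\delta(\rho_\theta(b)))=e^{-in\theta}\delta(b)$ for all $\theta\in[0,2\pi)$, $b\in\mathcal B(N)$. Every $n$-covariant $\delta$ has the form $\delta(b)=[V^n\eta_n(\mathbb L),b]$ (commutator computed on the linear span of $\{E_l\}$) for a diagonal operator $\eta_n(\mathbb L)$; fix such $\eta_n$. If $N$ is infinite and $n\ne0$, or $N$ is finite and $N\nmid n$, then $\eta_n(\mathbb L)=h_n(q(\mathbb L))$ with $h_n\in C(\mathbb Z/N\mathbb Z)$. Otherwise $\eta_n(\mathbb L+I)-\eta_n(\mathbb L)=g_n(q(\mathbb L))$ with $g_n\in C(\mathbb Z/N\mathbb Z)$, and one decomposes $g_n=C_n+\tilde g_n$ with $C_n$ constant and $\int\tilde g_n\,d_Hx=0$, and $\eta_n(\mathbb L)=C_n\mathbb L+\tilde\eta_n(\mathbb L)$ with $\tilde g_n(q(\mathbb L))=\tilde\eta_n(\mathbb L+I)-\tilde\eta_n(\mathbb L)$; when $N$ is finite and $N\mid n$, $\tilde\eta_n(\mathbb L)=\tilde h_n(q(\mathbb L))$ with $\tilde h_n\in C(\mathbb Z/N\mathbb Z)$. The sum $\tilde g_0(x+m-1)+\cdots+\tilde g_0(x)$ is $0$ for $m=0$ and $-(\tilde g_0(x-1)+\cdots+\tilde g_0(x+m))$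 for $m<0$. State: let $E(b)=\frac1{2\pi}\int_0^{2\pi}\rho_\theta(b)\,d\theta\in B_{\mathrm{diag}}(N)\cong C(\mathbb Z/N\mathbb Z)$ and $\tau_{\mathrm{Haar}}(b)=\int_{\mathbb Z/N\mathbb Z}E(b)(x)\,d_Hx$. Its GNS Hilbert space is identified with $L^2(\mathbb Z\times\mathbb Z/N\mathbb Z)$ (counting measure times $d_Hx$), the class of $b=\sum_nV^nf_n(q(\mathbb L))$ being $[b](m,x)=f_m(x)$. The GNS representation is $\pi_{\mathrm{Haar}}(V)f(m,x)=f(m-1,x)$, $\pi_{\mathrm{Haar}}(a(q(\mathbb L)))f(m,x)=a(x+m)f(m,x)$. $\mathcal D_{\tau_{\mathrm{Haar}}}=\pi_{\mathrm{Haar}}(\mathcal B(N))[I]$, and $V_{\theta}$ is the unitary with $V_\theta[b]=[\rho_\theta(b)]$. A covariant implementation of $\delta$ is a linear operator $D:\mathcal D_{\tau_{\mathrm{Haar}}}\to L^2(\mathbb Z\times\mathbb Z/N\mathbb Z)$ with $[D,\pi_{\mathrm{Haar}}(b)]=\pi_{\mathrm{Haar}}(\delta(b))$ on $\mathcal D_{\tau_{\mathrm{Haar}}}$ for all $b\in\mathcal B(N)$ and $V_\theta DV_\theta^{-1}=e^{in\theta}D$ for all $\theta$. An operator $D$ (replaced by its closure) has compact parametrices if and only if $(I+D^*D)^{-1/2}$ and $(I+DD^* )^{-1/2}$ are compact; take this as the definition. *)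

theory Defs
  imports "HOL-Analysis.Analysis"
begin

section \<open>Supernatural numbers and the group of residues\<close>

text \<open>Only the exponents at primes are ever used.\<close>

type_synonym supernat = "nat \<Rightarrow> enat"

definition sn_finite :: "supernat \<Rightarrow> bool" where
  "sn_finite N \<longleftrightarrow> (\<Sum>\<^sub>\<infinity>p\<in>{p. prime p}. N p) < \<infinity>"

text \<open>The ordinary positive integer represented by a finite supernatural number.\<close>

definition sn_value :: "supernat \<Rightarrow> nat" where
  "sn_value N = (\<Prod>p | prime p \<and> N p \<noteq> 0. p ^ the_enat (N p))"

definition sn_dvd :: "nat \<Rightarrow> supernat \<Rightarrow> bool" where
  "sn_dvd j N \<longleftrightarrow> j > 0 \<and> (\<forall>p. prime p \<longrightarrow> enat (multiplicity p j) \<le> N p)"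

text \<open>The inverse limit of the residue rings modulo the finite divisors of \<open>N\<close>: compatible families of
  representatives \<open>x j \<in> {0..<j}\<close>.  Its topology is the one inherited from the product topology on
  \<^typ>\<open>nat \<Rightarrow> int\<close>, where \<^typ>\<open>int\<close> is discrete.\<close>

definition ZN :: "supernat \<Rightarrow> (nat \<Rightarrow> int) set" where
  "ZN N = {x \<in> (\<Pi>\<^sub>E j\<in>{j. sn_dvd j N}. {0..<int j}).
      \<forall>j k. sn_dvd j N \<longrightarrow> sn_dvd k N \<longrightarrow> j dvd k \<longrightarrow> x k mod int j = x j}"

definition zq :: "supernat \<Rightarrow> int \<Rightarrow> nat \<Rightarrow> int" where
  "zq N l = (\<lambda>j\<in>{j. sn_dvd j N}. l mod int j)"

definition zadd :: "supernat \<Rightarrow> (nat \<Rightarrow> int) \<Rightarrow> (nat \<Rightarrow> int) \<Rightarrow> nat \<Rightarrow> int" where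
  "zadd N x y = (\<lambda>j\<in>{j. sn_dvd j N}. (x j + y j) mod int j)"

definition zshift :: "supernat \<Rightarrow> (nat \<Rightarrow> int) \<Rightarrow> int \<Rightarrow> nat \<Rightarrow> int" where
  "zshift N x m = zadd N x (zq N m)"

definition haar_measure :: "supernat \<Rightarrow> (nat \<Rightarrow> int) measure \<Rightarrow> bool" where
  "haar_measure N \<mu> \<longleftrightarrow> sets \<mu> = sets (restrict_space borel (ZN N)) \<and> emeasure \<mu> (ZN N) = 1 \<and>
     (\<forall>y\<in>ZN N. \<forall>A\<in>sets \<mu>. emeasure \<mu> (zadd N y ` A) = emeasure \<mu> A)"

lemma zq_in_ZN: "zq N l \<in> ZN N"
proof -
  have "zq N l k mod int j = zq N l j" if "sn_dvd j N" "sn_dvd k N" "j dvd k" for j k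
    using that by (simp add: zq_def mod_mod_cancel)
  then show ?thesis by (simp add: ZN_def zq_def sn_dvd_def)
qed

lemma sn_dvd_Lcm:
  assumes "finite A" "\<And>j. j \<in> A \<Longrightarrow> sn_dvd j N"
  shows "sn_dvd (Lcm A) N"
  using assms
proof (induction A rule: finite_induct)
  case empty
  show ?case by (simp add: sn_dvd_def zero_enat_def[symmetric])
next
  case (insert a A)
  have a: "sn_dvd a N" and A: "sn_dvd (Lcm A) N" using insert by auto
  have pos: "a \<noteq> 0" "Lcm A \<noteq> 0" using a A by (auto simp: sn_dvd_def)
  have "enat (multiplicity p (lcm a (Lcm A))) \<le> N p" if "prime p" for p
  proof -
    have "multiplicity p (lcm a (Lcm A)) = max (multiplicity p a) (multiplicity p (Lcm A))"
      by (rule multiplicity_lcm[OF pos that])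
    then show ?thesis using a A that unfolding sn_dvd_def max_def by presburger
  qed
  moreover have "lcm a (Lcm A) > 0" using pos lcm_pos_nat by blast
  ultimately show ?case by (simp add: sn_dvd_def)
qed

lemma zq_dense:
  assumes x: "x \<in> ZN N"
  shows "\<exists>s. (\<lambda>k. zq N (s k)) \<longlonglongrightarrow> x"
proof -
  define L where "L k = Lcm {j. j \<le> k \<and> sn_dvd j N}" for k
  have L: "sn_dvd (L k) N" for k
    unfolding L_def by (rule sn_dvd_Lcm) auto
  have "(\<lambda>k. zq N (x (L k)) j) \<longlonglongrightarrow> x j" for j
  proof -
    have "zq N (x (L k)) j = x j" if k: "k \<ge> j" for k
    proof (cases "sn_dvd j N")
      case True
      then have "j dvd L k" unfolding L_def using k by (intro dvd_Lcm) simp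
      then have "x (L k) mod int j = x j" using x True L[of k] unfolding ZN_def by blast
      then show ?thesis using True by (simp add: zq_def)
    next
      case False
      have "x \<in> (\<Pi>\<^sub>E j\<in>{j. sn_dvd j N}. {0..<int j})" using x by (simp add: ZN_def)
      then have "x j = undefined" using False by (intro PiE_arb) auto
      then show ?thesis using False by (simp add: zq_def)
    qed
    then have "\<forall>\<^sub>F k in sequentially. zq N (x (L k)) j = x j"
      by (rule eventually_sequentiallyI)
    then show ?thesis by (rule tendsto_eventually)
  qed
  then have "limitin (product_topology (\<lambda>_. euclidean) UNIV) (\<lambda>k. zq N (x (L k))) x sequentially"
    unfolding limitin_componentwise by simp
  then have "(\<lambda>k. zq N (x (L k))) \<longlonglongrightarrow> x"
    unfolding euclidean_product_topology by simp
  then show ?thesis by (intro exI)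
qed

lemma continuous_on_ZN_eqI:
  fixes f g :: "(nat \<Rightarrow> int) \<Rightarrow> complex"
  assumes "continuous_on (ZN N) f" "continuous_on (ZN N) g"
    and eq: "\<And>l. f (zq N l) = g (zq N l)" and x: "x \<in> ZN N"
  shows "f x = g x"
proof -
  obtain s where s: "(\<lambda>k. zq N (s k)) \<longlonglongrightarrow> x" using zq_dense[OF x] by blast
  have ev: "\<forall>\<^sub>F k in sequentially. zq N (s k) \<in> ZN N" by (simp add: zq_in_ZN)
  have "(\<lambda>k. f (zq N (s k))) \<longlonglongrightarrow> f x"
    by (rule continuous_on_tendsto_compose[OF assms(1) s x ev])
  moreover have "(\<lambda>k. g (zq N (s k))) \<longlonglongrightarrow> g x"
    by (rule continuous_on_tendsto_compose[OF assms(2) s x ev])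
  ultimately show ?thesis unfolding eq by (rule LIMSEQ_unique)
qed

section \<open>Operators on the Hilbert space of square-summable bilateral sequences\<close>

typedef ell2 = "{f :: int \<Rightarrow> complex. (\<lambda>l. (cmod (f l))\<^sup>2) summable_on UNIV}"
  by (rule exI[of _ "\<lambda>_. 0"]) simp

setup_lifting type_definition_ell2

lemma ell2_summable: "(\<lambda>l. (cmod (Rep_ell2 x l))\<^sup>2) summable_on UNIV"
  using Rep_ell2[of x] by simp

lemma square_summable_add:
  fixes f g :: "int \<Rightarrow> complex"
  assumes "(\<lambda>l. (cmod (f l))\<^sup>2) summable_on UNIV" "(\<lambda>l. (cmod (g l))\<^sup>2) summable_on UNIV"
  shows "(\<lambda>l. (cmod (f l + g l))\<^sup>2) summable_on UNIV"
proof (rule summable_on_comparison_test)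
  show "(\<lambda>l. 2 * (cmod (f l))\<^sup>2 + 2 * (cmod (g l))\<^sup>2) summable_on UNIV"
    using assms by (intro summable_on_add summable_on_cmult_right)
  fix l
  have "(cmod (f l + g l))\<^sup>2 \<le> (cmod (f l) + cmod (g l))\<^sup>2"
    by (intro power_mono norm_triangle_ineq) auto
  also have "\<dots> \<le> 2 * (cmod (f l))\<^sup>2 + 2 * (cmod (g l))\<^sup>2"
    using sum_squares_bound[of "cmod (f l)" "cmod (g l)"] by (simp add: power2_sum)
  finally show "(cmod (f l + g l))\<^sup>2 \<le> 2 * (cmod (f l))\<^sup>2 + 2 * (cmod (g l))\<^sup>2" .
qed auto

lemma square_summable_cmult:
  fixes f :: "int \<Rightarrow> complex"
  assumes "(\<lambda>l. (cmod (f l))\<^sup>2) summable_on UNIV"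
  shows "(\<lambda>l. (cmod (c * f l))\<^sup>2) summable_on UNIV"
  using assms by (auto simp: norm_mult power_mult_distrib intro: summable_on_cmult_right)

instantiation ell2 :: real_vector
begin

lift_definition zero_ell2 :: ell2 is "\<lambda>_. 0" by simp
lift_definition plus_ell2 :: "ell2 \<Rightarrow> ell2 \<Rightarrow> ell2" is "\<lambda>f g l. f l + g l"
  by (rule square_summable_add)
lift_definition uminus_ell2 :: "ell2 \<Rightarrow> ell2" is "\<lambda>f l. - f l" by simp
lift_definition minus_ell2 :: "ell2 \<Rightarrow> ell2 \<Rightarrow> ell2" is "\<lambda>f g l. f l - g l"
  subgoal for f g using square_summable_add[of f "\<lambda>l. - g l"] by simp
  done
lift_definition scaleR_ell2 :: "real \<Rightarrow> ell2 \<Rightarrow> ell2" is "\<lambda>r f l. complex_of_real r * f l"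
  by (rule square_summable_cmult)

instance
  by standard (transfer; simp add: algebra_simps fun_eq_iff)+

end

lemma inner_summable:
  "(\<lambda>l. inner (Rep_ell2 x l) (Rep_ell2 y l)) summable_on UNIV"
proof -
  have "(\<lambda>l. norm (inner (Rep_ell2 x l) (Rep_ell2 y l))) summable_on UNIV"
  proof (rule Infinite_Sum.abs_summable_on_comparison_test'[of "\<lambda>l. (cmod (Rep_ell2 x l))\<^sup>2 + (cmod (Rep_ell2 y l))\<^sup>2"])
    show "(\<lambda>l. (cmod (Rep_ell2 x l))\<^sup>2 + (cmod (Rep_ell2 y l))\<^sup>2) summable_on UNIV"
      by (intro summable_on_add ell2_summable)
    fix l
    have "norm (inner (Rep_ell2 x l) (Rep_ell2 y l)) \<le> cmod (Rep_ell2 x l) * cmod (Rep_ell2 y l)"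
      using Cauchy_Schwarz_ineq2 by auto
    also have "\<dots> \<le> (cmod (Rep_ell2 x l))\<^sup>2 + (cmod (Rep_ell2 y l))\<^sup>2"
      using sum_squares_bound[of "cmod (Rep_ell2 x l)" "cmod (Rep_ell2 y l)"]
        mult_nonneg_nonneg[OF norm_ge_zero norm_ge_zero, of "Rep_ell2 x l" "Rep_ell2 y l"]
      by linarith
    finally show "norm (inner (Rep_ell2 x l) (Rep_ell2 y l)) \<le> \<dots>" .
  qed
  then show ?thesis by (rule abs_summable_summable)
qed

text \<open>The real part of the complex inner product; it yields the norm and the operator norm.\<close>

instantiation ell2 :: real_inner
begin

definition inner_ell2 :: "ell2 \<Rightarrow> ell2 \<Rightarrow> real" where
  "inner_ell2 x y = (\<Sum>\<^sub>\<infinity>l. inner (Rep_ell2 x l) (Rep_ell2 y l))"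
definition norm_ell2 :: "ell2 \<Rightarrow> real" where
  "norm_ell2 x = sqrt (\<Sum>\<^sub>\<infinity>l. (cmod (Rep_ell2 x l))\<^sup>2)"
definition dist_ell2 :: "ell2 \<Rightarrow> ell2 \<Rightarrow> real" where
  "dist_ell2 x y = norm (x - y)"
definition sgn_ell2 :: "ell2 \<Rightarrow> ell2" where
  "sgn_ell2 x = inverse (norm x) *\<^sub>R x"
definition uniformity_ell2 :: "(ell2 \<times> ell2) filter" where
  "uniformity_ell2 = (INF e\<in>{0<..}. principal {(x, y). dist x y < e})"
definition open_ell2 :: "ell2 set \<Rightarrow> bool" where
  "open_ell2 U \<longleftrightarrow> (\<forall>x\<in>U. \<forall>\<^sub>F (x', y) in uniformity. x' = x \<longrightarrow> y \<in> U)"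

instance
proof
  fix x y z :: ell2 and r :: real
  show "dist x y = norm (x - y)" by (simp add: dist_ell2_def)
  show "sgn x = inverse (norm x) *\<^sub>R x" by (simp add: sgn_ell2_def)
  show "inner x y = inner y x" by (simp add: inner_ell2_def inner_commute)
  show "inner (x + y) z = inner x z + inner y z"
    unfolding inner_ell2_def
    by (simp add: plus_ell2.rep_eq inner_add_left infsum_add inner_summable)
  have "inner (complex_of_real r * a) b = r * inner a b" for a b :: complex
    by (simp add: inner_complex_def algebra_simps)
  then show "inner (r *\<^sub>R x) y = r * inner x y"
    unfolding inner_ell2_def by (simp add: scaleR_ell2.rep_eq infsum_cmult_right')
  have sq: "inner x x = (\<Sum>\<^sub>\<infinity>l. (cmod (Rep_ell2 x l))\<^sup>2)"
    by (simp add: inner_ell2_def power2_norm_eq_inner)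
  then show "0 \<le> inner x x" by (simp add: infsum_nonneg)
  show "norm x = sqrt (inner x x)" by (simp add: norm_ell2_def sq)
  show "inner x x = 0 \<longleftrightarrow> x = 0"
  proof
    assume 0: "inner x x = 0"
    have "(cmod (Rep_ell2 x l))\<^sup>2 = 0" for l
      by (rule nonneg_infsum_le_0D[of "\<lambda>l. (cmod (Rep_ell2 x l))\<^sup>2" UNIV])
        (use 0 sq ell2_summable in auto)
    then show "x = 0" by (simp add: Rep_ell2_inject[symmetric] zero_ell2.rep_eq fun_eq_iff)
  next
    assume "x = 0"
    then show "inner x x = 0" unfolding sq by (simp add: zero_ell2.rep_eq)
  qed
qed (auto simp: uniformity_ell2_def open_ell2_def)

end

definition cinner_ell2 :: "ell2 \<Rightarrow> ell2 \<Rightarrow> complex" where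
  "cinner_ell2 x y = (\<Sum>\<^sub>\<infinity>l. cnj (Rep_ell2 x l) * Rep_ell2 y l)"

lift_definition Evec :: "int \<Rightarrow> ell2" is "\<lambda>l k. if k = l then 1 else 0"
proof -
  fix l :: int
  have "(\<lambda>k. (cmod (if k = l then 1 else 0))\<^sup>2) summable_on UNIV
      \<longleftrightarrow> (\<lambda>k. (cmod (if k = l then 1 else 0))\<^sup>2) summable_on {l}"
    by (rule summable_on_cong_neutral) auto
  then show "(\<lambda>k. (cmod (if k = l then 1 else 0))\<^sup>2) summable_on UNIV" by simp
qed

text \<open>The linear span of the canonical basis.\<close>

definition fin_ell2 :: "ell2 set" where
  "fin_ell2 = {x. finite {l. Rep_ell2 x l \<noteq> 0}}"

text \<open>The operator \<open>V\<^sup>k w(\<bbbL>)\<close>.  It is meaningful on all of \<open>\<ell>\<^sup>2\<close> if \<open>w\<close> is bounded, and on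
  \<^const>\<open>fin_ell2\<close> for arbitrary \<open>w\<close>.\<close>

definition wshift :: "int \<Rightarrow> (int \<Rightarrow> complex) \<Rightarrow> ell2 \<Rightarrow> ell2" where
  "wshift k w x = Abs_ell2 (\<lambda>l. w (l - k) * Rep_ell2 x (l - k))"

lemma summable_on_int_shift:
  fixes f :: "int \<Rightarrow> real"
  shows "(\<lambda>l. f (l - k)) summable_on UNIV \<longleftrightarrow> f summable_on UNIV"
    and "(\<Sum>\<^sub>\<infinity>l. f (l - k)) = (\<Sum>\<^sub>\<infinity>l. f l)"
proof -
  have "bij (\<lambda>l. l - k)" by (rule bij_betwI[of _ _ _ "\<lambda>l. l + k"]) auto
  then show "(\<lambda>l. f (l - k)) summable_on UNIV \<longleftrightarrow> f summable_on UNIV"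
    and "(\<Sum>\<^sub>\<infinity>l. f (l - k)) = (\<Sum>\<^sub>\<infinity>l. f l)"
    by (rule summable_on_reindex_bij_betw, rule infsum_reindex_bij_betw)
qed

lemma wshift_le:
  assumes "\<And>l. cmod (w l) \<le> B"
  shows "(cmod (w l * Rep_ell2 x l))\<^sup>2 \<le> B\<^sup>2 * (cmod (Rep_ell2 x l))\<^sup>2"
  using assms[of l] by (auto simp: norm_mult power_mult_distrib intro!: mult_right_mono power_mono)

lemma wshift_summable:
  assumes "\<And>l. cmod (w l) \<le> B"
  shows "(\<lambda>l. (cmod (w l * Rep_ell2 x l))\<^sup>2) summable_on UNIV"
  by (rule summable_on_comparison_test[of "\<lambda>l. B\<^sup>2 * (cmod (Rep_ell2 x l))\<^sup>2"])
    (use wshift_le[of w B, OF assms] in \<open>auto intro!: summable_on_cmult_right ell2_summable\<close>)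

lemma Rep_wshift:
  assumes "\<And>l. cmod (w l) \<le> B"
  shows "Rep_ell2 (wshift k w x) l = w (l - k) * Rep_ell2 x (l - k)"
  unfolding wshift_def
  using summable_on_int_shift(1)[of "\<lambda>l. (cmod (w l * Rep_ell2 x l))\<^sup>2" k] wshift_summable[of w B x]
    assms by (subst Abs_ell2_inverse) auto

lemma Rep_wshift_fin:
  assumes "x \<in> fin_ell2"
  shows "Rep_ell2 (wshift k w x) l = w (l - k) * Rep_ell2 x (l - k)"
proof -
  let ?f = "\<lambda>l. (cmod (w l * Rep_ell2 x l))\<^sup>2"
  have "?f summable_on UNIV \<longleftrightarrow> ?f summable_on {l. Rep_ell2 x l \<noteq> 0}"
    by (rule summable_on_cong_neutral) auto
  then have "?f summable_on UNIV" using assms by (simp add: fin_ell2_def)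
  then show ?thesis
    unfolding wshift_def using summable_on_int_shift(1)[of ?f k] by (subst Abs_ell2_inverse) auto
qed

lemma bounded_linear_wshift:
  assumes B: "\<And>l. cmod (w l) \<le> B"
  shows "bounded_linear (wshift k w)"
proof (rule bounded_linear_intro[where K = "\<bar>B\<bar>"])
  note R = Rep_wshift[of w B, OF B]
  show "wshift k w (x + y) = wshift k w x + wshift k w y" for x y
    by (simp add: Rep_ell2_inject[symmetric] fun_eq_iff R plus_ell2.rep_eq algebra_simps)
  show "wshift k w (r *\<^sub>R x) = r *\<^sub>R wshift k w x" for r x
    by (simp add: Rep_ell2_inject[symmetric] fun_eq_iff R scaleR_ell2.rep_eq)
  fix x
  have "(\<Sum>\<^sub>\<infinity>l. (cmod (Rep_ell2 (wshift k w x) l))\<^sup>2) = (\<Sum>\<^sub>\<infinity>l. (cmod (w l * Rep_ell2 x l))\<^sup>2)"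
    using summable_on_int_shift(2)[of "\<lambda>l. (cmod (w l * Rep_ell2 x l))\<^sup>2" k] by (simp add: R)
  also have "\<dots> \<le> (\<Sum>\<^sub>\<infinity>l. B\<^sup>2 * (cmod (Rep_ell2 x l))\<^sup>2)"
    using wshift_le[of w B, OF B]
    by (intro infsum_mono summable_on_cmult_right ell2_summable wshift_summable[of w B, OF B])
  also have "\<dots> = B\<^sup>2 * (\<Sum>\<^sub>\<infinity>l. (cmod (Rep_ell2 x l))\<^sup>2)" by (rule infsum_cmult_right')
  finally have "norm (wshift k w x) \<le> sqrt (B\<^sup>2 * (\<Sum>\<^sub>\<infinity>l. (cmod (Rep_ell2 x l))\<^sup>2))"
    by (simp add: norm_ell2_def)
  then show "norm (wshift k w x) \<le> norm x * \<bar>B\<bar>"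
    by (simp add: norm_ell2_def real_sqrt_mult mult.commute)
qed

definition Vpow :: "int \<Rightarrow> ell2 \<Rightarrow>\<^sub>L ell2" where
  "Vpow k = Blinfun (wshift k (\<lambda>_. 1))"

text \<open>The operator \<open>w(\<bbbL>)\<close>, for bounded \<open>w\<close>.\<close>

definition diag_op :: "(int \<Rightarrow> complex) \<Rightarrow> ell2 \<Rightarrow>\<^sub>L ell2" where
  "diag_op w = Blinfun (wshift 0 w)"

lemma Rep_Vpow [simp]: "Rep_ell2 (blinfun_apply (Vpow k) x) l = Rep_ell2 x (l - k)"
  using Rep_wshift[of "\<lambda>_. 1" 1] bounded_linear_wshift[of "\<lambda>_. 1" 1]
  by (simp add: Vpow_def bounded_linear_Blinfun_apply)

lemma Rep_diag_op:
  assumes "\<And>l. cmod (w l) \<le> B"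
  shows "Rep_ell2 (blinfun_apply (diag_op w) x) l = w l * Rep_ell2 x l"
  using Rep_wshift[of w B] bounded_linear_wshift[of w B] assms
  by (simp add: diag_op_def bounded_linear_Blinfun_apply)

lemma Vpow_basis: "Vpow 1 (Evec l) = Evec (l + 1)"
  by (auto simp: Rep_ell2_inject[symmetric] fun_eq_iff Evec.rep_eq)

lemma Vpow_0: "Vpow 0 = id_blinfun"
  by (intro blinfun_eqI) (simp add: Rep_ell2_inject[symmetric] fun_eq_iff)

lemma Vpow_add: "Vpow (j + k) = Vpow j o\<^sub>L Vpow k"
  by (intro blinfun_eqI) (simp add: Rep_ell2_inject[symmetric] fun_eq_iff algebra_simps)

definition cscale :: "complex \<Rightarrow> (ell2 \<Rightarrow>\<^sub>L ell2) \<Rightarrow> (ell2 \<Rightarrow>\<^sub>L ell2)" where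
  "cscale c T = diag_op (\<lambda>_. c) o\<^sub>L T"

definition is_adjoint :: "(ell2 \<Rightarrow>\<^sub>L ell2) \<Rightarrow> (ell2 \<Rightarrow>\<^sub>L ell2) \<Rightarrow> bool" where
  "is_adjoint S T \<longleftrightarrow> (\<forall>x y. cinner_ell2 (S x) y = cinner_ell2 x (T y))"

definition closed_star_subalgebra :: "(ell2 \<Rightarrow>\<^sub>L ell2) set \<Rightarrow> bool" where
  "closed_star_subalgebra A \<longleftrightarrow> 0 \<in> A \<and> closed A \<and>
     (\<forall>S\<in>A. \<forall>T\<in>A. S + T \<in> A \<and> S o\<^sub>L T \<in> A) \<and> (\<forall>c. \<forall>S\<in>A. cscale c S \<in> A) \<and>
     (\<forall>S\<in>A. \<forall>T. is_adjoint S T \<longrightarrow> T \<in> A)"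

definition cstar_generated :: "(ell2 \<Rightarrow>\<^sub>L ell2) set \<Rightarrow> (ell2 \<Rightarrow>\<^sub>L ell2) set" where
  "cstar_generated G = \<Inter> {A. closed_star_subalgebra A \<and> G \<subseteq> A}"

section \<open>Bunce-Deddens algebras and their covariant derivations\<close>

definition Bdiag_poly :: "supernat \<Rightarrow> (ell2 \<Rightarrow>\<^sub>L ell2) set" where
  "Bdiag_poly N = {diag_op w |w. \<exists>j. sn_dvd j N \<and> (\<forall>l. w (l + int j) = w l)}"

definition BD :: "supernat \<Rightarrow> (ell2 \<Rightarrow>\<^sub>L ell2) set" where
  "BD N = cstar_generated (insert (Vpow 1) (Bdiag_poly N))"

definition BD_poly :: "supernat \<Rightarrow> (ell2 \<Rightarrow>\<^sub>L ell2) set" where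
  "BD_poly N = {(\<Sum>k\<in>F. Vpow k o\<^sub>L b k) |F b. finite F \<and> (\<forall>k\<in>F. b k \<in> Bdiag_poly N)}"

definition BD_derivation :: "supernat \<Rightarrow> ((ell2 \<Rightarrow>\<^sub>L ell2) \<Rightarrow> (ell2 \<Rightarrow>\<^sub>L ell2)) \<Rightarrow> bool" where
  "BD_derivation N \<delta> \<longleftrightarrow>
     (\<forall>a\<in>BD_poly N. \<delta> a \<in> BD N) \<and>
     (\<forall>a\<in>BD_poly N. \<forall>b\<in>BD_poly N. \<delta> (a + b) = \<delta> a + \<delta> b) \<and>
     (\<forall>c. \<forall>a\<in>BD_poly N. \<delta> (cscale c a) = cscale c (\<delta> a)) \<and>
     (\<forall>a\<in>BD_poly N. \<forall>b\<in>BD_poly N. \<delta> (a o\<^sub>L b) = (\<delta> a o\<^sub>L b) + (a o\<^sub>L \<delta> b))"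

definition rho :: "real \<Rightarrow> (ell2 \<Rightarrow>\<^sub>L ell2) \<Rightarrow> (ell2 \<Rightarrow>\<^sub>L ell2)" where
  "rho \<theta> b = diag_op (\<lambda>l. cis (\<theta> * of_int l)) o\<^sub>L b o\<^sub>L diag_op (\<lambda>l. cis (- \<theta> * of_int l))"

definition covariant_derivation ::
    "supernat \<Rightarrow> int \<Rightarrow> ((ell2 \<Rightarrow>\<^sub>L ell2) \<Rightarrow> (ell2 \<Rightarrow>\<^sub>L ell2)) \<Rightarrow> bool" where
  "covariant_derivation N n \<delta> \<longleftrightarrow> BD_derivation N \<delta> \<and>
     (\<forall>\<theta>\<in>{0..<2 * pi}. \<forall>b\<in>BD_poly N.
        rho (- \<theta>) (\<delta> (rho \<theta> b)) = cscale (cis (- of_int n * \<theta>)) (\<delta> b))"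

text \<open>\<open>\<delta>(b) = [V\<^sup>n \<eta>(\<bbbL>), b]\<close>, the commutator being computed on the span of the canonical basis.\<close>

definition commutator_form ::
    "supernat \<Rightarrow> int \<Rightarrow> ((ell2 \<Rightarrow>\<^sub>L ell2) \<Rightarrow> (ell2 \<Rightarrow>\<^sub>L ell2)) \<Rightarrow> (int \<Rightarrow> complex) \<Rightarrow> bool" where
  "commutator_form N n \<delta> \<eta> \<longleftrightarrow>
     (\<forall>b\<in>BD_poly N. \<forall>x\<in>fin_ell2. \<delta> b x = wshift n \<eta> (b x) - b (wshift n \<eta> x))"

definition sn_dvd_int :: "supernat \<Rightarrow> int \<Rightarrow> bool" where
  "sn_dvd_int N n \<longleftrightarrow> int (sn_value N) dvd n"

text \<open>The case in which \<open>\<eta>\<close> itself extends continuously.\<close>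

definition inner_case :: "supernat \<Rightarrow> int \<Rightarrow> bool" where
  "inner_case N n \<longleftrightarrow> \<not> sn_finite N \<and> n \<noteq> 0 \<or> sn_finite N \<and> \<not> sn_dvd_int N n"

text \<open>The data attached to \<open>\<eta>\<close>; here \<open>h\<close> is only constrained in the first case, \<open>C\<close>, \<open>gt\<close> only
  outside it, and \<open>ht\<close> only if \<open>N\<close> is finite and divides \<open>n\<close>.\<close>

definition associated_data ::
    "supernat \<Rightarrow> (nat \<Rightarrow> int) measure \<Rightarrow> int \<Rightarrow> (int \<Rightarrow> complex) \<Rightarrow> ((nat \<Rightarrow> int) \<Rightarrow> complex) \<Rightarrow>
     complex \<Rightarrow> ((nat \<Rightarrow> int) \<Rightarrow> complex) \<Rightarrow> ((nat \<Rightarrow> int) \<Rightarrow> complex) \<Rightarrow> bool" where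
  "associated_data N \<mu> n \<eta> h C gt ht \<longleftrightarrow>
     (inner_case N n \<longrightarrow> continuous_on (ZN N) h \<and> (\<forall>l. \<eta> l = h (zq N l))) \<and>
     (\<not> inner_case N n \<longrightarrow>
        (\<exists>g. continuous_on (ZN N) g \<and> (\<forall>l. \<eta> (l + 1) - \<eta> l = g (zq N l)) \<and>
           (\<forall>x\<in>ZN N. g x = C + gt x)) \<and>
        continuous_on (ZN N) gt \<and> (LINT x|\<mu>. gt x) = 0 \<and>
        (\<exists>\<eta>t. (\<forall>l. \<eta> l = C * of_int l + \<eta>t l) \<and> (\<forall>l. gt (zq N l) = \<eta>t (l + 1) - \<eta>t l) \<and>
           (sn_finite N \<and> sn_dvd_int N n \<longrightarrow>
              continuous_on (ZN N) ht \<and> (\<forall>l. \<eta>t l = ht (zq N l)))))"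

text \<open>\<open>gt(x + m - 1) + \<dots> + gt(x)\<close>, with the usual convention for negative \<open>m\<close>.\<close>

definition orbit_sum ::
    "supernat \<Rightarrow> ((nat \<Rightarrow> int) \<Rightarrow> complex) \<Rightarrow> int \<Rightarrow> (nat \<Rightarrow> int) \<Rightarrow> complex" where
  "orbit_sum N gt m x =
     (if 0 \<le> m then \<Sum>k\<in>{0..<m}. gt (zshift N x k) else - (\<Sum>k\<in>{m..<0}. gt (zshift N x k)))"

section \<open>Operators on \<open>L\<^sup>2\<close> and compact parametrices\<close>

text \<open>Elements of \<open>L\<^sup>2\<close> are represented by functions, and equality in \<open>L\<^sup>2\<close> is equality almost
  everywhere.  The domains of operators are saturated under this equivalence.\<close>

definition L2 :: "'a measure \<Rightarrow> ('a \<Rightarrow> complex) set" where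
  "L2 M = {f \<in> borel_measurable M. integrable M (\<lambda>x. (cmod (f x))\<^sup>2)}"

definition L2_norm :: "'a measure \<Rightarrow> ('a \<Rightarrow> complex) \<Rightarrow> real" where
  "L2_norm M f = sqrt (LINT x|M. (cmod (f x))\<^sup>2)"

definition L2_inner :: "'a measure \<Rightarrow> ('a \<Rightarrow> complex) \<Rightarrow> ('a \<Rightarrow> complex) \<Rightarrow> complex" where
  "L2_inner M f g = (LINT x|M. cnj (f x) * g x)"

definition L2_linear ::
    "'a measure \<Rightarrow> ('a \<Rightarrow> complex) set \<Rightarrow> (('a \<Rightarrow> complex) \<Rightarrow> ('a \<Rightarrow> complex)) \<Rightarrow> bool" where
  "L2_linear M W T \<longleftrightarrow>
     (\<forall>f\<in>W. T f \<in> L2 M) \<and>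
     (\<forall>f\<in>W. \<forall>g\<in>W. (AE x in M. f x = g x) \<longrightarrow> (AE x in M. T f x = T g x)) \<and>
     (\<forall>f\<in>W. \<forall>g\<in>W. AE x in M. T (\<lambda>y. f y + g y) x = T f x + T g x) \<and>
     (\<forall>c. \<forall>f\<in>W. AE x in M. T (\<lambda>y. c * f y) x = c * T f x)"

definition L2_positive :: "'a measure \<Rightarrow> (('a \<Rightarrow> complex) \<Rightarrow> ('a \<Rightarrow> complex)) \<Rightarrow> bool" where
  "L2_positive M R \<longleftrightarrow> L2_linear M (L2 M) R \<and>
     (\<exists>K. \<forall>f\<in>L2 M. L2_norm M (R f) \<le> K * L2_norm M f) \<and>
     (\<forall>f\<in>L2 M. Im (L2_inner M f (R f)) = 0 \<and> Re (L2_inner M f (R f)) \<ge> 0)"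

definition L2_compact :: "'a measure \<Rightarrow> (('a \<Rightarrow> complex) \<Rightarrow> ('a \<Rightarrow> complex)) \<Rightarrow> bool" where
  "L2_compact M R \<longleftrightarrow>
     (\<forall>s :: nat \<Rightarrow> 'a \<Rightarrow> complex. (\<forall>k. s k \<in> L2 M) \<and> (\<exists>K. \<forall>k. L2_norm M (s k) \<le> K) \<longrightarrow>
        (\<exists>r g. strict_mono (r :: nat \<Rightarrow> nat) \<and> g \<in> L2 M \<and>
           (\<lambda>k. L2_norm M (\<lambda>x. R (s (r k)) x - g x)) \<longlonglongrightarrow> 0))"

text \<open>Unbounded operators are handled through their graphs, so that composition is relational
  composition: if \<open>G\<close> is the graph of \<open>T\<close> and \<open>H\<close> that of \<open>S\<close>, then \<open>G O H\<close> is that of \<open>S T\<close>.\<close>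

definition closure_graph ::
    "'a measure \<Rightarrow> ('a \<Rightarrow> complex) set \<Rightarrow> (('a \<Rightarrow> complex) \<Rightarrow> ('a \<Rightarrow> complex)) \<Rightarrow>
     (('a \<Rightarrow> complex) \<times> ('a \<Rightarrow> complex)) set" where
  "closure_graph M W T = {(f, g). f \<in> L2 M \<and> g \<in> L2 M \<and>
     (\<exists>s :: nat \<Rightarrow> 'a \<Rightarrow> complex. (\<forall>k. s k \<in> W) \<and>
        (\<lambda>k. L2_norm M (\<lambda>x. s k x - f x)) \<longlonglongrightarrow> 0 \<and>
        (\<lambda>k. L2_norm M (\<lambda>x. T (s k) x - g x)) \<longlonglongrightarrow> 0)}"

definition adjoint_graph ::
    "'a measure \<Rightarrow> (('a \<Rightarrow> complex) \<times> ('a \<Rightarrow> complex)) set \<Rightarrow>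
     (('a \<Rightarrow> complex) \<times> ('a \<Rightarrow> complex)) set" where
  "adjoint_graph M G = {(g, h). g \<in> L2 M \<and> h \<in> L2 M \<and>
     (\<forall>(f, f') \<in> G. L2_inner M f' g = L2_inner M f h)}"

text \<open>The graph of \<open>(I + A)\<^sup>-\<^sup>1\<close>, where \<open>A\<close> is given by its graph.\<close>

definition resolvent_graph ::
    "'a measure \<Rightarrow> (('a \<Rightarrow> complex) \<times> ('a \<Rightarrow> complex)) set \<Rightarrow>
     (('a \<Rightarrow> complex) \<times> ('a \<Rightarrow> complex)) set" where
  "resolvent_graph M A = {(g, f). g \<in> L2 M \<and>
     (\<exists>h. (f, h) \<in> A \<and> (AE x in M. g x = f x + h x))}"

text \<open>\<open>R\<close> is the positive square root \<open>(I + A)\<^sup>-\<^sup>1\<^sup>/\<^sup>2\<close> of the everywhere defined operator \<open>(I + A)\<^sup>-\<^sup>1\<close>.\<close>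

definition inv_sqrt ::
    "'a measure \<Rightarrow> (('a \<Rightarrow> complex) \<times> ('a \<Rightarrow> complex)) set \<Rightarrow>
     (('a \<Rightarrow> complex) \<Rightarrow> ('a \<Rightarrow> complex)) \<Rightarrow> bool" where
  "inv_sqrt M A R \<longleftrightarrow> L2_positive M R \<and>
     (\<forall>g\<in>L2 M. \<forall>f\<in>L2 M. (g, f) \<in> resolvent_graph M A \<longleftrightarrow> (AE x in M. f x = R (R g) x))"

text \<open>The operator \<open>T\<close> with domain \<open>W\<close> is replaced by its closure \<open>G\<close>.  If \<open>T\<close> is not closable, \<open>G\<close> is
  only a linear relation; the covariant implementations below are closable.\<close>

definition compact_parametrices ::
    "'a measure \<Rightarrow> ('a \<Rightarrow> complex) set \<Rightarrow> (('a \<Rightarrow> complex) \<Rightarrow> ('a \<Rightarrow> complex)) \<Rightarrow> bool" where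
  "compact_parametrices M W T \<longleftrightarrow>
     (let G = closure_graph M W T; Gs = adjoint_graph M G in
        (\<exists>R. inv_sqrt M (G O Gs) R \<and> L2_compact M R) \<and>
        (\<exists>R. inv_sqrt M (Gs O G) R \<and> L2_compact M R))"

section \<open>The GNS representation of the Haar state\<close>

definition gns_measure :: "(nat \<Rightarrow> int) measure \<Rightarrow> (int \<times> (nat \<Rightarrow> int)) measure" where
  "gns_measure \<mu> = count_space UNIV \<Otimes>\<^sub>M \<mu>"

text \<open>The function \<open>f\<^sub>k\<close> in the expansion \<open>b = \<Sum>\<^sub>k V\<^sup>k f\<^sub>k(q(\<bbbL>))\<close>: since the diagonal operator
  \<open>f\<^sub>k(q(\<bbbL>)) = E(V\<^sup>-\<^sup>k b)\<close> has the entries \<open>\<langle>E\<^bsub>l+k\<^esub>, b E\<^sub>l\<rangle>\<close>, it is the continuous extension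
  of these entries, which is unique on \<^term>\<open>ZN N\<close> by density.\<close>

definition is_coeff ::
    "supernat \<Rightarrow> (ell2 \<Rightarrow>\<^sub>L ell2) \<Rightarrow> int \<Rightarrow> ((nat \<Rightarrow> int) \<Rightarrow> complex) \<Rightarrow> bool" where
  "is_coeff N b k f \<longleftrightarrow> continuous_on (ZN N) f \<and> (\<forall>l. f (zq N l) = Rep_ell2 (b (Evec l)) (l + k))"

definition fcoeff :: "supernat \<Rightarrow> (ell2 \<Rightarrow>\<^sub>L ell2) \<Rightarrow> int \<Rightarrow> (nat \<Rightarrow> int) \<Rightarrow> complex" where
  "fcoeff N b k = (SOME f. is_coeff N b k f)"

definition gns_class :: "supernat \<Rightarrow> (ell2 \<Rightarrow>\<^sub>L ell2) \<Rightarrow> int \<times> (nat \<Rightarrow> int) \<Rightarrow> complex" where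
  "gns_class N b = (\<lambda>(m, x). fcoeff N b m x)"

text \<open>By the formulas for the generators, \<open>\<pi>(V\<^sup>k f\<^sub>k(q(\<bbbL>)))\<close> maps \<open>f\<close> to
  \<open>(m, x) \<mapsto> f\<^sub>k(x + m - k) f(m - k, x)\<close>; these terms are summed over \<open>k\<close>.  For almost every \<open>x\<close> the
  sum is a matrix row of a bounded operator on \<open>\<ell>\<^sup>2\<close> applied to \<open>f(-, x)\<close>, hence converges absolutely.\<close>

definition gns_rep ::
    "supernat \<Rightarrow> (ell2 \<Rightarrow>\<^sub>L ell2) \<Rightarrow> (int \<times> (nat \<Rightarrow> int) \<Rightarrow> complex) \<Rightarrow> int \<times> (nat \<Rightarrow> int) \<Rightarrow> complex" where
  "gns_rep N b f = (\<lambda>(m, x). \<Sum>\<^sub>\<infinity>k. fcoeff N b k (zshift N x (m - k)) * f (m - k, x))"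

definition gns_domain ::
    "supernat \<Rightarrow> (nat \<Rightarrow> int) measure \<Rightarrow> (int \<times> (nat \<Rightarrow> int) \<Rightarrow> complex) set" where
  "gns_domain N \<mu> = {f \<in> L2 (gns_measure \<mu>). \<exists>b\<in>BD_poly N.
     AE z in gns_measure \<mu>. f z = gns_rep N b (gns_class N id_blinfun) z}"

text \<open>The unitary \<open>V\<^sub>\<theta>\<close>; see \<open>gns_class_rho\<close> below.\<close>

definition Vtheta :: "real \<Rightarrow> (int \<times> (nat \<Rightarrow> int) \<Rightarrow> complex) \<Rightarrow> int \<times> (nat \<Rightarrow> int) \<Rightarrow> complex" where
  "Vtheta \<theta> f = (\<lambda>(m, x). cis (\<theta> * of_int m) * f (m, x))"

definition covariant_implementation ::
    "supernat \<Rightarrow> (nat \<Rightarrow> int) measure \<Rightarrow> int \<Rightarrow> ((ell2 \<Rightarrow>\<^sub>L ell2) \<Rightarrow> (ell2 \<Rightarrow>\<^sub>L ell2)) \<Rightarrow>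
     ((int \<times> (nat \<Rightarrow> int) \<Rightarrow> complex) \<Rightarrow> int \<times> (nat \<Rightarrow> int) \<Rightarrow> complex) \<Rightarrow> bool" where
  "covariant_implementation N \<mu> n \<delta> D \<longleftrightarrow>
     L2_linear (gns_measure \<mu>) (gns_domain N \<mu>) D \<and>
     (\<forall>b\<in>BD_poly N. \<forall>f\<in>gns_domain N \<mu>. AE z in gns_measure \<mu>.
        D (gns_rep N b f) z - gns_rep N b (D f) z = gns_rep N (\<delta> b) f z) \<and>
     (\<forall>\<theta>. \<forall>f\<in>gns_domain N \<mu>. AE z in gns_measure \<mu>.
        Vtheta \<theta> (D (Vtheta (- \<theta>) f)) z = cis (of_int n * \<theta>) * D f z)"

lemma zshift_in_ZN:
  assumes "x \<in> ZN N"
  shows "zshift N x m \<in> ZN N"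
proof -
  have "zshift N x m k mod int j = zshift N x m j"
    if "sn_dvd j N" "sn_dvd k N" "j dvd k" for j k
  proof -
    have "zshift N x m k mod int j = (x k + m) mod int j"
      using that by (simp add: zshift_def zadd_def zq_def mod_mod_cancel mod_add_right_eq)
    also have "\<dots> = (x k mod int j + m) mod int j" by (simp add: mod_add_left_eq)
    also have "x k mod int j = x j" using assms that by (auto simp: ZN_def)
    finally show ?thesis
      using that by (simp add: zshift_def zadd_def zq_def mod_add_right_eq)
  qed
  moreover have "zshift N x m \<in> (\<Pi>\<^sub>E j\<in>{j. sn_dvd j N}. {0..<int j})"
    by (simp add: zshift_def zadd_def sn_dvd_def)
  ultimately show ?thesis unfolding ZN_def by blast
qed

lemma fcoeff_eqI:
  assumes "is_coeff N b k f" "x \<in> ZN N"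
  shows "fcoeff N b k x = f x"
proof -
  have f': "is_coeff N b k (fcoeff N b k)" unfolding fcoeff_def
    by (rule someI[of "is_coeff N b k", OF assms(1)])
  show ?thesis
    by (rule continuous_on_ZN_eqI[OF _ _ _ assms(2)])
      (use assms(1) f' in \<open>simp_all add: is_coeff_def\<close>)
qed

lemma is_coeff_monomial:
  assumes "continuous_on (ZN N) a" "\<And>l. cmod (a (zq N l)) \<le> B"
  shows "is_coeff N (Vpow j o\<^sub>L diag_op (\<lambda>l. a (zq N l))) k (if k = j then a else (\<lambda>_. 0))"
  using assms by (auto simp: is_coeff_def Rep_diag_op[of "\<lambda>l. a (zq N l)" B] Evec.rep_eq)

lemma gns_rep_monomial:
  assumes "continuous_on (ZN N) a" "\<And>l. cmod (a (zq N l)) \<le> B" "x \<in> ZN N"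
  shows "gns_rep N (Vpow j o\<^sub>L diag_op (\<lambda>l. a (zq N l))) f (m, x) =
    a (zshift N x (m - j)) * f (m - j, x)"
proof -
  let ?b = "Vpow j o\<^sub>L diag_op (\<lambda>l. a (zq N l))"
  let ?t = "\<lambda>k. fcoeff N ?b k (zshift N x (m - k)) * f (m - k, x)"
  have t: "?t k = (if k = j then a (zshift N x (m - j)) * f (m - j, x) else 0)" for k
    using fcoeff_eqI[OF is_coeff_monomial[OF assms(1,2)] zshift_in_ZN[OF assms(3)]] by simp
  have "(\<Sum>\<^sub>\<infinity>k. ?t k) = (\<Sum>\<^sub>\<infinity>k\<in>{j}. ?t k)"
    by (rule infsum_cong_neutral) (auto simp: t)
  then show ?thesis by (simp add: gns_rep_def t)
qed

lemma diag_op_1: "diag_op (\<lambda>_. 1) = id_blinfun"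
  using Vpow_0 by (simp add: Vpow_def diag_op_def)

lemma gns_rep_V:
  assumes "x \<in> ZN N"
  shows "gns_rep N (Vpow 1) f (m, x) = f (m - 1, x)"
proof -
  have "Vpow 1 o\<^sub>L diag_op (\<lambda>l. (\<lambda>_. 1) (zq N l)) = Vpow 1"
    unfolding diag_op_1 by (intro blinfun_eqI) simp
  then show ?thesis
    using gns_rep_monomial[of N "\<lambda>_. 1" 1 x 1 f m] assms by simp
qed

lemma gns_rep_diag:
  assumes "continuous_on (ZN N) a" "\<And>l. cmod (a (zq N l)) \<le> B" "x \<in> ZN N"
  shows "gns_rep N (diag_op (\<lambda>l. a (zq N l))) f (m, x) = a (zshift N x m) * f (m, x)"
proof -
  have "Vpow 0 o\<^sub>L diag_op (\<lambda>l. a (zq N l)) = diag_op (\<lambda>l. a (zq N l))"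
    unfolding Vpow_0 by (intro blinfun_eqI) simp
  then show ?thesis
    using gns_rep_monomial[OF assms, of 0 f m] by simp
qed

lemma gns_class_rho:
  assumes f: "is_coeff N b m f" and x: "x \<in> ZN N"
    and complex_linear: "\<And>c. b o\<^sub>L diag_op (\<lambda>_. c) = cscale c b"
  shows "gns_class N (rho \<theta> b) (m, x) = Vtheta \<theta> (gns_class N b) (m, x)"
proof -
  note D = Rep_diag_op[of _ 1]
  have "Rep_ell2 (rho \<theta> b (Evec l)) (l + m) = cis (\<theta> * of_int m) * Rep_ell2 (b (Evec l)) (l + m)"
    for l
  proof -
    let ?c = "cis (- \<theta> * of_int l)"
    have E: "diag_op (\<lambda>l. cis (- \<theta> * of_int l)) (Evec l) = diag_op (\<lambda>_. ?c) (Evec l)"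
      by (auto simp: Rep_ell2_inject[symmetric] fun_eq_iff Evec.rep_eq D)
    have "b (diag_op (\<lambda>_. ?c) (Evec l)) = diag_op (\<lambda>_. ?c) (b (Evec l))"
      using arg_cong[OF complex_linear[of ?c], of "\<lambda>T. blinfun_apply T (Evec l)"]
      by (simp add: cscale_def)
    then have "Rep_ell2 (rho \<theta> b (Evec l)) (l + m) =
        (cis (\<theta> * of_int (l + m)) * ?c) * Rep_ell2 (b (Evec l)) (l + m)"
      using E by (simp add: rho_def D)
    also have "cis (\<theta> * of_int (l + m)) * ?c = cis (\<theta> * of_int m)"
      by (simp add: cis_mult algebra_simps)
    finally show ?thesis .
  qed
  then have "is_coeff N (rho \<theta> b) m (\<lambda>x. cis (\<theta> * of_int m) * f x)"
    using f by (auto simp: is_coeff_def intro!: continuous_intros)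
  then show ?thesis
    using fcoeff_eqI[of N "rho \<theta> b" m _ x] fcoeff_eqI[OF f x] x
    by (simp add: gns_class_def Vtheta_def)
qed

end

theory Submission
  imports Defs
begin

text \<open>Write \<open>e = [I]\<close> for the cyclic vector.  Covariance forces \<open>D e\<close> to live on the slice \<open>m = n\<close>, and its
  restriction to that slice is \<open>\<psi>\<close>; the commutator relation \<open>D \<pi>(b) e = \<pi>(b) D e + \<pi>(\<delta>(b)) e\<close> then
  determines \<open>D\<close>, once the coefficients of \<open>\<delta>(b) = [V\<^sup>n \<eta>(\<bbbL>), b]\<close> are read off from its matrix entries.

  If \<open>D\<close> has compact parametrices, a bounded sequence of the domain on which \<open>D\<close> is bounded cannot be
  separated.  Outside the case \<open>N\<close> finite, \<open>N\<close> dividing \<open>n\<close> and \<open>C \<noteq> 0\<close> such a separated sequence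
  exists: the indicators of the slices \<open>m = k\<close> if the coefficients of \<open>D\<close> are bounded in \<open>m\<close>, and
  infinitely many characters of \<open>\<int>/N\<int>\<close> on the slice \<open>m = 0\<close> if \<open>N\<close> is infinite and \<open>n = 0\<close>.  In the
  remaining case \<open>D\<close> is a shift in \<open>m\<close> composed with multiplication by \<open>A(m, x) = C m + O(1)\<close>, so the two
  parametrices are multiplications by functions tending to \<open>0\<close> on a space with finite fibres over \<open>\<int>\<close>.\<close>

section \<open>Square-integrable functions\<close>

text \<open>Compactness is refuted by an estimate for pairs in the graphs that controls
  \<open>w\<close> by \<open>R (R w)\<close> and \<open>T w\<close>; it holds for linear relations
  and uses no functional calculus. The obstacle is that \<psi> is only known to be
  square-integrable. The test functions are therefore of modulus 1 on a single slice, where \<psi>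
  contributes at most its norm. For infinite N and n = 0 the coefficients may grow with m, so
  different slices are of no use; but on m = 0 both C m and the orbit sum vanish, and the infinite
  group still offers infinitely many orthonormal functions there. For finite N the group consists of
  finitely many atoms of equal positive mass: every function on it is continuous, \<psi> is bounded,
  and evaluation at a point is bounded on L2. Explicit multipliers then serve as inverse square
  roots, namely 1 / sqrt (1 + |A|^2) and its copy shifted by n.\<close>

lemma borel_measurable_cnj [measurable (raw)]:
  "f \<in> borel_measurable M \<Longrightarrow> (\<lambda>x. cnj (f x)) \<in> borel_measurable M"
  by (rule borel_measurable_continuous_on[OF continuous_on_cnj[OF continuous_on_id]])

lemma L2_measurable [measurable_dest]: "f \<in> L2 M \<Longrightarrow> f \<in> borel_measurable M"
  by (simp add: L2_def)

lemma L2_integrable: "f \<in> L2 M \<Longrightarrow> integrable M (\<lambda>x. (cmod (f x))\<^sup>2)"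
  by (simp add: L2_def)

lemma L2I_bound:
  assumes "g \<in> borel_measurable M" "integrable M F" "\<And>x. x \<in> space M \<Longrightarrow> (cmod (g x))\<^sup>2 \<le> F x"
  shows "g \<in> L2 M"
proof -
  have "AE x in M. norm ((cmod (g x))\<^sup>2) \<le> norm (F x)"
    using assms(3) by (intro AE_I2) force
  then have "integrable M (\<lambda>x. (cmod (g x))\<^sup>2)"
    using assms by (intro Bochner_Integration.integrable_bound[OF assms(2)]) auto
  then show ?thesis using assms by (simp add: L2_def)
qed

lemma L2_zero: "(\<lambda>_. 0) \<in> L2 M"
  by (simp add: L2_def)

lemma L2_add:
  assumes f: "f \<in> L2 M" and g: "g \<in> L2 M"
  shows "(\<lambda>x. f x + g x) \<in> L2 M"
proof (rule L2I_bound)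
  show "integrable M (\<lambda>x. 2 * (cmod (f x))\<^sup>2 + 2 * (cmod (g x))\<^sup>2)"
    using assms by (auto simp: L2_def)
  fix x
  have "(cmod (f x + g x))\<^sup>2 \<le> (cmod (f x) + cmod (g x))\<^sup>2"
    by (intro power_mono norm_triangle_ineq) auto
  also have "\<dots> \<le> 2 * (cmod (f x))\<^sup>2 + 2 * (cmod (g x))\<^sup>2"
    using sum_squares_bound[of "cmod (f x)" "cmod (g x)"] by (simp add: power2_sum)
  finally show "(cmod (f x + g x))\<^sup>2 \<le> 2 * (cmod (f x))\<^sup>2 + 2 * (cmod (g x))\<^sup>2" .
qed (use assms in \<open>auto simp: L2_def\<close>)

lemma L2_scale:
  assumes "f \<in> L2 M"
  shows "(\<lambda>x. c * f x) \<in> L2 M"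
  using assms by (auto simp: L2_def norm_mult power_mult_distrib)

lemma L2_diff:
  assumes "f \<in> L2 M" "g \<in> L2 M"
  shows "(\<lambda>x. f x - g x) \<in> L2 M"
  using L2_add[OF assms(1) L2_scale[OF assms(2), of "-1"]] by simp

lemma L2_AE_cong:
  assumes "f \<in> L2 M" "g \<in> borel_measurable M" "AE x in M. f x = g x"
  shows "g \<in> L2 M"
proof -
  have "integrable M (\<lambda>x. (cmod (f x))\<^sup>2) \<longleftrightarrow> integrable M (\<lambda>x. (cmod (g x))\<^sup>2)"
    using assms by (intro integrable_cong_AE) (auto simp: L2_def)
  then show ?thesis using assms by (simp add: L2_def)
qed

lemma L2_mult_bounded:
  assumes f: "f \<in> L2 M" and r: "r \<in> borel_measurable M"
    and B: "\<And>x. x \<in> space M \<Longrightarrow> cmod (r x) \<le> B"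
  shows "(\<lambda>x. r x * f x) \<in> L2 M"
proof (rule L2I_bound)
  show "integrable M (\<lambda>x. B\<^sup>2 * (cmod (f x))\<^sup>2)" using f by (simp add: L2_def)
  show "(\<lambda>x. r x * f x) \<in> borel_measurable M" using f r by (auto simp: L2_def)
  fix x assume "x \<in> space M"
  then show "(cmod (r x * f x))\<^sup>2 \<le> B\<^sup>2 * (cmod (f x))\<^sup>2"
    using B by (auto simp: norm_mult power_mult_distrib intro!: mult_right_mono power_mono)
qed

lemma L2_norm_nonneg: "0 \<le> L2_norm M f"
  by (simp add: L2_norm_def)

lemma L2_norm_power2: "(L2_norm M f)\<^sup>2 = (LINT x|M. (cmod (f x))\<^sup>2)"
  by (simp add: L2_norm_def)

lemma L2_norm_cong_AE:
  assumes "f \<in> borel_measurable M" "g \<in> borel_measurable M" "AE x in M. f x = g x"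
  shows "L2_norm M f = L2_norm M g"
  unfolding L2_norm_def using assms by (intro arg_cong[of _ _ sqrt] integral_cong_AE) auto

lemma L2_norm_mono:
  assumes "f \<in> L2 M" "g \<in> L2 M" "AE x in M. cmod (f x) \<le> cmod (g x)"
  shows "L2_norm M f \<le> L2_norm M g"
  unfolding L2_norm_def
  using assms by (intro real_sqrt_le_mono integral_mono_AE) (auto simp: L2_def)

lemma L2_norm_scale: "L2_norm M (\<lambda>x. c * f x) = cmod c * L2_norm M f"
  by (simp add: L2_norm_def norm_mult power_mult_distrib real_sqrt_mult)

lemma L2_norm_minus_commute: "L2_norm M (\<lambda>x. f x - g x) = L2_norm M (\<lambda>x. g x - f x)"
  by (simp add: L2_norm_def norm_minus_commute)

lemma L2_inner_integrable:
  assumes "f \<in> L2 M" "g \<in> L2 M"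
  shows "integrable M (\<lambda>x. cnj (f x) * g x)"
proof (rule Bochner_Integration.integrable_bound)
  show "integrable M (\<lambda>x. (cmod (f x))\<^sup>2 + (cmod (g x))\<^sup>2)" using assms by (auto simp: L2_def)
  show "AE x in M. norm (cnj (f x) * g x) \<le> norm ((cmod (f x))\<^sup>2 + (cmod (g x))\<^sup>2)"
  proof (rule AE_I2)
    fix x
    have "norm (cnj (f x) * g x) \<le> 2 * (cmod (f x) * cmod (g x))"
      by (simp add: norm_mult)
    also have "\<dots> \<le> (cmod (f x))\<^sup>2 + (cmod (g x))\<^sup>2"
      using sum_squares_bound[of "cmod (f x)" "cmod (g x)"] by simp
    finally show "norm (cnj (f x) * g x) \<le> norm ((cmod (f x))\<^sup>2 + (cmod (g x))\<^sup>2)" by simp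
  qed
qed (use assms in \<open>auto simp: L2_def\<close>)

lemma L2_inner_self: "L2_inner M f f = complex_of_real ((L2_norm M f)\<^sup>2)"
  unfolding L2_norm_power2
  by (simp add: L2_inner_def complex_norm_square mult.commute flip: integral_complex_of_real of_real_power)

lemma L2_inner_commute: "L2_inner M g f = cnj (L2_inner M f g)"
proof -
  have "cnj (L2_inner M f g) = (LINT x|M. cnj (cnj (f x) * g x))"
    unfolding L2_inner_def by (rule Bochner_Integration.integral_cnj[symmetric])
  then show ?thesis by (simp add: L2_inner_def mult.commute)
qed

lemma L2_inner_add_right:
  assumes "f \<in> L2 M" "g \<in> L2 M" "h \<in> L2 M"
  shows "L2_inner M f (\<lambda>x. g x + h x) = L2_inner M f g + L2_inner M f h"
  using L2_inner_integrable[OF assms(1,2)] L2_inner_integrable[OF assms(1,3)]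
  by (simp add: L2_inner_def distrib_left)

lemma L2_inner_diff_right:
  assumes "f \<in> L2 M" "g \<in> L2 M" "h \<in> L2 M"
  shows "L2_inner M f (\<lambda>x. g x - h x) = L2_inner M f g - L2_inner M f h"
  using L2_inner_integrable[OF assms(1,2)] L2_inner_integrable[OF assms(1,3)]
  by (simp add: L2_inner_def right_diff_distrib)

lemma L2_inner_diff_left:
  assumes "f \<in> L2 M" "g \<in> L2 M" "h \<in> L2 M"
  shows "L2_inner M (\<lambda>x. g x - h x) f = L2_inner M g f - L2_inner M h f"
  using L2_inner_integrable[OF assms(2,1)] L2_inner_integrable[OF assms(3,1)]
  by (simp add: L2_inner_def left_diff_distrib)

lemma L2_inner_cong_AE:
  assumes "f \<in> borel_measurable M" "g \<in> borel_measurable M" "f' \<in> borel_measurable M"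
    "g' \<in> borel_measurable M" "AE x in M. f x = f' x" "AE x in M. g x = g' x"
  shows "L2_inner M f g = L2_inner M f' g'"
  unfolding L2_inner_def using assms by (intro integral_cong_AE) auto

text \<open>Passing to \<open>cmod (f x) * cmod (g x)\<close> reduces this to the inequality for
  nonnegative integrals; integrability makes the way back to real integrals exact.\<close>

lemma L2_Cauchy_Schwarz:
  assumes f: "f \<in> L2 M" and g: "g \<in> L2 M"
  shows "cmod (L2_inner M f g) \<le> L2_norm M f * L2_norm M g"
proof -
  let ?I = "LINT x|M. cmod (f x) * cmod (g x)"
  have int: "integrable M (\<lambda>x. cmod (f x) * cmod (g x))"
    using integrable_norm[OF L2_inner_integrable[OF f g]] by (simp add: norm_mult)
  have "cmod (L2_inner M f g) \<le> (LINT x|M. cmod (cnj (f x) * g x))"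
    unfolding L2_inner_def by (rule integral_norm_bound)
  then have 1: "cmod (L2_inner M f g) \<le> ?I" by (simp add: norm_mult)
  have nn: "(\<integral>\<^sup>+x. ennreal (cmod (f x)) * ennreal (cmod (g x)) \<partial>M) = ennreal ?I"
    using int by (subst nn_integral_eq_integral[symmetric]) (auto simp: ennreal_mult)
  have sq: "(\<integral>\<^sup>+x. (ennreal (cmod (u x)))\<^sup>2 \<partial>M) = ennreal ((L2_norm M u)\<^sup>2)" if "u \<in> L2 M" for u
    unfolding L2_norm_power2
    using that by (subst nn_integral_eq_integral[symmetric]) (auto simp: L2_def ennreal_power)
  have [measurable]: "f \<in> borel_measurable M" "g \<in> borel_measurable M" using f g by (auto simp: L2_def)
  have "(ennreal ?I)\<^sup>2 \<le> ennreal ((L2_norm M f)\<^sup>2) * ennreal ((L2_norm M g)\<^sup>2)"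
    using Cauchy_Schwarz_nn_integral[of "\<lambda>x. ennreal (cmod (f x))" M "\<lambda>x. ennreal (cmod (g x))"]
    by (simp add: nn sq f g)
  then have "ennreal (?I\<^sup>2) \<le> ennreal ((L2_norm M f * L2_norm M g)\<^sup>2)"
    by (simp add: ennreal_power power_mult_distrib flip: ennreal_mult)
  then have "?I\<^sup>2 \<le> (L2_norm M f * L2_norm M g)\<^sup>2" by simp
  then have "?I \<le> L2_norm M f * L2_norm M g"
    by (rule power2_le_imp_le) (simp add: L2_norm_nonneg)
  with 1 show ?thesis by simp
qed

text \<open>The squared norm of the sum \<open>?s\<close> splits into its pairings with
  \<open>f\<close> and \<open>g\<close>; Cauchy-Schwarz leaves one factor
  \<open>L2_norm M ?s\<close> to cancel, whence the case split.\<close>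

lemma L2_norm_triangle:
  assumes f: "f \<in> L2 M" and g: "g \<in> L2 M"
  shows "L2_norm M (\<lambda>x. f x + g x) \<le> L2_norm M f + L2_norm M g"
proof (rule power2_le_imp_le)
  let ?s = "\<lambda>x. f x + g x"
  have "L2_inner M ?s ?s = L2_inner M ?s f + L2_inner M ?s g"
    using assms by (intro L2_inner_add_right L2_add) auto
  then have "(L2_norm M ?s)\<^sup>2 = cmod (L2_inner M ?s f + L2_inner M ?s g)"
    by (metis L2_inner_self norm_of_real abs_power2)
  also have "\<dots> \<le> L2_norm M ?s * L2_norm M f + L2_norm M ?s * L2_norm M g"
    using L2_Cauchy_Schwarz[of ?s M f] L2_Cauchy_Schwarz[of ?s M g] L2_add[OF f g] f g
    by (meson add_mono norm_triangle_le)
  finally have *: "(L2_norm M ?s)\<^sup>2 \<le> L2_norm M ?s * (L2_norm M f + L2_norm M g)"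
    by (simp add: distrib_left)
  show "(L2_norm M ?s)\<^sup>2 \<le> (L2_norm M f + L2_norm M g)\<^sup>2"
  proof (cases "L2_norm M ?s = 0")
    case False
    then have "L2_norm M ?s > 0" using L2_norm_nonneg[of M ?s] by linarith
    with * have "L2_norm M ?s \<le> L2_norm M f + L2_norm M g"
      by (simp add: power2_eq_square)
    then show ?thesis using L2_norm_nonneg by (intro power_mono)
  qed simp
qed (simp add: L2_norm_nonneg)

lemma L2_norm_triangle_diff:
  assumes f: "f \<in> L2 M" and g: "g \<in> L2 M"
  shows "L2_norm M (\<lambda>x. f x - g x) \<le> L2_norm M f + L2_norm M g"
  using L2_norm_triangle[OF f L2_scale[OF g, of "-1"]] L2_norm_scale[of M "-1" g] by simp

lemma L2_norm_triangle_mid: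
  assumes "f \<in> L2 M" "g \<in> L2 M" "h \<in> L2 M"
  shows "L2_norm M (\<lambda>x. f x - h x) \<le> L2_norm M (\<lambda>x. f x - g x) + L2_norm M (\<lambda>x. g x - h x)"
  using L2_norm_triangle[OF L2_diff[OF assms(1,2)] L2_diff[OF assms(2,3)]] by simp

text \<open>Carries adjoint identities from a domain to its closure.\<close>

lemma L2_inner_tendsto_left:
  assumes "\<And>k. s k \<in> L2 M" "f \<in> L2 M" "g \<in> L2 M"
    and lim: "(\<lambda>k. L2_norm M (\<lambda>x. s k x - f x)) \<longlonglongrightarrow> 0"
  shows "(\<lambda>k. L2_inner M (s k) g) \<longlonglongrightarrow> L2_inner M f g"
proof -
  have "(\<lambda>k. L2_inner M (s k) g - L2_inner M f g) \<longlonglongrightarrow> 0"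
  proof (rule Lim_null_comparison)
    show "\<forall>\<^sub>F k in sequentially. norm (L2_inner M (s k) g - L2_inner M f g)
        \<le> L2_norm M (\<lambda>x. s k x - f x) * L2_norm M g"
      using L2_Cauchy_Schwarz[OF L2_diff[OF assms(1,2)] assms(3)] assms(1-3)
      by (simp add: L2_inner_diff_left)
    show "(\<lambda>k. L2_norm M (\<lambda>x. s k x - f x) * L2_norm M g) \<longlonglongrightarrow> 0"
      using tendsto_mult_left_zero[OF lim] by simp
  qed
  then show ?thesis by (simp add: LIM_zero_iff)
qed

lemma L2_linear_add_AE:
  "L2_linear M W T \<Longrightarrow> f \<in> W \<Longrightarrow> g \<in> W \<Longrightarrow> AE x in M. T (\<lambda>y. f y + g y) x = T f x + T g x"
  by (simp add: L2_linear_def)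

lemma L2_linear_cong_AE:
  "L2_linear M W T \<Longrightarrow> f \<in> W \<Longrightarrow> g \<in> W \<Longrightarrow> AE x in M. f x = g x \<Longrightarrow> AE x in M. T f x = T g x"
  by (simp add: L2_linear_def)

lemma L2_linear_in_L2: "L2_linear M W T \<Longrightarrow> f \<in> W \<Longrightarrow> T f \<in> L2 M"
  by (simp add: L2_linear_def)

text \<open>\<open>L2_linear\<close> speaks of sums and multiples only, so the difference is a sum
  with \<open>- 1 * g\<close>, whose membership in \<open>W\<close> has to be supplied.\<close>

lemma L2_linear_diff_AE:
  assumes T: "L2_linear M W T" and f: "f \<in> W" and g: "g \<in> W"
    and scale: "(\<lambda>y. - 1 * g y) \<in> W"
  shows "AE x in M. T (\<lambda>y. f y - g y) x = T f x - T g x"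
proof -
  have "AE x in M. T (\<lambda>y. - 1 * g y) x = - 1 * T g x"
    using T g unfolding L2_linear_def by blast
  moreover have "AE x in M. T (\<lambda>y. f y + - 1 * g y) x = T f x + T (\<lambda>y. - 1 * g y) x"
    by (rule L2_linear_add_AE[OF T f scale])
  ultimately show ?thesis by eventually_elim simp
qed

section \<open>Graphs, adjoints and compact parametrices\<close>

lemma closure_graph_L2: "(f, g) \<in> closure_graph M W T \<Longrightarrow> f \<in> L2 M \<and> g \<in> L2 M"
  by (simp add: closure_graph_def)

lemma adjoint_graph_L2: "(f, g) \<in> adjoint_graph M G \<Longrightarrow> f \<in> L2 M \<and> g \<in> L2 M"
  by (simp add: adjoint_graph_def)

lemma adjoint_graph_inner:
  "(g, h) \<in> adjoint_graph M G \<Longrightarrow> (f, f') \<in> G \<Longrightarrow> L2_inner M f' g = L2_inner M f h"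
  by (auto simp: adjoint_graph_def)

lemma adjoint_graph_inner':
  "(g, h) \<in> adjoint_graph M G \<Longrightarrow> (f, f') \<in> G \<Longrightarrow> L2_inner M g f' = L2_inner M h f"
  using adjoint_graph_inner[of g h M G f f'] by (metis L2_inner_commute)

lemma closure_graph_base:
  assumes "f \<in> W" "f \<in> L2 M" "T f \<in> L2 M"
  shows "(f, T f) \<in> closure_graph M W T"
  using assms by (auto simp: closure_graph_def L2_norm_def intro!: exI[of _ "\<lambda>_. f"])

text \<open>Both sides of \<open>eq\<close> are continuous along an approximating sequence, so the
  adjoint need only be tested on \<open>W\<close>.\<close>

lemma adjoint_closure_graphI:
  assumes T: "\<And>f. f \<in> W \<Longrightarrow> f \<in> L2 M \<and> T f \<in> L2 M" and g: "g \<in> L2 M" and h: "h \<in> L2 M"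
    and eq: "\<And>f. f \<in> W \<Longrightarrow> L2_inner M (T f) g = L2_inner M f h"
  shows "(g, h) \<in> adjoint_graph M (closure_graph M W T)"
proof -
  have "L2_inner M f' g = L2_inner M f h" if ff: "(f, f') \<in> closure_graph M W T" for f f'
  proof -
    obtain s where s: "\<And>k. s k \<in> W" and 1: "(\<lambda>k. L2_norm M (\<lambda>x. s k x - f x)) \<longlonglongrightarrow> 0"
      and 2: "(\<lambda>k. L2_norm M (\<lambda>x. T (s k) x - f' x)) \<longlonglongrightarrow> 0" and "f \<in> L2 M" "f' \<in> L2 M"
      using ff by (auto simp: closure_graph_def)
    have "(\<lambda>k. L2_inner M (s k) h) \<longlonglongrightarrow> L2_inner M f h"
      by (rule L2_inner_tendsto_left) (use T s 1 h \<open>f \<in> L2 M\<close> in auto)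
    moreover have "(\<lambda>k. L2_inner M (T (s k)) g) \<longlonglongrightarrow> L2_inner M f' g"
      by (rule L2_inner_tendsto_left) (use T s 2 g \<open>f' \<in> L2 M\<close> in auto)
    ultimately show ?thesis using eq[OF s] LIMSEQ_unique by simp
  qed
  then show ?thesis using g h by (auto simp: adjoint_graph_def)
qed

text \<open>With \<open>f = R (R w)\<close>, \<open>u = T f\<close> and \<open>w = f + T\<^sup>* u\<close>, the adjoint relation gives
  \<open>\<parallel>f\<parallel>\<^sup>2 + \<parallel>u\<parallel>\<^sup>2 = Re \<langle>f, w\<rangle>\<close> and \<open>\<parallel>w\<parallel>\<^sup>2 = \<langle>w, f\<rangle> + \<langle>T w, u\<rangle>\<close>.\<close>

lemma inv_sqrt_lower_bound:
  assumes R: "inv_sqrt M (closure_graph M W T O adjoint_graph M (closure_graph M W T)) R"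
    and w: "w \<in> W" "w \<in> L2 M" "T w \<in> L2 M"
  shows "(L2_norm M w)\<^sup>2 \<le> L2_norm M w * L2_norm M (R (R w)) +
    L2_norm M (T w) * sqrt (L2_norm M (R (R w)) * L2_norm M w)"
proof -
  let ?G = "closure_graph M W T" and ?f = "R (R w)"
  have RL: "R g \<in> L2 M" if "g \<in> L2 M" for g
    using R that by (simp add: inv_sqrt_def L2_positive_def L2_linear_def)
  have f: "?f \<in> L2 M" using RL w by blast
  then have "(w, ?f) \<in> resolvent_graph M (?G O adjoint_graph M ?G)"
    using R w by (simp add: inv_sqrt_def)
  then obtain u h where fu: "(?f, u) \<in> ?G" and uh: "(u, h) \<in> adjoint_graph M ?G"
    and wfh: "AE x in M. w x = ?f x + h x"
    by (auto simp: resolvent_graph_def)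
  have u: "u \<in> L2 M" and h: "h \<in> L2 M" using adjoint_graph_L2[OF uh] by auto
  \<comment> \<open>The resolvent equation trades the unknown \<open>h\<close> for \<open>w\<close>
    and \<open>?f\<close>.\<close>
  have inner_h: "L2_inner M g h = L2_inner M g w - L2_inner M g ?f" if "g \<in> L2 M" for g
  proof -
    have "L2_inner M g w = L2_inner M g (\<lambda>x. ?f x + h x)"
      using wfh w f h that by (intro L2_inner_cong_AE) (auto simp: L2_def)
    then show ?thesis using L2_inner_add_right[OF that f h] by simp
  qed
  have "(L2_norm M u)\<^sup>2 + (L2_norm M ?f)\<^sup>2 = Re (L2_inner M ?f w)"
    using adjoint_graph_inner[OF uh fu] inner_h[OF f] by (simp add: L2_inner_self complex_eq_iff)
  also have "\<dots> \<le> L2_norm M ?f * L2_norm M w"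
    using L2_Cauchy_Schwarz[OF f w(2)] complex_Re_le_cmod order_trans by blast
  finally have "(L2_norm M u)\<^sup>2 \<le> L2_norm M ?f * L2_norm M w"
    using zero_le_power2[of "L2_norm M ?f"] by linarith
  then have u_le: "L2_norm M u \<le> sqrt (L2_norm M ?f * L2_norm M w)"
    by (rule real_le_rsqrt)
  have "complex_of_real ((L2_norm M w)\<^sup>2) = L2_inner M w ?f + L2_inner M (T w) u"
    using adjoint_graph_inner[OF uh closure_graph_base[where T = T, OF w]] inner_h[OF w(2)]
    by (simp add: L2_inner_self)
  then have "(L2_norm M w)\<^sup>2 = cmod (L2_inner M w ?f + L2_inner M (T w) u)"
    by (metis norm_of_real abs_power2)
  also have "\<dots> \<le> L2_norm M w * L2_norm M ?f + L2_norm M (T w) * L2_norm M u"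
    using L2_Cauchy_Schwarz[OF w(2) f] L2_Cauchy_Schwarz[OF w(3) u] by (meson add_mono norm_triangle_le)
  also have "\<dots> \<le> L2_norm M w * L2_norm M ?f +
      L2_norm M (T w) * sqrt (L2_norm M ?f * L2_norm M w)"
    using u_le L2_norm_nonneg by (intro add_left_mono mult_left_mono)
  finally show ?thesis .
qed

text \<open>A compact \<open>R\<close> maps a subsequence of \<open>w\<close> to a convergent
  sequence, so \<open>R (R d)\<close> tends to 0 for successive differences \<open>d\<close>. As
  \<open>d\<close> and \<open>T d\<close> stay bounded, \<open>inv_sqrt_lower_bound\<close> forces
  \<open>d\<close> to 0, against the separation.\<close>

lemma not_compact_parametricesI:
  fixes w :: "nat \<Rightarrow> 'a \<Rightarrow> complex"
  assumes W: "W \<subseteq> L2 M" "\<And>f g. f \<in> W \<Longrightarrow> g \<in> W \<Longrightarrow> (\<lambda>x. f x + g x) \<in> W"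
      "\<And>c f. f \<in> W \<Longrightarrow> (\<lambda>x. c * f x) \<in> W"
    and T: "L2_linear M W T"
    and w: "\<And>k. w k \<in> W" "\<And>k. L2_norm M (w k) \<le> K" "\<And>k. L2_norm M (T (w k)) \<le> K"
    and sep: "\<And>k l. k \<noteq> l \<Longrightarrow> L2_norm M (\<lambda>x. w k x - w l x) \<ge> \<epsilon>" and \<epsilon>: "\<epsilon> > 0"
  shows "\<not> compact_parametrices M W T"
proof
  assume "compact_parametrices M W T"
  then obtain R where R: "inv_sqrt M (closure_graph M W T O adjoint_graph M (closure_graph M W T)) R"
    and comp: "L2_compact M R" by (auto simp: compact_parametrices_def Let_def)
  have Rlin: "L2_linear M (L2 M) R" using R by (simp add: inv_sqrt_def L2_positive_def)
  obtain K' where K': "\<And>f. f \<in> L2 M \<Longrightarrow> L2_norm M (R f) \<le> K' * L2_norm M f"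
    using R by (auto simp: inv_sqrt_def L2_positive_def)
  have RL: "R g \<in> L2 M" if "g \<in> L2 M" for g by (rule L2_linear_in_L2[OF Rlin that])
  have wL: "w k \<in> L2 M" for k using W w by blast
  obtain r g where r: "strict_mono (r :: nat \<Rightarrow> nat)" and g: "g \<in> L2 M"
    and lim: "(\<lambda>k. L2_norm M (\<lambda>x. R (w (r k)) x - g x)) \<longlonglongrightarrow> 0"
    using comp wL w(2) unfolding L2_compact_def by metis
  define d where "d k = (\<lambda>x. w (r k) x - w (r (Suc k)) x)" for k
  have dW: "d k \<in> W" for k
  proof -
    have "(\<lambda>x. w (r k) x + - 1 * w (r (Suc k)) x) \<in> W" by (intro W w)
    then show ?thesis by (simp add: d_def)
  qed
  have dL: "d k \<in> L2 M" for k using dW W by blast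
  \<comment> \<open>The bracket comes from inserting the limit \<open>g\<close> between consecutive
    images; the factor accounts for the outer \<open>R\<close>, with an absolute value because the
    sign of \<open>K'\<close> is not known.\<close>
  define e where "e k = \<bar>K'\<bar> * (L2_norm M (\<lambda>x. R (w (r k)) x - g x) +
    L2_norm M (\<lambda>x. R (w (r (Suc k))) x - g x))" for k
  have e0: "e \<longlonglongrightarrow> 0"
    unfolding e_def using lim LIMSEQ_Suc[OF lim]
    by (auto intro!: tendsto_eq_intros)
  have RR: "L2_norm M (R (R (d k))) \<le> e k" for k
  proof -
    have "AE x in M. R (d k) x = R (w (r k)) x - R (w (r (Suc k))) x"
      unfolding d_def by (rule L2_linear_diff_AE[OF Rlin wL wL L2_scale[OF wL]])
    then have "L2_norm M (R (d k)) = L2_norm M (\<lambda>x. R (w (r k)) x - R (w (r (Suc k))) x)"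
      using RL[OF dL] L2_diff[OF RL[OF wL] RL[OF wL]] by (intro L2_norm_cong_AE) (auto simp: L2_def)
    also have "\<dots> \<le> L2_norm M (\<lambda>x. R (w (r k)) x - g x) + L2_norm M (\<lambda>x. R (w (r (Suc k))) x - g x)"
      using L2_norm_triangle_mid[OF RL[OF wL] g RL[OF wL]] by (simp add: L2_norm_minus_commute[of M g])
    finally have *: "L2_norm M (R (d k)) \<le> \<dots>" .
    have "L2_norm M (R (R (d k))) \<le> K' * L2_norm M (R (d k))" by (rule K'[OF RL[OF dL]])
    also have "\<dots> \<le> \<bar>K'\<bar> * L2_norm M (R (d k))" by (simp add: mult_right_mono L2_norm_nonneg)
    also have "\<dots> \<le> e k" unfolding e_def using * by (intro mult_left_mono) auto
    finally show ?thesis .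
  qed
  have d_le: "L2_norm M (d k) \<le> 2 * K" for k
    using L2_norm_triangle_diff[OF wL wL, of "r k" "r (Suc k)"] w(2)[of "r k"] w(2)[of "r (Suc k)"]
    by (simp add: d_def)
  have TL: "T f \<in> L2 M" if "f \<in> W" for f by (rule L2_linear_in_L2[OF T that])
  have Td_le: "L2_norm M (T (d k)) \<le> 2 * K" for k
  proof -
    have "AE x in M. T (d k) x = T (w (r k)) x - T (w (r (Suc k))) x"
      unfolding d_def by (rule L2_linear_diff_AE[OF T w(1) w(1) W(3)[OF w(1)]])
    then have "L2_norm M (T (d k)) = L2_norm M (\<lambda>x. T (w (r k)) x - T (w (r (Suc k))) x)"
      using TL[OF dW] L2_diff[OF TL[OF w(1)] TL[OF w(1)]] by (intro L2_norm_cong_AE) (auto simp: L2_def)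
    also have "\<dots> \<le> 2 * K"
      using L2_norm_triangle_diff[OF TL[OF w(1)] TL[OF w(1)], of "r k" "r (Suc k)"]
        w(3)[of "r k"] w(3)[of "r (Suc k)"] by simp
    finally show ?thesis .
  qed
  have "\<epsilon>\<^sup>2 \<le> 2 * K * e k + 2 * K * sqrt (e k * (2 * K))" for k
  proof -
    have K: "0 \<le> K" using w(2)[of 0] L2_norm_nonneg[of M "w 0"] by linarith
    have "r k \<noteq> r (Suc k)" using r by (metis lessI order_less_irrefl strict_mono_less)
    then have "\<epsilon> \<le> L2_norm M (d k)" unfolding d_def by (rule sep)
    then have "\<epsilon>\<^sup>2 \<le> (L2_norm M (d k))\<^sup>2" using \<epsilon> by (intro power_mono) auto
    also have "\<dots> \<le> L2_norm M (d k) * L2_norm M (R (R (d k))) +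
        L2_norm M (T (d k)) * sqrt (L2_norm M (R (R (d k))) * L2_norm M (d k))"
      by (rule inv_sqrt_lower_bound[OF R dW dL TL[OF dW]])
    also have "\<dots> \<le> 2 * K * e k + 2 * K * sqrt (e k * (2 * K))"
      using d_le Td_le RR K order_trans[OF L2_norm_nonneg RR]
      by (intro add_mono mult_mono real_sqrt_le_mono) (auto simp: L2_norm_nonneg)
    finally show ?thesis .
  qed
  moreover have "(\<lambda>k. 2 * K * e k + 2 * K * sqrt (e k * (2 * K))) \<longlonglongrightarrow> 2 * K * 0 + 2 * K * sqrt (0 * (2 * K))"
    by (intro tendsto_intros e0)
  ultimately have "\<epsilon>\<^sup>2 \<le> 0" by (intro LIMSEQ_le_const) auto
  then show False using \<epsilon> by simp
qed

lemma L2_norm_eq_0_AE: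
  assumes "f \<in> L2 M" "L2_norm M f = 0"
  shows "AE x in M. f x = 0"
  using assms integral_nonneg_eq_0_iff_AE[of M "\<lambda>x. (cmod (f x))\<^sup>2"] by (simp add: L2_norm_def L2_def)

lemma L2_inner_scale_right: "L2_inner M f (\<lambda>x. c * g x) = c * L2_inner M f g"
  by (simp add: L2_inner_def mult.left_commute)

text \<open>Monotonicity of \<open>A\<close> makes \<open>I + A\<close> injective, so that \<open>R\<^sup>2\<close> only has to be a right inverse.\<close>

lemma inv_sqrtI:
  assumes R: "L2_positive M R" and A: "A \<subseteq> L2 M \<times> L2 M"
    and mono: "\<And>f1 h1 f2 h2. (f1, h1) \<in> A \<Longrightarrow> (f2, h2) \<in> A \<Longrightarrow>
      Re (L2_inner M (\<lambda>x. f1 x - f2 x) (\<lambda>x. h1 x - h2 x)) \<ge> 0"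
    and cong: "\<And>f f' h. (f, h) \<in> A \<Longrightarrow> f' \<in> L2 M \<Longrightarrow> AE x in M. f x = f' x \<Longrightarrow> (f', h) \<in> A"
    and ex: "\<And>g. g \<in> L2 M \<Longrightarrow> \<exists>h. (R (R g), h) \<in> A \<and> (AE x in M. g x = R (R g) x + h x)"
  shows "inv_sqrt M A R"
  unfolding inv_sqrt_def
proof (intro conjI R ballI)
  fix g f assume g: "g \<in> L2 M" and f: "f \<in> L2 M"
  obtain h where h: "(R (R g), h) \<in> A" and gh: "AE x in M. g x = R (R g) x + h x"
    using ex[OF g] by blast
  show "(g, f) \<in> resolvent_graph M A \<longleftrightarrow> (AE x in M. f x = R (R g) x)"
  proof
    assume eq: "AE x in M. f x = R (R g) x"
    then have "AE x in M. R (R g) x = f x" by eventually_elim simp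
    then have "(f, h) \<in> A" by (rule cong[OF h f])
    moreover have "AE x in M. g x = f x + h x" using gh eq by eventually_elim simp
    ultimately show "(g, f) \<in> resolvent_graph M A" using g by (auto simp: resolvent_graph_def)
  next
    assume "(g, f) \<in> resolvent_graph M A"
    then obtain k where k: "(f, k) \<in> A" and gk: "AE x in M. g x = f x + k x"
      by (auto simp: resolvent_graph_def)
    \<comment> \<open>Two solutions of g = f + A f differ by \<open>?d\<close> in the first
      component and by \<open>- ?d\<close> in the second; monotonicity then says that minus the
      squared norm of \<open>?d\<close> is nonnegative.\<close>
    let ?d = "\<lambda>x. f x - R (R g) x" and ?e = "\<lambda>x. k x - h x"
    have L: "?d \<in> L2 M" "?e \<in> L2 M" using A h k by (auto intro!: L2_diff)
    have de: "AE x in M. ?e x = - 1 * ?d x" using gh gk by eventually_elim (simp add: algebra_simps)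
    have "L2_inner M ?d ?e = L2_inner M ?d (\<lambda>x. - 1 * ?d x)"
      by (rule L2_inner_cong_AE[OF _ _ _ _ _ de])
        (use L L2_scale[OF L(1), of "- 1"] in \<open>auto dest: L2_measurable\<close>)
    also have "\<dots> = - 1 * L2_inner M ?d ?d" by (rule L2_inner_scale_right)
    finally have "Re (- complex_of_real ((L2_norm M ?d)\<^sup>2)) \<ge> 0"
      using mono[OF k h] by (simp add: L2_inner_self)
    then have "L2_norm M ?d = 0" by simp
    then show "AE x in M. f x = R (R g) x" using L2_norm_eq_0_AE[OF L(1)] by simp
  qed
qed

lemma L2_inner_diff_diff:
  assumes "f1 \<in> L2 M" "f2 \<in> L2 M" "g1 \<in> L2 M" "g2 \<in> L2 M"
  shows "L2_inner M (\<lambda>x. f1 x - f2 x) (\<lambda>x. g1 x - g2 x) =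
    (L2_inner M f1 g1 - L2_inner M f1 g2) - (L2_inner M f2 g1 - L2_inner M f2 g2)"
  using assms by (simp add: L2_inner_diff_left L2_inner_diff_right L2_diff)

text \<open>The pairing equals the squared norm of the difference of the intermediate elements
  \<open>u1\<close>, \<open>u2\<close>. The adjoint identity is applied to the four pairs
  separately, which avoids subtracting inside the graphs.\<close>

lemma closure_adjoint_mono:
  assumes "(f1, h1) \<in> closure_graph M W T O adjoint_graph M (closure_graph M W T)"
    "(f2, h2) \<in> closure_graph M W T O adjoint_graph M (closure_graph M W T)"
  shows "Re (L2_inner M (\<lambda>x. f1 x - f2 x) (\<lambda>x. h1 x - h2 x)) \<ge> 0"
proof -
  let ?G = "closure_graph M W T"
  obtain u1 u2 where G: "(f1, u1) \<in> ?G" "(f2, u2) \<in> ?G"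
    and Gs: "(u1, h1) \<in> adjoint_graph M ?G" "(u2, h2) \<in> adjoint_graph M ?G"
    using assms by auto
  note L = closure_graph_L2[OF G(1)] closure_graph_L2[OF G(2)] adjoint_graph_L2[OF Gs(1)] adjoint_graph_L2[OF Gs(2)]
  have "L2_inner M (\<lambda>x. f1 x - f2 x) (\<lambda>x. h1 x - h2 x) = L2_inner M (\<lambda>x. u1 x - u2 x) (\<lambda>x. u1 x - u2 x)"
    using L by (simp add: L2_inner_diff_diff adjoint_graph_inner[OF Gs(1) G(1)]
      adjoint_graph_inner[OF Gs(1) G(2)] adjoint_graph_inner[OF Gs(2) G(1)] adjoint_graph_inner[OF Gs(2) G(2)])
  then show ?thesis by (simp add: L2_inner_self)
qed

text \<open>The same computation with the adjoint acting first; its defining identity enters in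
  conjugated form.\<close>

lemma adjoint_closure_mono:
  assumes "(f1, h1) \<in> adjoint_graph M (closure_graph M W T) O closure_graph M W T"
    "(f2, h2) \<in> adjoint_graph M (closure_graph M W T) O closure_graph M W T"
  shows "Re (L2_inner M (\<lambda>x. f1 x - f2 x) (\<lambda>x. h1 x - h2 x)) \<ge> 0"
proof -
  let ?G = "closure_graph M W T"
  obtain u1 u2 where G: "(u1, h1) \<in> ?G" "(u2, h2) \<in> ?G"
    and Gs: "(f1, u1) \<in> adjoint_graph M ?G" "(f2, u2) \<in> adjoint_graph M ?G"
    using assms by auto
  note L = closure_graph_L2[OF G(1)] closure_graph_L2[OF G(2)] adjoint_graph_L2[OF Gs(1)] adjoint_graph_L2[OF Gs(2)]
  have "L2_inner M (\<lambda>x. f1 x - f2 x) (\<lambda>x. h1 x - h2 x) = L2_inner M (\<lambda>x. u1 x - u2 x) (\<lambda>x. u1 x - u2 x)"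
    using L by (simp add: L2_inner_diff_diff adjoint_graph_inner'[OF Gs(1) G(1)]
      adjoint_graph_inner'[OF Gs(1) G(2)] adjoint_graph_inner'[OF Gs(2) G(1)] adjoint_graph_inner'[OF Gs(2) G(2)])
  then show ?thesis by (simp add: L2_inner_self)
qed

text \<open>Graphs contain functions rather than classes, so stability under almost everywhere
  equality, which \<open>inv_sqrtI\<close> asks for, has to be proved.\<close>

lemma closure_graph_cong_AE:
  assumes fg: "(f, g) \<in> closure_graph M W T" and W: "\<And>s. s \<in> W \<Longrightarrow> s \<in> L2 M"
    and f': "f' \<in> L2 M" and eq: "AE x in M. f x = f' x"
  shows "(f', g) \<in> closure_graph M W T"
proof -
  have "L2_norm M (\<lambda>x. s x - f x) = L2_norm M (\<lambda>x. s x - f' x)" if "s \<in> W" for s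
  proof (rule L2_norm_cong_AE)
    show "AE x in M. s x - f x = s x - f' x" using eq by eventually_elim simp
  qed (use W[OF that] f' closure_graph_L2[OF fg] in \<open>auto simp: L2_def\<close>)
  then show ?thesis using fg f' unfolding closure_graph_def by auto
qed

lemma adjoint_graph_cong_AE:
  assumes gh: "(g, h) \<in> adjoint_graph M G" and G: "G \<subseteq> L2 M \<times> L2 M"
    and g': "g' \<in> L2 M" and eq: "AE x in M. g x = g' x"
  shows "(g', h) \<in> adjoint_graph M G"
proof -
  have "L2_inner M f' g' = L2_inner M f' g" if "(f, f') \<in> G" for f f'
  proof (rule L2_inner_cong_AE)
    show "AE x in M. g' x = g x" using eq by eventually_elim simp
  qed (use that G g' adjoint_graph_L2[OF gh] in \<open>auto simp: L2_def\<close>)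
  then show ?thesis using gh g' unfolding adjoint_graph_def by auto
qed

lemma L2_positive_mult:
  assumes r: "r \<in> borel_measurable M" and r01: "\<And>x. 0 \<le> r x \<and> r x \<le> 1"
  shows "L2_positive M (\<lambda>f x. complex_of_real (r x) * f x)"
proof -
  have L: "(\<lambda>x. complex_of_real (r x) * f x) \<in> L2 M" if "f \<in> L2 M" for f
    by (rule L2_mult_bounded[OF that, of _ 1]) (use r r01 in auto)
  have "L2_linear M (L2 M) (\<lambda>f x. complex_of_real (r x) * f x)"
    using L by (auto simp: L2_linear_def algebra_simps)
  moreover have "L2_norm M (\<lambda>x. complex_of_real (r x) * f x) \<le> 1 * L2_norm M f" if "f \<in> L2 M" for f
    using L2_norm_mono[OF L[OF that] that] r01 by (simp add: norm_mult mult_left_le_one_le)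
  moreover have "L2_inner M f (\<lambda>x. complex_of_real (r x) * f x)
      = complex_of_real (LINT x|M. r x * (cmod (f x))\<^sup>2)" for f
  proof -
    have "cnj (f x) * (complex_of_real (r x) * f x) = complex_of_real (r x * (cmod (f x))\<^sup>2)" for x
      by (simp only: of_real_mult complex_norm_square) (simp add: mult_ac)
    then show ?thesis by (simp add: L2_inner_def integral_complex_of_real del: of_real_mult)
  qed
  ultimately show ?thesis
    unfolding L2_positive_def using r01 by (auto intro!: exI[of _ 1] integral_nonneg_AE AE_I2)
qed

section \<open>The Haar measure and the GNS space\<close>

locale haar_setting =
  fixes N :: supernat and \<mu> :: "(nat \<Rightarrow> int) measure"
  assumes haar: "haar_measure N \<mu>"
begin

abbreviation "M \<equiv> gns_measure \<mu>"

lemma sets_mu [measurable_cong]: "sets \<mu> = sets (restrict_space borel (ZN N))"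
  using haar by (simp add: haar_measure_def)

lemma space_mu: "space \<mu> = ZN N"
  using sets_eq_imp_space_eq[OF sets_mu] by (simp add: space_restrict_space)

sublocale mu: finite_measure \<mu>
  by (rule finite_measureI) (use haar in \<open>simp add: haar_measure_def space_mu\<close>)

lemma measure_mu: "measure \<mu> (ZN N) = 1"
  using haar by (simp add: haar_measure_def measure_def)

lemma pair_sigma_finite_gns: "pair_sigma_finite (count_space (UNIV :: int set)) \<mu>"
  by (simp add: pair_sigma_finite_def sigma_finite_measure_count_space_countable mu.sigma_finite_measure_axioms)

lemma space_gns: "space M = UNIV \<times> ZN N"
  by (simp add: gns_measure_def space_pair_measure space_mu)

text \<open>The integer factor is countable and all its subsets are measurable, so slices can be
  tested one at a time.\<close>

lemma measurable_gns_iff: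
  "f \<in> borel_measurable M \<longleftrightarrow> (\<forall>m. (\<lambda>x. f (m, x)) \<in> borel_measurable \<mu>)"
proof
  assume "f \<in> borel_measurable M"
  then show "\<forall>m. (\<lambda>x. f (m, x)) \<in> borel_measurable \<mu>"
    unfolding gns_measure_def by (auto intro: measurable_compose[OF measurable_Pair1'])
next
  assume "\<forall>m. (\<lambda>x. f (m, x)) \<in> borel_measurable \<mu>"
  then show "f \<in> borel_measurable M" unfolding gns_measure_def
    by (intro measurable_pair_measure_countable1) auto
qed

text \<open>Every integer has positive counting mass, so no slice can be exceptional; conversely a
  countable union of null slices is null.\<close>

lemma AE_gns_iff: "(AE z in M. P z) \<longleftrightarrow> (\<forall>m. AE x in \<mu>. P (m, x))"
proof
  interpret pair_sigma_finite "count_space (UNIV :: int set)" \<mu> by (rule pair_sigma_finite_gns)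
  assume "AE z in M. P z"
  then have "AE m in count_space UNIV. AE x in \<mu>. P (m, x)"
    unfolding gns_measure_def by (rule AE_pair)
  then show "\<forall>m. AE x in \<mu>. P (m, x)" by (simp add: AE_count_space)
next
  assume *: "\<forall>m. AE x in \<mu>. P (m, x)"
  have "AE z in M. fst z = m \<longrightarrow> P z" for m
  proof -
    obtain A where A: "A \<in> null_sets \<mu>" "{x \<in> space \<mu>. \<not> P (m, x)} \<subseteq> A"
      using * unfolding eventually_ae_filter by metis
    have "{m} \<times> A \<in> null_sets M"
      using A mu.emeasure_pair_measure_Times[of "{m}" "count_space UNIV" A]
      by (auto simp: gns_measure_def null_sets_def)
    then show ?thesis
      by (rule AE_I') (use A in \<open>auto simp: space_gns space_mu\<close>)
  qed
  then have "AE z in M. \<forall>m. fst z = m \<longrightarrow> P z" unfolding AE_all_countable by blast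
  then show "AE z in M. P z" by simp
qed

lemma nn_integral_slice:
  assumes "F \<in> borel_measurable \<mu>"
  shows "(\<integral>\<^sup>+z. (if fst z = k then F (snd z) else 0) \<partial>M) = (\<integral>\<^sup>+x. F x \<partial>\<mu>)"
proof -
  let ?f = "\<lambda>z. if fst z = k then F (snd z) else (0 :: ennreal)"
  have "?f \<in> borel_measurable (count_space UNIV \<Otimes>\<^sub>M \<mu>)"
    using assms by measurable
  from mu.nn_integral_fst[OF this]
  have "(\<integral>\<^sup>+z. ?f z \<partial>M) = (\<integral>\<^sup>+m. (\<integral>\<^sup>+x. ?f (m, x) \<partial>\<mu>) \<partial>count_space UNIV)"
    by (simp add: gns_measure_def)
  also have "\<dots> = (\<integral>\<^sup>+m. (\<integral>\<^sup>+x. F x \<partial>\<mu>) * indicator {k} m \<partial>count_space UNIV)"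
  proof (rule nn_integral_cong)
    show "(\<integral>\<^sup>+x. ?f (m, x) \<partial>\<mu>) = (\<integral>\<^sup>+x. F x \<partial>\<mu>) * indicator {k} m" for m
      by (cases "m = k") auto
  qed
  finally show ?thesis by (simp add: nn_integral_count_space_indicator[symmetric])
qed

text \<open>Turns norms of test functions on one slice, and of their images under \<open>D\<close>,
  into norms over the group.\<close>

lemma L2_slice:
  assumes F: "F \<in> L2 \<mu>" and f: "f \<in> borel_measurable M"
    and fF: "\<And>m. AE x in \<mu>. f (m, x) = (if m = k then F x else 0)"
  shows "f \<in> L2 M" and "L2_norm M f = L2_norm \<mu> F"
proof -
  have ae: "AE z in M. f z = (if fst z = k then F (snd z) else 0)"
    unfolding AE_gns_iff fst_conv snd_conv using fF by blast
  have "(\<integral>\<^sup>+z. ennreal ((cmod (f z))\<^sup>2) \<partial>M) = (\<integral>\<^sup>+z. (if fst z = k then ennreal ((cmod (F (snd z)))\<^sup>2) else 0) \<partial>M)"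
  proof (rule nn_integral_cong_AE)
    show "AE z in M. ennreal ((cmod (f z))\<^sup>2) = (if fst z = k then ennreal ((cmod (F (snd z)))\<^sup>2) else 0)"
      using ae by eventually_elim auto
  qed
  also have "\<dots> = (\<integral>\<^sup>+x. ennreal ((cmod (F x))\<^sup>2) \<partial>\<mu>)"
    by (rule nn_integral_slice) (use F in \<open>auto simp: L2_def\<close>)
  finally have nn: "(\<integral>\<^sup>+z. ennreal ((cmod (f z))\<^sup>2) \<partial>M) = (\<integral>\<^sup>+x. ennreal ((cmod (F x))\<^sup>2) \<partial>\<mu>)" .
  show "f \<in> L2 M" using F f nn by (auto simp: L2_def integrable_iff_bounded)
  show "L2_norm M f = L2_norm \<mu> F"
    using nn F f unfolding L2_norm_def by (subst (1 2) integral_eq_nn_integral) (auto simp: L2_def)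
qed

text \<open>An integer has counting mass 1, so a slice is no larger in norm than the whole function.
  This puts \<psi>, a slice of the image of the cyclic vector, into L2.\<close>

lemma L2_section:
  assumes f: "f \<in> L2 M"
  shows "(\<lambda>x. f (k, x)) \<in> L2 \<mu>"
proof -
  have m: "(\<lambda>x. f (k, x)) \<in> borel_measurable \<mu>"
    using f measurable_gns_iff by (auto simp: L2_def)
  have "(\<integral>\<^sup>+x. ennreal ((cmod (f (k, x)))\<^sup>2) \<partial>\<mu>) =
      (\<integral>\<^sup>+z. (if fst z = k then ennreal ((cmod (f (k, snd z)))\<^sup>2) else 0) \<partial>M)"
    by (rule nn_integral_slice[symmetric]) (use m in auto)
  also have "\<dots> \<le> (\<integral>\<^sup>+z. ennreal ((cmod (f z))\<^sup>2) \<partial>M)"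
    by (intro nn_integral_mono) auto
  also have "\<dots> < \<infinity>" using f by (auto simp: L2_def integrable_iff_bounded)
  finally show ?thesis using m by (auto simp: L2_def integrable_iff_bounded)
qed

lemma distr_shift: "distr M M (\<lambda>(m, x). (m - n, x)) = M"
proof -
  have "bij_betw (\<lambda>m. m - n) UNIV (UNIV :: int set)"
    by (rule bij_betwI[of _ _ _ "\<lambda>m. m + n"]) auto
  then have "distr (count_space UNIV) (count_space UNIV) (\<lambda>m. m - n) = count_space (UNIV :: int set)"
    by (rule distr_bij_count_space)
  moreover have "distr \<mu> \<mu> (\<lambda>x. x) = \<mu>" by (rule distr_id)
  ultimately show ?thesis
    using pair_measure_distr[of "\<lambda>m. m - n" "count_space UNIV" "count_space (UNIV :: int set)" "\<lambda>x. x" \<mu> \<mu>]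
      mu.sigma_finite_measure_axioms
    by (simp add: gns_measure_def)
qed

lemma shift_measurable: "(\<lambda>(m, x). (m - n, x)) \<in> measurable M M"
  unfolding gns_measure_def by measurable

lemma integral_shift:
  fixes f :: "int \<times> (nat \<Rightarrow> int) \<Rightarrow> 'b :: {banach, second_countable_topology}"
  assumes "f \<in> borel_measurable M"
  shows "(LINT z|M. f (fst z - n, snd z)) = (LINT z|M. f z)"
    and "integrable M (\<lambda>z. f (fst z - n, snd z)) \<longleftrightarrow> integrable M f"
  using integral_distr[OF shift_measurable assms, of n] integrable_distr_eq[OF shift_measurable assms, of n]
  by (simp_all add: distr_shift[unfolded case_prod_unfold] case_prod_unfold)

lemma measurable_shift: "f \<in> borel_measurable M \<Longrightarrow> (\<lambda>z. f (fst z - n, snd z)) \<in> borel_measurable M"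
  using measurable_compose[OF shift_measurable, of f borel n] by (simp add: case_prod_unfold)

lemma L2_shift:
  assumes "f \<in> L2 M"
  shows "(\<lambda>z. f (fst z - n, snd z)) \<in> L2 M"
    "L2_norm M (\<lambda>z. f (fst z - n, snd z)) = L2_norm M f"
  using assms measurable_shift[of f n] integral_shift[of "\<lambda>z. (cmod (f z))\<^sup>2" n]
  by (auto simp: L2_def L2_norm_def)

end

section \<open>The group of residues\<close>

lemma zshift_apply: "sn_dvd j N \<Longrightarrow> zshift N x k j = (x j + k) mod int j"
  by (simp add: zshift_def zadd_def zq_def mod_add_right_eq)

lemma zshift_undef: "\<not> sn_dvd j N \<Longrightarrow> zshift N x k j = undefined"
  by (simp add: zshift_def zadd_def)

lemma ZN_range: "x \<in> ZN N \<Longrightarrow> sn_dvd j N \<Longrightarrow> x j \<in> {0..<int j}"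
  by (auto simp: ZN_def PiE_def Pi_def)

lemma ZN_undef: "x \<in> ZN N \<Longrightarrow> \<not> sn_dvd j N \<Longrightarrow> x j = undefined"
  by (auto simp: ZN_def PiE_def extensional_def)

lemma ZN_mod: "x \<in> ZN N \<Longrightarrow> sn_dvd j N \<Longrightarrow> sn_dvd k N \<Longrightarrow> j dvd k \<Longrightarrow> x k mod int j = x j"
  by (auto simp: ZN_def)

lemma ZN_eqI:
  assumes "x \<in> ZN N" "y \<in> ZN N" "\<And>j. sn_dvd j N \<Longrightarrow> x j = y j"
  shows "x = y"
proof
  show "x j = y j" for j using assms ZN_undef by metis
qed

lemma zshift_0 [simp]: "x \<in> ZN N \<Longrightarrow> zshift N x 0 = x"
  by (rule ZN_eqI[OF zshift_in_ZN]) (auto simp: zshift_apply dest: ZN_range)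

lemma zshift_zshift: "zshift N (zshift N x k) l = zshift N x (k + l)"
proof
  show "zshift N (zshift N x k) l j = zshift N x (k + l) j" for j
    by (cases "sn_dvd j N") (simp_all add: zshift_apply zshift_undef mod_add_left_eq add.assoc)
qed

lemma zshift_zq: "zshift N (zq N l) k = zq N (l + k)"
  by (rule ZN_eqI[OF zshift_in_ZN]) (simp_all add: zq_in_ZN zshift_apply, simp add: zq_def mod_add_left_eq)

text \<open>The type \<open>int\<close> is discrete, so an arbitrary \<open>w\<close> is
  continuous.\<close>

lemma continuous_on_coordinate: "continuous_on S (\<lambda>x. w (x j))"
  for w :: "int \<Rightarrow> 'a :: topological_space" and S :: "('b \<Rightarrow> int) set"
proof -
  have "continuous_on UNIV (\<lambda>x :: 'b \<Rightarrow> int. w (x j))"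
    by (rule continuous_on_compose2[OF _ continuous_on_product_coordinates[of j]]) auto
  then show ?thesis by (rule continuous_on_subset) auto
qed

lemma continuous_on_zshift: "continuous_on S (\<lambda>x. zshift N x k)"
proof (rule continuous_on_coordinatewise_then_product)
  fix j show "continuous_on S (\<lambda>x. zshift N x k j)"
    using continuous_on_coordinate[of S "\<lambda>t. (t + k) mod int j" j]
    by (cases "sn_dvd j N") (simp_all add: zshift_apply zshift_undef)
qed

lemma continuous_on_zshift_compose:
  assumes "continuous_on (ZN N) f"
  shows "continuous_on (ZN N) (\<lambda>x. f (zshift N x k))"
  by (rule continuous_on_compose2[OF assms continuous_on_zshift]) (auto intro: zshift_in_ZN)

lemma compact_ZN: "compact (ZN N)"
proof -
  \<comment> \<open>Elements of \<open>ZN N\<close> take the value \<open>undefined\<close> off the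
    divisors; a singleton factor there exhibits \<open>ZN N\<close> as a closed part of a full
    product of finite sets.\<close>
  define S where "S j = (if sn_dvd j N then {0..<int j} else {undefined})" for j
  define C where "C = {x. \<forall>j k. sn_dvd j N \<longrightarrow> sn_dvd k N \<longrightarrow> j dvd k \<longrightarrow> x k mod int j = x j}"
  have "finite (S j)" for j by (simp add: S_def)
  then have "compactin euclidean (S j)" for j by (simp add: finite_imp_compact)
  then have "compactin (product_topology (\<lambda>_. euclidean) UNIV) (PiE UNIV S)"
    unfolding compactin_PiE by blast
  then have A: "compact (PiE UNIV S)" by (simp add: euclidean_product_topology)
  have eq: "closed {x :: nat \<Rightarrow> int. x k mod int j = x j}" for j k
    by (rule closed_Collect_eq[OF continuous_on_coordinate[of UNIV "\<lambda>t. t mod int j"]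
        continuous_on_coordinate[of UNIV "\<lambda>t. t"]])
  have C: "closed C" unfolding C_def
    by (intro closed_Collect_all closed_Collect_imp open_Collect_const eq)
  have "ZN N = PiE UNIV S \<inter> C"
  proof (intro set_eqI iffI)
    fix x assume x: "x \<in> ZN N"
    have "x j \<in> S j" for j
      using ZN_range[OF x, of j] ZN_undef[OF x, of j] by (cases "sn_dvd j N") (simp_all add: S_def)
    then show "x \<in> PiE UNIV S \<inter> C" using ZN_mod[OF x] by (simp add: PiE_UNIV_domain C_def)
  next
    fix x assume x: "x \<in> PiE UNIV S \<inter> C"
    then have S: "x j \<in> S j" for j by (auto simp: PiE_UNIV_domain)
    have "x \<in> (\<Pi>\<^sub>E j\<in>{j. sn_dvd j N}. {0..<int j})"
    proof (rule PiE_I)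
      show "x j \<in> {0..<int j}" if "j \<in> {j. sn_dvd j N}" for j
        using S[of j] that by (simp add: S_def)
      show "x j = undefined" if "j \<notin> {j. sn_dvd j N}" for j
        using S[of j] that by (simp add: S_def)
    qed
    then show "x \<in> ZN N" using x unfolding ZN_def C_def by simp
  qed
  then show ?thesis using compact_Int_closed[OF A C] by simp
qed

lemma continuous_ZN_bounded:
  assumes "continuous_on (ZN N) (f :: _ \<Rightarrow> complex)"
  obtains B where "B \<ge> 0" "\<And>x. x \<in> ZN N \<Longrightarrow> cmod (f x) \<le> B"
proof -
  have "bounded (f ` ZN N)"
    by (intro compact_imp_bounded compact_continuous_image assms compact_ZN)
  then obtain B where "\<And>x. x \<in> ZN N \<Longrightarrow> cmod (f x) \<le> B" by (auto simp: bounded_iff)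
  then show ?thesis using that[of "max B 0"] by (meson max.cobounded1 max.cobounded2 order_trans)
qed

text \<open>These are the symbols of \<open>Bdiag_poly\<close>, as shown in
  \<open>Bdiag_poly_iff\<close>. Values off \<open>ZN N\<close> are left free.\<close>

definition loc_const :: "supernat \<Rightarrow> ((nat \<Rightarrow> int) \<Rightarrow> complex) set" where
  "loc_const N = {a. \<exists>j w. sn_dvd j N \<and> (\<forall>x\<in>ZN N. a x = w (x j))}"

lemma loc_const_continuous: "a \<in> loc_const N \<Longrightarrow> continuous_on (ZN N) a"
  using continuous_on_coordinate[of "ZN N"] by (auto simp: loc_const_def cong: continuous_on_cong)

lemma sn_dvd_1: "sn_dvd 1 N"
  using sn_dvd_Lcm[of "{}" N] by simp

lemma loc_const_const: "(\<lambda>_. c) \<in> loc_const N"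
  unfolding loc_const_def using sn_dvd_1
  by (intro CollectI exI[of _ 1] exI[of _ "\<lambda>_. c"]) simp

lemma loc_const_scale:
  assumes "a \<in> loc_const N"
  shows "(\<lambda>x. c * a x) \<in> loc_const N"
proof -
  obtain j w where "sn_dvd j N" "\<forall>x\<in>ZN N. a x = w (x j)"
    using assms by (auto simp: loc_const_def)
  then show ?thesis
    unfolding loc_const_def by (intro CollectI exI[of _ j] exI[of _ "\<lambda>t. c * w t"]) simp
qed

text \<open>Both functions factor through the residue modulo the least common multiple, which is
  again a finite divisor.\<close>

lemma loc_const_add:
  assumes "a \<in> loc_const N" "b \<in> loc_const N"
  shows "(\<lambda>x. a x + b x) \<in> loc_const N"
proof -
  obtain j v where j: "sn_dvd j N" "\<And>x. x \<in> ZN N \<Longrightarrow> a x = v (x j)"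
    using assms by (auto simp: loc_const_def)
  obtain k w where k: "sn_dvd k N" "\<And>x. x \<in> ZN N \<Longrightarrow> b x = w (x k)"
    using assms by (auto simp: loc_const_def)
  let ?l = "Lcm {j, k}"
  have l: "sn_dvd ?l N" by (rule sn_dvd_Lcm) (use j k in auto)
  have "a x + b x = v (x ?l mod int j) + w (x ?l mod int k)" if "x \<in> ZN N" for x
    using that j k ZN_mod[OF that j(1) l] ZN_mod[OF that k(1) l] by simp
  then show ?thesis
    using l unfolding loc_const_def
    by (intro CollectI exI[of _ ?l] exI[of _ "\<lambda>t. v (t mod int j) + w (t mod int k)"]) simp
qed

lemma periodic_mod:
  fixes w :: "int \<Rightarrow> 'a"
  assumes "\<And>l. w (l + j) = w l"
  shows "w (l mod j) = w l"
proof -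
  have "w (l + t * j) = w l" for l t
  proof (induction t rule: int_induct[where k = 0])
    case (step1 i)
    then show ?case using assms[of "l + i * j"] by (simp add: algebra_simps)
  next
    case (step2 i)
    then show ?case using assms[of "l + (i - 1) * j"] by (simp add: algebra_simps)
  qed simp
  from this[of "l mod j" "l div j"] show ?thesis by simp
qed

text \<open>A sequence of period \<open>j\<close> depends only on the residue modulo
  \<open>j\<close>, which is the coordinate \<open>zq N l j\<close>.\<close>

lemma Bdiag_poly_iff: "B \<in> Bdiag_poly N \<longleftrightarrow> (\<exists>a\<in>loc_const N. B = diag_op (\<lambda>l. a (zq N l)))"
proof
  assume "B \<in> Bdiag_poly N"
  then obtain w j where w: "B = diag_op w" "sn_dvd j N" "\<And>l. w (l + int j) = w l"
    by (auto simp: Bdiag_poly_def)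
  have L: "(\<lambda>x. w (x j)) \<in> loc_const N" using w by (auto simp: loc_const_def)
  have w_eq: "w (zq N l j) = w l" for l
    using periodic_mod[of w "int j", OF w(3)] w(2) by (simp add: zq_def)
  have "B = diag_op (\<lambda>l. (\<lambda>x. w (x j)) (zq N l))" using w(1) w_eq by simp
  then show "\<exists>a\<in>loc_const N. B = diag_op (\<lambda>l. a (zq N l))" using L by (rule bexI)
next
  assume "\<exists>a\<in>loc_const N. B = diag_op (\<lambda>l. a (zq N l))"
  then obtain a where a: "a \<in> loc_const N" "B = diag_op (\<lambda>l. a (zq N l))" by blast
  obtain j w where w: "sn_dvd j N" "\<And>x. x \<in> ZN N \<Longrightarrow> a x = w (x j)"
    using a by (auto simp: loc_const_def)
  have "a (zq N (l + int j)) = a (zq N l)" for l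
    using w zq_in_ZN by (simp add: zq_def)
  then show "B \<in> Bdiag_poly N" using w a by (auto simp: Bdiag_poly_def)
qed

section \<open>Matrix entries and coefficient families of polynomial elements\<close>

lemma Rep_ell2_sum: "Rep_ell2 (sum f F) i = (\<Sum>k\<in>F. Rep_ell2 (f k) i)"
  by (induction F rule: infinite_finite_induct) (simp_all add: zero_ell2.rep_eq plus_ell2.rep_eq)

lemma Rep_BD_sum:
  assumes "\<And>k. k \<in> F \<Longrightarrow> c k \<in> loc_const N"
  shows "Rep_ell2 (blinfun_apply (\<Sum>k\<in>F. Vpow k o\<^sub>L diag_op (\<lambda>l. c k (zq N l))) x) i =
    (\<Sum>k\<in>F. c k (zq N (i - k)) * Rep_ell2 x (i - k))"
proof -
  have "Rep_ell2 (blinfun_apply (Vpow k o\<^sub>L diag_op (\<lambda>l. c k (zq N l))) x) i =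
      c k (zq N (i - k)) * Rep_ell2 x (i - k)" if k: "k \<in> F" for k
  proof -
    \<comment> \<open>\<open>diag_op\<close> acts coordinatewise only for bounded symbols;
      compactness of the group supplies the bound.\<close>
    obtain B where B: "\<And>x. x \<in> ZN N \<Longrightarrow> cmod (c k x) \<le> B"
      using continuous_ZN_bounded[OF loc_const_continuous[OF assms[OF k]]] by blast
    then show ?thesis using Rep_diag_op[of "\<lambda>l. c k (zq N l)" B] zq_in_ZN by simp
  qed
  then show ?thesis by (simp add: blinfun.sum_left Rep_ell2_sum)
qed

text \<open>Indexing by all integers avoids carrying a finite index set with each element. The
  support is that of functions on the whole type, not of their restrictions to
  \<open>ZN N\<close>.\<close>

definition coeff_family :: "supernat \<Rightarrow> (int \<Rightarrow> (nat \<Rightarrow> int) \<Rightarrow> complex) \<Rightarrow> bool" where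
  "coeff_family N c \<longleftrightarrow> (\<forall>m. c m \<in> loc_const N) \<and> finite {m. c m \<noteq> (\<lambda>_. 0)}"

lemma BD_poly_iff:
  "b \<in> BD_poly N \<longleftrightarrow> (\<exists>c. coeff_family N c \<and>
     b = (\<Sum>k | c k \<noteq> (\<lambda>_. 0). Vpow k o\<^sub>L diag_op (\<lambda>l. c k (zq N l))))"
proof
  assume "b \<in> BD_poly N"
  then obtain F d where F: "finite F" and d: "\<And>k. k \<in> F \<Longrightarrow> d k \<in> Bdiag_poly N"
    and b: "b = (\<Sum>k\<in>F. Vpow k o\<^sub>L d k)" by (auto simp: BD_poly_def)
  have "\<forall>k\<in>F. \<exists>a\<in>loc_const N. d k = diag_op (\<lambda>l. a (zq N l))"
    using d by (simp add: Bdiag_poly_iff)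
  then obtain a where a: "\<And>k. k \<in> F \<Longrightarrow> a k \<in> loc_const N"
    "\<And>k. k \<in> F \<Longrightarrow> d k = diag_op (\<lambda>l. a k (zq N l))" by metis
  define c where "c k = (if k \<in> F then a k else (\<lambda>_. 0))" for k
  have c: "\<And>k. c k \<in> loc_const N" "{m. c m \<noteq> (\<lambda>_. 0)} \<subseteq> F"
    using a by (auto simp: c_def loc_const_const)
  have 0: "Vpow k o\<^sub>L diag_op (\<lambda>l. 0) = 0" for k
    by (intro blinfun_eqI) (simp add: Rep_ell2_inject[symmetric] fun_eq_iff Rep_diag_op[of _ 0] zero_ell2.rep_eq)
  have "b = (\<Sum>k\<in>F. Vpow k o\<^sub>L diag_op (\<lambda>l. c k (zq N l)))"
    unfolding b by (rule sum.cong) (simp_all add: a c_def)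
  also have "\<dots> = (\<Sum>k | c k \<noteq> (\<lambda>_. 0). Vpow k o\<^sub>L diag_op (\<lambda>l. c k (zq N l)))"
    by (rule sum.mono_neutral_right) (use F c in \<open>auto simp: 0\<close>)
  finally show "\<exists>c. coeff_family N c \<and>
     b = (\<Sum>k | c k \<noteq> (\<lambda>_. 0). Vpow k o\<^sub>L diag_op (\<lambda>l. c k (zq N l)))"
    using c F finite_subset unfolding coeff_family_def by blast
next
  assume "\<exists>c. coeff_family N c \<and>
     b = (\<Sum>k | c k \<noteq> (\<lambda>_. 0). Vpow k o\<^sub>L diag_op (\<lambda>l. c k (zq N l)))"
  then obtain c where c: "coeff_family N c"
    and b: "b = (\<Sum>k | c k \<noteq> (\<lambda>_. 0). Vpow k o\<^sub>L diag_op (\<lambda>l. c k (zq N l)))" by blast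
  have "diag_op (\<lambda>l. c k (zq N l)) \<in> Bdiag_poly N" for k
    using c by (auto simp: Bdiag_poly_iff coeff_family_def)
  then show "b \<in> BD_poly N"
    unfolding BD_poly_def b using c
    by (intro CollectI exI[of _ "{k. c k \<noteq> (\<lambda>_. 0)}"] exI[of _ "\<lambda>k. diag_op (\<lambda>l. c k (zq N l))"])
      (simp add: coeff_family_def)
qed

text \<open>Only \<open>k = i - l\<close> contributes, and if this index is missing from the sum its
  coefficient is the zero function. The factor \<open>a\<close> is allowed because the lemma is also
  applied to \<open>wshift n \<eta> (Evec l)\<close>.\<close>

lemma Rep_BD_family_single:
  assumes c: "coeff_family N c" and x: "\<And>i. Rep_ell2 x i = (if i = l then a else 0)"
  shows "Rep_ell2 (blinfun_apply (\<Sum>k | c k \<noteq> (\<lambda>_. 0). Vpow k o\<^sub>L diag_op (\<lambda>l. c k (zq N l))) x) i =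
    c (i - l) (zq N l) * a"
proof -
  have "(\<Sum>k | c k \<noteq> (\<lambda>_. 0). c k (zq N (i - k)) * Rep_ell2 x (i - k)) =
      (\<Sum>k | c k \<noteq> (\<lambda>_. 0). if k = i - l then c (i - l) (zq N l) * a else 0)"
    by (rule sum.cong) (auto simp: x)
  also have "\<dots> = c (i - l) (zq N l) * a"
    using c by (auto simp: coeff_family_def fun_eq_iff)
  finally show ?thesis using c by (subst Rep_BD_sum) (auto simp: coeff_family_def)
qed

lemma Rep_BD_family_Evec:
  assumes "coeff_family N c"
  shows "Rep_ell2 (blinfun_apply (\<Sum>k | c k \<noteq> (\<lambda>_. 0). Vpow k o\<^sub>L diag_op (\<lambda>l. c k (zq N l))) (Evec l)) i =
    c (i - l) (zq N l)"
  using Rep_BD_family_single[OF assms, of "Evec l" l 1 i] by (simp add: Evec.rep_eq)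

lemma is_coeff_BD_family:
  assumes c: "coeff_family N c"
  shows "is_coeff N (\<Sum>k | c k \<noteq> (\<lambda>_. 0). Vpow k o\<^sub>L diag_op (\<lambda>l. c k (zq N l))) m (c m)"
  using assms loc_const_continuous by (auto simp: is_coeff_def Rep_BD_family_Evec coeff_family_def)

lemma gns_class_id: "x \<in> ZN N \<Longrightarrow> gns_class N id_blinfun (m, x) = (if m = 0 then 1 else 0)"
  using fcoeff_eqI[of N id_blinfun m "\<lambda>_. if m = 0 then 1 else 0" x]
  by (simp add: gns_class_def is_coeff_def Evec.rep_eq)

text \<open>Collapses the infinite sum in \<open>gns_rep\<close>; it serves for the cyclic vector,
  on slice 0, and for its image under \<open>D\<close>, on slice \<open>n\<close>.\<close>

lemma gns_rep_single:
  assumes "\<And>m. m \<noteq> n \<Longrightarrow> f (m, x) = 0"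
  shows "gns_rep N b f (m, x) = fcoeff N b (m - n) (zshift N x n) * f (n, x)"
proof -
  have "f (m - k, x) = 0" if "k \<noteq> m - n" for k using assms[of "m - k"] that by simp
  then have "(\<Sum>\<^sub>\<infinity>k. fcoeff N b k (zshift N x (m - k)) * f (m - k, x)) =
      (\<Sum>\<^sub>\<infinity>k\<in>{m - n}. fcoeff N b k (zshift N x (m - k)) * f (m - k, x))"
    by (intro infsum_cong_neutral) auto
  then show ?thesis by (simp add: gns_rep_def)
qed

lemma gns_rep_id:
  assumes "x \<in> ZN N"
  shows "gns_rep N b (gns_class N id_blinfun) (m, x) = fcoeff N b m x"
  using assms gns_rep_single[of 0 "gns_class N id_blinfun" x N b m] by (simp add: gns_class_id)

section \<open>Translation invariance and the domain of the implementations\<close>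

context haar_setting begin

lemma zshift_measurable [measurable]: "(\<lambda>x. zshift N x k) \<in> measurable \<mu> \<mu>"
proof -
  have "(\<lambda>x. zshift N x k) \<in> restrict_space borel (ZN N) \<rightarrow>\<^sub>M restrict_space borel (ZN N)"
    by (rule measurable_restrict_space3) (auto simp: zshift_in_ZN intro: borel_measurable_continuous_onI continuous_on_zshift)
  then show ?thesis using measurable_cong_sets[OF sets_mu sets_mu] by simp
qed

text \<open>Haar invariance is stated for images of sets, the pushforward uses preimages: the
  preimage under the shift by \<open>k\<close> is the translate by
  \<open>zq N (- k)\<close>.\<close>

lemma distr_zshift: "distr \<mu> \<mu> (\<lambda>x. zshift N x k) = \<mu>"
proof (rule measure_eqI)
  fix A assume "A \<in> sets (distr \<mu> \<mu> (\<lambda>x. zshift N x k))"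
  then have A: "A \<in> sets \<mu>" by simp
  then have sub: "A \<subseteq> ZN N" using sets.sets_into_space space_mu by blast
  have comm: "zadd N (zq N (- k)) x = zshift N x (- k)" for x
    unfolding zshift_def zadd_def by (simp add: add.commute)
  have "(\<lambda>x. zshift N x k) -` A \<inter> space \<mu> = zadd N (zq N (- k)) ` A"
    unfolding comm
  proof (intro equalityI subsetI)
    fix x assume "x \<in> (\<lambda>x. zshift N x k) -` A \<inter> space \<mu>"
    then show "x \<in> (\<lambda>x. zshift N x (- k)) ` A"
      by (intro image_eqI[of _ _ "zshift N x k"]) (auto simp: zshift_zshift space_mu)
  qed (use sub in \<open>auto simp: zshift_zshift space_mu zshift_in_ZN\<close>)
  then have "emeasure (distr \<mu> \<mu> (\<lambda>x. zshift N x k)) A = emeasure \<mu> (zadd N (zq N (- k)) ` A)"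
    using A by (simp add: emeasure_distr)
  also have "\<dots> = emeasure \<mu> A" using haar A zq_in_ZN by (auto simp: haar_measure_def)
  finally show "emeasure (distr \<mu> \<mu> (\<lambda>x. zshift N x k)) A = emeasure \<mu> A" .
qed simp

text \<open>Elements of the domain are known only almost everywhere, yet the formula for
  \<open>D\<close> evaluates them at translated points.\<close>

lemma AE_zshift: "AE x in \<mu>. P x \<Longrightarrow> AE x in \<mu>. P (zshift N x k)"
  using AE_distrD[OF zshift_measurable[of k], where P = P] unfolding distr_zshift .

lemma continuous_measurable:
  "continuous_on (ZN N) (f :: _ \<Rightarrow> complex) \<Longrightarrow> f \<in> borel_measurable \<mu>"
  using borel_measurable_continuous_on_restrict[of "ZN N" f] measurable_cong_sets[OF sets_mu refl] by blast

lemma AE_ZN: "AE x in \<mu>. x \<in> ZN N"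
  using AE_space[of \<mu>] by (simp add: space_mu)

lemma L2_mu_bounded:
  assumes "f \<in> borel_measurable \<mu>" "\<And>x. x \<in> ZN N \<Longrightarrow> cmod (f x) \<le> B"
  shows "f \<in> L2 \<mu>"
proof (rule L2I_bound)
  show "(cmod (f x))\<^sup>2 \<le> B\<^sup>2" if "x \<in> space \<mu>" for x
    using assms(2) that by (intro power_mono) (auto simp: space_mu)
qed (use assms in auto)

lemma L2_mu_continuous:
  assumes "continuous_on (ZN N) f"
  shows "f \<in> L2 \<mu>"
proof -
  obtain B where "\<And>x. x \<in> ZN N \<Longrightarrow> cmod (f x) \<le> B" using continuous_ZN_bounded[OF assms] by blast
  then show ?thesis by (rule L2_mu_bounded[OF continuous_measurable[OF assms]])
qed

lemma coeff_family_L2: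
  assumes c: "coeff_family N c"
  shows "(\<lambda>(m, x). c m x) \<in> L2 M"
proof -
  have cm: "c m \<in> L2 \<mu>" for m
    using c by (intro L2_mu_continuous loc_const_continuous) (simp add: coeff_family_def)
  have sl: "(\<lambda>z. if fst z = k then c k (snd z) else 0) \<in> L2 M" for k
  proof (rule L2_slice(1)[OF cm[of k], where k = k])
    have "(\<lambda>x. if m = k then c k x else 0) \<in> borel_measurable \<mu>" for m
      using L2_measurable[OF cm[of k]] by (cases "m = k") simp_all
    then show "(\<lambda>z. if fst z = k then c k (snd z) else 0) \<in> borel_measurable M"
      unfolding measurable_gns_iff fst_conv snd_conv by blast
  qed simp
  have "(\<lambda>z. \<Sum>k\<in>F. if fst z = k then c k (snd z) else 0) \<in> L2 M" if "finite F" for F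
    using that
  proof induction
    case (insert k F)
    show ?case using L2_add[OF sl[of k] insert.IH] unfolding sum.insert[OF insert.hyps] .
  qed (simp add: L2_zero)
  from this[of "{m. c m \<noteq> (\<lambda>_. 0)}"] have "(\<lambda>z. \<Sum>k | c k \<noteq> (\<lambda>_. 0). if fst z = k then c k (snd z) else 0) \<in> L2 M"
    using c by (simp add: coeff_family_def)
  also have "(\<lambda>z. \<Sum>k | c k \<noteq> (\<lambda>_. 0). if fst z = k then c k (snd z) else 0) = (\<lambda>(m, x). c m x)"
    using c by (auto simp: coeff_family_def fun_eq_iff)
  finally show ?thesis .
qed

text \<open>Applying \<pi>(b) to the cyclic vector returns the coefficients of b, and polynomial
  elements correspond to coefficient families; square-integrability comes from
  \<open>coeff_family_L2\<close>.\<close>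

lemma gns_domain_iff:
  "f \<in> gns_domain N \<mu> \<longleftrightarrow> f \<in> borel_measurable M \<and>
    (\<exists>c. coeff_family N c \<and> (\<forall>m. AE x in \<mu>. f (m, x) = c m x))"
proof -
  let ?b = "\<lambda>c. \<Sum>k | c k \<noteq> (\<lambda>_. 0). Vpow k o\<^sub>L diag_op (\<lambda>l. c k (zq N l))"
  have "(AE z in M. f z = gns_rep N (?b c) (gns_class N id_blinfun) z) \<longleftrightarrow> (\<forall>m. AE x in \<mu>. f (m, x) = c m x)"
    if "coeff_family N c" for c
    unfolding AE_gns_iff
    by (intro all_cong1 AE_cong) (simp add: space_mu gns_rep_id fcoeff_eqI[OF is_coeff_BD_family[OF that]])
  note eq = this
  have L: "f \<in> L2 M" if "coeff_family N c" "f \<in> borel_measurable M" "\<forall>m. AE x in \<mu>. f (m, x) = c m x" for c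
  proof (rule L2_AE_cong[OF coeff_family_L2[OF that(1)] that(2)])
    show "AE z in M. (case z of (m, x) \<Rightarrow> c m x) = f z"
      unfolding AE_gns_iff prod.case using that(3) by (metis (mono_tags, lifting) eventually_mono)
  qed
  show ?thesis
  proof
    assume f: "f \<in> gns_domain N \<mu>"
    then obtain b where "b \<in> BD_poly N" "AE z in M. f z = gns_rep N b (gns_class N id_blinfun) z"
      by (auto simp: gns_domain_def)
    then obtain c where "coeff_family N c" "AE z in M. f z = gns_rep N (?b c) (gns_class N id_blinfun) z"
      unfolding BD_poly_iff by blast
    then show "f \<in> borel_measurable M \<and> (\<exists>c. coeff_family N c \<and> (\<forall>m. AE x in \<mu>. f (m, x) = c m x))"
      using eq f by (auto simp: gns_domain_def dest: L2_measurable)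
  next
    assume "f \<in> borel_measurable M \<and> (\<exists>c. coeff_family N c \<and> (\<forall>m. AE x in \<mu>. f (m, x) = c m x))"
    then obtain c where f: "f \<in> borel_measurable M" and c: "coeff_family N c" "\<forall>m. AE x in \<mu>. f (m, x) = c m x"
      by blast
    have "?b c \<in> BD_poly N" using c BD_poly_iff by blast
    then show "f \<in> gns_domain N \<mu>"
      using eq[OF c(1)] c(2) L[OF c(1) f c(2)] unfolding gns_domain_def by blast
  qed
qed

lemma gns_domain_L2: "f \<in> gns_domain N \<mu> \<Longrightarrow> f \<in> L2 M"
  by (simp add: gns_domain_def)

lemma gns_domain_add:
  assumes "f \<in> gns_domain N \<mu>" "g \<in> gns_domain N \<mu>"
  shows "(\<lambda>z. f z + g z) \<in> gns_domain N \<mu>"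
proof -
  obtain c d where c: "coeff_family N c" "\<And>m. AE x in \<mu>. f (m, x) = c m x"
    and d: "coeff_family N d" "\<And>m. AE x in \<mu>. g (m, x) = d m x"
    using assms unfolding gns_domain_iff by metis
  have "coeff_family N (\<lambda>m x. c m x + d m x)"
    unfolding coeff_family_def
  proof
    show "finite {m. (\<lambda>x. c m x + d m x) \<noteq> (\<lambda>_. 0)}"
      by (rule finite_subset[of _ "{m. c m \<noteq> (\<lambda>_. 0)} \<union> {m. d m \<noteq> (\<lambda>_. 0)}"])
        (use c d in \<open>auto simp: coeff_family_def fun_eq_iff\<close>)
  qed (use c d in \<open>simp add: loc_const_add coeff_family_def\<close>)
  moreover have "AE x in \<mu>. f (m, x) + g (m, x) = c m x + d m x" for m
    using c(2)[of m] d(2)[of m] by eventually_elim simp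
  ultimately show ?thesis using assms unfolding gns_domain_iff by auto
qed

lemma gns_domain_scale:
  assumes "f \<in> gns_domain N \<mu>"
  shows "(\<lambda>z. a * f z) \<in> gns_domain N \<mu>"
proof -
  obtain c where c: "coeff_family N c" "\<And>m. AE x in \<mu>. f (m, x) = c m x"
    using assms unfolding gns_domain_iff by metis
  have "coeff_family N (\<lambda>m x. a * c m x)"
    unfolding coeff_family_def
  proof
    show "finite {m. (\<lambda>x. a * c m x) \<noteq> (\<lambda>_. 0)}"
      by (rule finite_subset[of _ "{m. c m \<noteq> (\<lambda>_. 0)}"])
        (use c in \<open>auto simp: coeff_family_def fun_eq_iff\<close>)
  qed (use c in \<open>simp add: loc_const_scale coeff_family_def\<close>)
  moreover have "AE x in \<mu>. a * f (m, x) = a * c m x" for m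
    using c(2)[of m] by eventually_elim simp
  ultimately show ?thesis using assms unfolding gns_domain_iff by auto
qed

end

section \<open>The form of covariant implementations\<close>

lemma Evec_fin: "Evec l \<in> fin_ell2"
  by (simp add: fin_ell2_def Evec.rep_eq)

context haar_setting begin

lemma gns_domainI:
  assumes c: "coeff_family N c" and f: "\<And>m x. x \<in> ZN N \<Longrightarrow> f (m, x) = c m x"
  shows "f \<in> gns_domain N \<mu>"
proof -
  have "f \<in> borel_measurable M" unfolding measurable_gns_iff
  proof
    fix m
    have "c m \<in> borel_measurable \<mu>"
      using c by (intro continuous_measurable loc_const_continuous) (simp add: coeff_family_def)
    then show "(\<lambda>x. f (m, x)) \<in> borel_measurable \<mu>"
      using f by (subst measurable_cong[of _ _ "c m"]) (auto simp: space_mu)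
  qed
  moreover have "AE x in \<mu>. f (m, x) = c m x" for m
    using AE_ZN by eventually_elim (rule f)
  ultimately show ?thesis using c unfolding gns_domain_iff by blast
qed

lemma coeff_family_slice:
  assumes "a \<in> loc_const N"
  shows "coeff_family N (\<lambda>m. if m = k then a else (\<lambda>_. 0))"
proof -
  have "{m. (if m = k then a else (\<lambda>_. 0)) \<noteq> (\<lambda>_. 0)} \<subseteq> {k}" by auto
  from finite_subset[OF this] show ?thesis
    unfolding coeff_family_def using assms loc_const_const[of 0 N] by simp
qed

lemma slice_in_gns_domain:
  assumes "a \<in> loc_const N"
  shows "(\<lambda>(m, x). if m = k then a x else 0) \<in> gns_domain N \<mu>"
  by (rule gns_domainI[OF coeff_family_slice[OF assms, of k]]) simp

text \<open>In the entry from \<open>l\<close> to \<open>l + m\<close>, the product with \<eta> on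
  the left gives \<eta>(l + m - n) c(l) and the other one \<eta>(l) c(l + n), where c is the
  coefficient of index m - n. \<open>PQ\<close> makes this continuous in \<open>zq N l\<close>; it
  is asked after multiplication by \<open>a\<close> so that the terms can merge when translation by
  \<open>n\<close> is trivial.\<close>

lemma is_coeff_commutator:
  assumes comm: "commutator_form N n \<delta> \<eta>" and c: "coeff_family N c"
    and P: "continuous_on (ZN N) P" and Q: "continuous_on (ZN N) Q"
    and PQ: "\<And>l a. a \<in> loc_const N \<Longrightarrow>
      \<eta> (l + m - n) * a (zq N l) - \<eta> l * a (zq N (l + n)) =
      P (zq N l) * a (zq N l) - Q (zq N l) * a (zq N (l + n))"
  shows "is_coeff N (\<delta> (\<Sum>k | c k \<noteq> (\<lambda>_. 0). Vpow k o\<^sub>L diag_op (\<lambda>l. c k (zq N l)))) m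
    (\<lambda>x. P x * c (m - n) x - Q x * c (m - n) (zshift N x n))"
proof -
  let ?b = "\<Sum>k | c k \<noteq> (\<lambda>_. 0). Vpow k o\<^sub>L diag_op (\<lambda>l. c k (zq N l))"
  have b: "?b \<in> BD_poly N" using c BD_poly_iff by blast
  have cont: "continuous_on (ZN N) (c k)" and cL: "c k \<in> loc_const N" for k
    using c loc_const_continuous by (auto simp: coeff_family_def)
  have "Rep_ell2 (\<delta> ?b (Evec l)) (l + m) =
    P (zq N l) * c (m - n) (zq N l) - Q (zq N l) * c (m - n) (zshift N (zq N l) n)" for l
  proof -
    \<comment> \<open>Since \<eta> may be unbounded, the formula for \<open>wshift n \<eta>\<close>
      needs a vector of finite support.\<close>
    have "{i. Rep_ell2 (?b (Evec l)) i \<noteq> 0} \<subseteq> (\<lambda>k. k + l) ` {k. c k \<noteq> (\<lambda>_. 0)}"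
      by (auto simp: Rep_BD_family_Evec[OF c] image_iff) (metis add.commute diff_add_cancel)
    then have fin: "?b (Evec l) \<in> fin_ell2"
      using c finite_subset unfolding fin_ell2_def coeff_family_def by blast
    have \<delta>b: "\<delta> ?b (Evec l) = wshift n \<eta> (?b (Evec l)) - ?b (wshift n \<eta> (Evec l))"
      using comm b Evec_fin by (auto simp: commutator_form_def)
    have "Rep_ell2 (wshift n \<eta> (Evec l)) i = (if i = l + n then \<eta> l else 0)" for i
      by (auto simp: Rep_wshift_fin[OF Evec_fin] Evec.rep_eq)
    from Rep_BD_family_single[OF c this]
    have "Rep_ell2 (\<delta> ?b (Evec l)) (l + m) =
      \<eta> (l + m - n) * c (m - n) (zq N l) - \<eta> l * c (m - n) (zq N (l + n))"
      unfolding \<delta>b minus_ell2.rep_eq Rep_wshift_fin[OF fin] Rep_BD_family_Evec[OF c]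
      by (simp add: algebra_simps)
    then show ?thesis using PQ[OF cL] by (simp add: zshift_zq)
  qed
  then show ?thesis unfolding is_coeff_def
    by (auto intro!: continuous_intros P Q cont continuous_on_zshift_compose)
qed

text \<open>Every \<open>Vtheta\<close> fixes the cyclic vector up to null sets, so covariance gives
  its image the single weight \<open>n\<close>; one angle for each \<open>m\<close> detects
  this.\<close>

lemma covariant_implementation_id_support:
  assumes impl: "covariant_implementation N \<mu> n \<delta> D" and mn: "m \<noteq> n"
  shows "AE x in \<mu>. D (gns_class N id_blinfun) (m, x) = 0"
proof -
  let ?e = "gns_class N id_blinfun"
  \<comment> \<open>Then \<theta> (m - n) = pi, so the phases at \<open>m\<close> and
    \<open>n\<close> are opposite and the value equals its own negative.\<close>
  define \<theta> where "\<theta> = pi / of_int (m - n)"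
  let ?v = "Vtheta (- \<theta>) ?e"
  have e: "?e \<in> gns_domain N \<mu>" and v: "?v \<in> gns_domain N \<mu>"
    by (rule gns_domainI[OF coeff_family_slice[OF loc_const_const[of 1], of 0]],
        auto simp: gns_class_id Vtheta_def)+
  have lin: "L2_linear M (gns_domain N \<mu>) D" using impl by (simp add: covariant_implementation_def)
  have "AE z in M. ?v z = ?e z"
    unfolding AE_gns_iff using AE_ZN by (auto elim!: eventually_mono simp: Vtheta_def gns_class_id)
  then have "AE z in M. D ?v z = D ?e z" by (rule L2_linear_cong_AE[OF lin v e])
  moreover have "AE z in M. Vtheta \<theta> (D ?v) z = cis (of_int n * \<theta>) * D ?e z"
    using impl e by (simp add: covariant_implementation_def)
  ultimately have eqs: "AE x in \<mu>. D ?v (m, x) = D ?e (m, x)"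
    "AE x in \<mu>. Vtheta \<theta> (D ?v) (m, x) = cis (of_int n * \<theta>) * D ?e (m, x)"
    unfolding AE_gns_iff by blast+
  have cis: "cis (\<theta> * of_int m) = - cis (of_int n * \<theta>)"
  proof -
    have "\<theta> * of_int m = pi + of_int n * \<theta>"
      using mn by (simp add: \<theta>_def field_simps)
    then show ?thesis by (simp add: cis_mult[symmetric])
  qed
  from eqs show ?thesis
  proof eventually_elim
    case (elim x)
    then have "- (cis (of_int n * \<theta>) * D ?e (m, x)) = cis (of_int n * \<theta>) * D ?e (m, x)"
      using cis by (simp add: Vtheta_def)
    then have "2 * (cis (of_int n * \<theta>) * D ?e (m, x)) = 0"
      unfolding mult_2 by (metis add.left_inverse)
    then show ?case by simp
  qed
qed

text \<open>The functions \<open>P\<close> and \<open>Q\<close> stand for \<open>\<eta>(l + m - n)\<close> and \<open>\<eta>(l)\<close>.  Where \<open>\<eta>\<close> itself does not extend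
  continuously to \<open>\<int>/N\<int>\<close>, the difference does, and then \<open>Q = 0\<close>.\<close>

lemma implementation_formula:
  assumes comm: "commutator_form N n \<delta> \<eta>" and impl: "covariant_implementation N \<mu> n \<delta> D"
    and P: "\<And>m. continuous_on (ZN N) (P m)" and Q: "continuous_on (ZN N) Q"
    and PQ: "\<And>m l a. a \<in> loc_const N \<Longrightarrow>
      \<eta> (l + m - n) * a (zq N l) - \<eta> l * a (zq N (l + n)) =
      P m (zq N l) * a (zq N l) - Q (zq N l) * a (zq N (l + n))"
  obtains \<psi> where "\<psi> \<in> L2 \<mu>" "\<And>f m. f \<in> gns_domain N \<mu> \<Longrightarrow> AE x in \<mu>. D f (m, x) =
      P m x * f (m - n, x) + (\<psi> x - Q x) * f (m - n, zshift N x n)"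
proof
  let ?e = "gns_class N id_blinfun"
  let ?\<phi> = "D ?e"
  have e: "?e \<in> gns_domain N \<mu>"
    by (rule gns_domainI[OF coeff_family_slice[OF loc_const_const[of 1], of 0]])
      (simp add: gns_class_id)
  have lin: "L2_linear M (gns_domain N \<mu>) D" using impl by (simp add: covariant_implementation_def)
  show "(\<lambda>x. ?\<phi> (n, x)) \<in> L2 \<mu>"
    by (rule L2_section[OF L2_linear_in_L2[OF lin e]])
  fix f m assume f: "f \<in> gns_domain N \<mu>"
  then obtain c where c: "coeff_family N c" and fc: "\<And>k. AE x in \<mu>. f (k, x) = c k x"
    unfolding gns_domain_iff by metis
  let ?b = "\<Sum>k | c k \<noteq> (\<lambda>_. 0). Vpow k o\<^sub>L diag_op (\<lambda>l. c k (zq N l))"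
  have b: "?b \<in> BD_poly N" using c BD_poly_iff by blast
  \<comment> \<open>\<open>f\<close> equals a vector \<pi>(b)[I] only almost everywhere. The
    commutator relation is available for \<open>?F\<close>, and \<open>D\<close> respects
    classes.\<close>
  let ?F = "gns_rep N ?b ?e"
  have Fc: "?F (k, x) = c k x" if "x \<in> ZN N" for k x
    using that by (simp add: gns_rep_id fcoeff_eqI[OF is_coeff_BD_family[OF c]])
  have F: "?F \<in> gns_domain N \<mu>" by (rule gns_domainI[OF c Fc])
  have "AE x in \<mu>. f (k, x) = ?F (k, x)" for k
    using fc[of k] AE_ZN by eventually_elim (simp only: Fc)
  then have "AE z in M. f z = ?F z" unfolding AE_gns_iff by blast
  then have "AE z in M. D f z = D ?F z" by (rule L2_linear_cong_AE[OF lin f F])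
  moreover have "AE z in M. D ?F z - gns_rep N ?b ?\<phi> z = gns_rep N (\<delta> ?b) ?e z"
    using impl b e unfolding covariant_implementation_def by blast
  ultimately have D1: "AE x in \<mu>. D f (m, x) = D ?F (m, x)"
    and D2: "AE x in \<mu>. D ?F (m, x) - gns_rep N ?b ?\<phi> (m, x) = gns_rep N (\<delta> ?b) ?e (m, x)"
    unfolding AE_gns_iff by blast+
  \<comment> \<open>\<open>gns_rep\<close> sums over all slices at a fixed point, so
    \<open>?\<phi>\<close> must vanish on all of them except slice \<open>n\<close> outside one
    common null set.\<close>
  have "AE x in \<mu>. \<forall>k. k \<noteq> n \<longrightarrow> ?\<phi> (k, x) = 0"
    unfolding AE_all_countable using covariant_implementation_id_support[OF impl] by auto
  with D1 D2 fc[of "m - n"] AE_zshift[OF fc[of "m - n"], of n] AE_ZN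
  show "AE x in \<mu>. D f (m, x) =
      P m x * f (m - n, x) + (?\<phi> (n, x) - Q x) * f (m - n, zshift N x n)"
  proof eventually_elim
    case (elim x)
    have "gns_rep N (\<delta> ?b) ?e (m, x) = P m x * c (m - n) x - Q x * c (m - n) (zshift N x n)"
      using elim(5) fcoeff_eqI[OF is_coeff_commutator[OF comm c P Q PQ]] by (simp add: gns_rep_id)
    moreover have "gns_rep N ?b ?\<phi> (m, x) = c (m - n) (zshift N x n) * ?\<phi> (n, x)"
      using elim(5,6) gns_rep_single[of n ?\<phi> x N ?b m]
        fcoeff_eqI[OF is_coeff_BD_family[OF c] zshift_in_ZN[of x N n]] by simp
    ultimately show ?case using elim by (simp add: algebra_simps)
  qed
qed

section \<open>Failure of compactness\<close>

text \<open>Each test function occupies slice \<open>k i\<close> and its image slice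
  \<open>k i + n\<close>, so both norm bounds can be checked over the group.\<close>

lemma gns_not_compactI:
  fixes k :: "nat \<Rightarrow> int" and a :: "nat \<Rightarrow> (nat \<Rightarrow> int) \<Rightarrow> complex"
  assumes lin: "L2_linear M (gns_domain N \<mu>) D"
    and a: "\<And>i. a i \<in> loc_const N" and a1: "\<And>i. L2_norm \<mu> (a i) \<le> K"
    and F: "\<And>i. F i \<in> L2 \<mu>" "\<And>i. L2_norm \<mu> (F i) \<le> K"
    and D: "\<And>i m. AE x in \<mu>. D (\<lambda>(m, x). if m = k i then a i x else 0) (m, x) =
      (if m = k i + n then F i x else 0)"
    and sep: "\<And>i j. i \<noteq> j \<Longrightarrow> L2_norm M (\<lambda>z. (case z of (m, x) \<Rightarrow> if m = k i then a i x else 0) -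
      (case z of (m, x) \<Rightarrow> if m = k j then a j x else 0)) \<ge> 1"
  shows "\<not> compact_parametrices M (gns_domain N \<mu>) D"
proof (rule not_compact_parametricesI[OF _ gns_domain_add gns_domain_scale lin,
      where w = "\<lambda>i (m, x). if m = k i then a i x else 0" and K = K and \<epsilon> = 1])
  let ?w = "\<lambda>i (m, x). if m = k i then a i x else 0"
  show w: "?w i \<in> gns_domain N \<mu>" for i by (rule slice_in_gns_domain[OF a])
  have "L2_norm M (?w i) = L2_norm \<mu> (a i)" for i
    by (rule L2_slice(2)[OF L2_mu_continuous[OF loc_const_continuous[OF a]], where k = "k i"])
      (use L2_measurable[OF gns_domain_L2[OF w]] in auto)
  then show "L2_norm M (?w i) \<le> K" for i using a1 by simp
  have "L2_norm M (D (?w i)) = L2_norm \<mu> (F i)" for i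
    by (rule L2_slice(2)[OF F(1) _ D]) (use L2_measurable[OF L2_linear_in_L2[OF lin w]] in auto)
  then show "L2_norm M (D (?w i)) \<le> K" for i using F by simp
  show "1 \<le> L2_norm M (\<lambda>z. ?w i z - ?w j z)" if "i \<noteq> j" for i j
    by (rule sep[OF that])
qed (use gns_domain_L2 in auto)

lemma L2_norm_mu_const: "L2_norm \<mu> (\<lambda>_. c) = cmod c"
  using measure_mu by (simp add: L2_norm_def space_mu)

text \<open>Indicators of slices do not depend on \<open>x\<close>, so the translation by
  \<open>n\<close> in the second term disappears and the two coefficients add up to
  \<open>P m x - Q x + \<psi> x\<close>. Hence only \<open>P m x - Q x\<close> needs a bound uniform
  in \<open>m\<close>.\<close>

lemma not_compact_bounded_coefficients:
  assumes lin: "L2_linear M (gns_domain N \<mu>) D" and \<psi>: "\<psi> \<in> L2 \<mu>"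
    and D: "\<And>f m. f \<in> gns_domain N \<mu> \<Longrightarrow> AE x in \<mu>. D f (m, x) =
      P m x * f (m - n, x) + (\<psi> x - Q x) * f (m - n, zshift N x n)"
    and P: "\<And>m. continuous_on (ZN N) (P m)" and Q: "continuous_on (ZN N) Q"
    and B: "\<And>m x. x \<in> ZN N \<Longrightarrow> cmod (P m x - Q x) \<le> B"
  shows "\<not> compact_parametrices M (gns_domain N \<mu>) D"
proof (rule gns_not_compactI[OF lin, where k = "\<lambda>i. int i" and a = "\<lambda>_ _. 1"
      and F = "\<lambda>i x. (P (int i + n) x - Q x) + \<psi> x" and K = "1 + \<bar>B\<bar> + L2_norm \<mu> \<psi>" and n = n])
  have PQ: "(\<lambda>x. P m x - Q x) \<in> L2 \<mu>" for m
    by (intro L2_mu_continuous continuous_intros P Q)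
  show "(\<lambda>x. (P (int i + n) x - Q x) + \<psi> x) \<in> L2 \<mu>" for i by (rule L2_add[OF PQ \<psi>])
  have "L2_norm \<mu> (\<lambda>x. P m x - Q x) \<le> L2_norm \<mu> (\<lambda>_. of_real \<bar>B\<bar>)" for m
  proof (rule L2_norm_mono[OF PQ L2_mu_continuous])
    show "AE x in \<mu>. cmod (P m x - Q x) \<le> cmod (complex_of_real \<bar>B\<bar>)"
      using AE_ZN
    proof eventually_elim
      case (elim x)
      then show ?case using B[of x m] by simp
    qed
  qed simp
  then have "L2_norm \<mu> (\<lambda>x. P m x - Q x) \<le> \<bar>B\<bar>" for m by (simp add: L2_norm_mu_const)
  then have "L2_norm \<mu> (\<lambda>x. P m x - Q x) + L2_norm \<mu> \<psi> \<le> 1 + \<bar>B\<bar> + L2_norm \<mu> \<psi>" for m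
    by (simp add: add_increasing)
  then show "L2_norm \<mu> (\<lambda>x. (P (int i + n) x - Q x) + \<psi> x) \<le> 1 + \<bar>B\<bar> + L2_norm \<mu> \<psi>" for i
    by (rule order_trans[OF L2_norm_triangle[OF PQ \<psi>]])
  show "L2_norm \<mu> (\<lambda>_. 1) \<le> 1 + \<bar>B\<bar> + L2_norm \<mu> \<psi>"
    using L2_norm_nonneg[of \<mu> \<psi>] by (simp add: L2_norm_mu_const)
  let ?w = "\<lambda>i (m, x). if m = int i then 1 else (0 :: complex)"
  have w: "?w i \<in> gns_domain N \<mu>" for i
    by (rule slice_in_gns_domain[OF loc_const_const])
  show "AE x in \<mu>. D (?w i) (m, x) = (if m = int i + n then (P (int i + n) x - Q x) + \<psi> x else 0)" for i m
    using D[OF w[of i], of m]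
  proof eventually_elim
    case (elim x)
    then show ?case by (cases "m = int i + n") auto
  qed
  show "1 \<le> L2_norm M (\<lambda>z. ?w i z - ?w j z)" if "i \<noteq> j" for i j
  proof -
    have "L2_norm M (?w i) = L2_norm \<mu> (\<lambda>_. 1)"
      by (rule L2_slice(2)[where k = "int i"])
        (use L2_measurable[OF gns_domain_L2[OF w]] L2_mu_continuous in auto)
    then have "1 = L2_norm M (?w i)" by (simp add: L2_norm_mu_const)
    \<comment> \<open>Different slices are disjoint, so the difference dominates the first indicator
      pointwise.\<close>
    also have "\<dots> \<le> L2_norm M (\<lambda>z. ?w i z - ?w j z)"
    proof (rule L2_norm_mono)
      show "(\<lambda>z. ?w i z - ?w j z) \<in> L2 M" by (intro L2_diff gns_domain_L2 w)
    qed (use that w gns_domain_L2 in auto)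
    finally show ?thesis .
  qed
qed (rule loc_const_const)

end

text \<open>Primes with nonzero exponent are divisors, and so are their powers up to the exponent.
  Finitely many divisors thus leave finitely many primes with finite exponents, and the sum of
  exponents would be finite.\<close>

lemma infinite_divisors:
  assumes "\<not> sn_finite N"
  shows "infinite {j. sn_dvd j N}"
proof
  assume fin: "finite {j. sn_dvd j N}"
  let ?P = "{p. prime p \<and> N p \<noteq> 0}"
  have pow: "sn_dvd (p ^ k) N" if p: "prime p" and k: "enat k \<le> N p" for p k
    unfolding sn_dvd_def
  proof (intro conjI allI impI)
    show "p ^ k > 0" using p by (simp add: prime_gt_0_nat)
    fix q :: nat assume q: "prime q"
    show "enat (multiplicity q (p ^ k)) \<le> N q"
    proof (cases "q = p")
      case True
      then show ?thesis using p k by (simp add: prime_elem_multiplicity_power_distrib prime_imp_prime_elem)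
    next
      case False
      then show ?thesis using p q by (simp add: multiplicity_distinct_prime_power zero_enat_def[symmetric])
    qed
  qed
  have "?P \<subseteq> {j. sn_dvd j N}"
  proof
    fix p assume "p \<in> ?P"
    then have p: "prime p" and "N p \<noteq> 0" by auto
    then have "enat 1 \<le> N p" by (cases "N p") (auto simp: zero_enat_def)
    from pow[OF p this] show "p \<in> {j. sn_dvd j N}" by simp
  qed
  then have finP: "finite ?P" using fin finite_subset by blast
  have finite_exp: "N p \<noteq> \<infinity>" if p: "prime p" for p
  proof
    assume "N p = \<infinity>"
    then have "range (\<lambda>k. p ^ k) \<subseteq> {j. sn_dvd j N}" using pow[OF p] by auto
    then have "finite (range (\<lambda>k. p ^ k))" using fin finite_subset by blast
    moreover have "inj (\<lambda>k. p ^ k)" using prime_gt_1_nat[OF p] by (intro injI) (simp add: power_inject_exp)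
    ultimately show False using finite_imageD infinite_UNIV_nat by blast
  qed
  have fin_sum: "sum N A \<noteq> \<infinity>" if "finite A" "\<forall>p\<in>A. prime p" for A
    using that
  proof (induction A rule: finite_induct)
    case (insert p A)
    then show ?case using finite_exp[of p] by auto
  qed simp
  have "(\<Sum>p\<in>?P. N p) \<noteq> \<infinity>" using fin_sum[OF finP] by blast
  moreover have "(\<Sum>\<^sub>\<infinity>p\<in>{p. prime p}. N p) = (\<Sum>\<^sub>\<infinity>p\<in>?P. N p)"
    by (rule infsum_cong_neutral) auto
  ultimately show False using assms finP unfolding sn_finite_def by simp
qed

text \<open>A character of order exactly \<open>j\<close> factoring through the quotient of order
  \<open>j\<close>, so different divisors give different characters.\<close>

definition character :: "nat \<Rightarrow> (nat \<Rightarrow> int) \<Rightarrow> complex" where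
  "character j x = cis (2 * pi * of_int (x j) / real j)"

lemma character_loc_const: "sn_dvd j N \<Longrightarrow> character j \<in> loc_const N"
  unfolding loc_const_def character_def
  by (intro CollectI exI[of _ j] exI[of _ "\<lambda>t. cis (2 * pi * of_int t / real j)"]) simp

lemma character_zshift:
  assumes j: "sn_dvd j N"
  shows "character j (zshift N x 1) = cis (2 * pi / real j) * character j x"
proof -
  have j0: "j > 0" using j by (simp add: sn_dvd_def)
  \<comment> \<open>\<open>q\<close> is the carry of the reduction modulo \<open>j\<close>; it
    changes the angle by a multiple of 2 pi.\<close>
  define q where "q = (x j + 1) div int j"
  have q: "(x j + 1) mod int j = x j + 1 - int j * q" unfolding q_def by (simp add: minus_mult_div_eq_mod)
  have "2 * pi * of_int (zshift N x 1 j) / real j =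
      (2 * pi / real j + 2 * pi * of_int (x j) / real j) + 2 * pi * of_int (- q)"
    unfolding zshift_apply[OF j] q using j0 by (simp add: field_simps)
  then have "character j (zshift N x 1) =
      cis (2 * pi / real j + 2 * pi * of_int (x j) / real j) * cis (2 * pi * of_int (- q))"
    unfolding character_def cis_mult by simp
  moreover have "cis (2 * pi * of_int (- q)) = 1" by (rule cis_multiple_2pi) simp
  ultimately show ?thesis by (simp add: character_def cis_mult[symmetric])
qed

section \<open>Orthogonality of characters and the case of infinite N with n = 0\<close>

context haar_setting begin

text \<open>Translation by 1 preserves the measure and multiplies the integrand by \<omega>, so the
  integral vanishes once \<omega> differs from 1.\<close>

lemma character_orthogonal:
  assumes j: "sn_dvd j N" and k: "sn_dvd k N" and "j \<noteq> k"
  shows "L2_inner \<mu> (character j) (character k) = 0"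
proof -
  let ?g = "\<lambda>x. cnj (character j x) * character k x"
  define \<omega> where "\<omega> = cis (2 * pi / real k - 2 * pi / real j)"
  have \<omega>_eq: "\<omega> = cnj (cis (2 * pi / real j)) * cis (2 * pi / real k)"
    unfolding \<omega>_def cis_cnj cis_mult by simp
  have jk: "0 < j" "0 < k" using j k by (auto simp: sn_dvd_def)
  have g: "?g \<in> borel_measurable \<mu>"
    using j k by (intro borel_measurable_times borel_measurable_cnj continuous_measurable
        loc_const_continuous character_loc_const)
  have "?g (zshift N x 1) = \<omega> * ?g x" for x
    unfolding character_zshift[OF j] character_zshift[OF k] \<omega>_eq by (simp add: mult_ac)
  then have "(LINT x|\<mu>. \<omega> * ?g x) = (LINT x|\<mu>. ?g (zshift N x 1))" by simp
  also have "\<dots> = (LINT x|\<mu>. ?g x)"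
    using integral_distr[OF zshift_measurable g, of 1] unfolding distr_zshift by simp
  finally have eq: "\<omega> * (LINT x|\<mu>. ?g x) = (LINT x|\<mu>. ?g x)" by simp
  have "\<omega> \<noteq> 1"
  proof
    assume "\<omega> = 1"
    then have "cos (2 * pi / real k - 2 * pi / real j) = 1" by (simp add: \<omega>_def complex_eq_iff)
    then obtain t :: int where "2 * pi / real k - 2 * pi / real j = of_int t * 2 * pi"
      by (auto simp: cos_one_2pi_int)
    then have "2 * pi * (1 / real k - 1 / real j) = 2 * pi * of_int t" by (simp add: algebra_simps)
    \<comment> \<open>Both reciprocals lie in (0, 1], so their difference is an integer only if it
      is 0.\<close>
    then have t: "1 / real k - 1 / real j = of_int t" by simp
    have "0 < 1 / real k" "1 / real k \<le> 1" "0 < 1 / real j" "1 / real j \<le> 1" using jk by auto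
    then have "\<bar>real_of_int t\<bar> < 1" using t by linarith
    then have "t = 0" by linarith
    then show False using t \<open>j \<noteq> k\<close> jk by simp
  qed
  with eq show ?thesis by (simp add: L2_inner_def)
qed

text \<open>On slice 0 the operator multiplies by \<psi>. Characters have modulus 1, so their images
  have at most the norm of \<psi>, even if \<psi> is unbounded; being orthonormal, they stay at
  distance sqrt 2.\<close>

lemma not_compact_infinite:
  assumes inf: "\<not> sn_finite N" and lin: "L2_linear M (gns_domain N \<mu>) D" and \<psi>: "\<psi> \<in> L2 \<mu>"
    and D: "\<And>f m. f \<in> gns_domain N \<mu> \<Longrightarrow> AE x in \<mu>. D f (m, x) = (P m x + \<psi> x) * f (m, x)"
    and P: "\<And>x. P 0 x = 0"
  shows "\<not> compact_parametrices M (gns_domain N \<mu>) D"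
proof -
  obtain j :: "nat \<Rightarrow> nat" where inj: "inj j" and j: "\<And>i. sn_dvd (j i) N"
    using infinite_countable_subset[OF infinite_divisors[OF inf]] by auto
  let ?a = "\<lambda>i. character (j i)" and ?w = "\<lambda>i (m, x). if m = (0::int) then character (j i) x else 0"
  have lc: "?a i \<in> loc_const N" for i by (rule character_loc_const[OF j])
  have aL: "?a i \<in> L2 \<mu>" for i by (intro L2_mu_continuous loc_const_continuous lc)
  have a1: "L2_norm \<mu> (?a i) = 1" for i
    using measure_mu by (simp add: L2_norm_def character_def space_mu)
  have \<psi>a: "(\<lambda>x. ?a i x * \<psi> x) \<in> L2 \<mu>" for i
    by (rule L2_mult_bounded[OF \<psi> L2_measurable[OF aL], where B = 1]) (simp add: character_def)
  have w: "?w i \<in> gns_domain N \<mu>" for i by (rule slice_in_gns_domain[OF lc])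
  show ?thesis
  proof (rule gns_not_compactI[OF lin lc, where k = "\<lambda>_. 0" and F = "\<lambda>i x. ?a i x * \<psi> x"
        and K = "1 + L2_norm \<mu> \<psi>" and n = 0])
    show "L2_norm \<mu> (?a i) \<le> 1 + L2_norm \<mu> \<psi>" for i using a1 L2_norm_nonneg[of \<mu> \<psi>] by simp
    have "L2_norm \<mu> (\<lambda>x. ?a i x * \<psi> x) \<le> L2_norm \<mu> \<psi>" for i
      by (rule L2_norm_mono[OF \<psi>a \<psi>]) (simp add: norm_mult character_def)
    then show "L2_norm \<mu> (\<lambda>x. ?a i x * \<psi> x) \<le> 1 + L2_norm \<mu> \<psi>" for i by (simp add: add_increasing)
    show "AE x in \<mu>. D (?w i) (m, x) = (if m = 0 + 0 then ?a i x * \<psi> x else 0)" for i m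
      using D[OF w[of i], of m]
    proof eventually_elim
      case (elim x)
      then show ?case using P by (cases "m = 0") auto
    qed
    show "1 \<le> L2_norm M (\<lambda>z. ?w i z - ?w k z)" if "i \<noteq> k" for i k
    proof -
      have jk: "j i \<noteq> j k" using inj that by (auto dest: injD)
      have dL: "(\<lambda>x. ?a i x - ?a k x) \<in> L2 \<mu>" by (rule L2_diff[OF aL aL])
      have "L2_norm M (\<lambda>z. ?w i z - ?w k z) = L2_norm \<mu> (\<lambda>x. ?a i x - ?a k x)"
      proof (rule L2_slice(2)[OF dL, where k = 0])
        show "(\<lambda>z. ?w i z - ?w k z) \<in> borel_measurable M"
          by (intro L2_measurable L2_diff gns_domain_L2 w)
      qed auto
      moreover have "(L2_norm \<mu> (\<lambda>x. ?a i x - ?a k x))\<^sup>2 = 2"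
      proof -
        have "complex_of_real ((L2_norm \<mu> (\<lambda>x. ?a i x - ?a k x))\<^sup>2) =
            L2_inner \<mu> (\<lambda>x. ?a i x - ?a k x) (\<lambda>x. ?a i x - ?a k x)"
          by (rule L2_inner_self[symmetric])
        also have "\<dots> = complex_of_real 2"
          unfolding L2_inner_diff_diff[OF aL aL aL aL] character_orthogonal[OF j j jk]
            character_orthogonal[OF j j jk[symmetric]]
          by (simp add: L2_inner_self a1)
        finally show ?thesis unfolding of_real_eq_iff .
      qed
      ultimately show ?thesis by (simp add: power2_le_imp_le L2_norm_nonneg)
    qed
  qed (use \<psi>a in simp_all)
qed

end

section \<open>Finite supernatural numbers\<close>

lemma sn_finiteD:
  assumes "sn_finite N"
  shows "finite {p. prime p \<and> N p \<noteq> 0}" and "prime p \<Longrightarrow> N p \<noteq> \<infinity>"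
proof -
  let ?S = "\<Sum>\<^sub>\<infinity>p\<in>{p. prime p}. N p"
  have le: "sum N F \<le> ?S" if "finite F" "F \<subseteq> {p. prime p}" for F
    using that by (subst nonneg_infsum_complete) (auto intro!: SUP_upper)
  obtain s where s: "?S = enat s" using assms unfolding sn_finite_def by auto
  show "finite {p. prime p \<and> N p \<noteq> 0}"
  proof (rule ccontr)
    assume "infinite {p. prime p \<and> N p \<noteq> 0}"
    \<comment> \<open>One prime more than the total \<open>s\<close> of the exponents, each
      contributing at least 1.\<close>
    then obtain F where F: "F \<subseteq> {p. prime p \<and> N p \<noteq> 0}" "finite F" "card F = Suc s"
      using infinite_arbitrarily_large by blast
    have "1 \<le> N p" if "p \<in> F" for p
    proof -
      have "N p \<noteq> 0" using F that by blast
      then show ?thesis by (cases "N p") (auto simp: zero_enat_def one_enat_def)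
    qed
    then have "(\<Sum>p\<in>F. 1) \<le> sum N F" by (rule sum_mono)
    also have "\<dots> \<le> enat s" using le[of F] F s by auto
    finally show False using F by (simp add: of_nat_eq_enat)
  qed
  show "N p \<noteq> \<infinity>" if "prime p"
    using le[of "{p}"] that s by (cases "N p") auto
qed

lemma sn_dvd_value:
  assumes fin: "sn_finite N" and j: "sn_dvd j N"
  shows "j dvd sn_value N"
proof (rule multiplicity_le_imp_dvd)
  show "j \<noteq> 0" using j by (simp add: sn_dvd_def)
  fix q :: nat assume q: "prime q"
  have "multiplicity q (sn_value N) = (if q \<in> {p. prime p \<and> N p \<noteq> 0} then the_enat (N q) else 0)"
    unfolding sn_value_def
    by (rule multiplicity_prod_prime_powers[OF sn_finiteD(1)[OF fin] _ q]) simp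
  moreover have "the_enat 0 = 0" unfolding zero_enat_def by (rule the_enat.simps)
  ultimately have "multiplicity q (sn_value N) = the_enat (N q)"
    using q by (cases "N q = 0") simp_all
  moreover obtain e where "N q = enat e" using sn_finiteD(2)[OF fin q] by blast
  moreover have "enat (multiplicity q j) \<le> N q" using j q by (simp add: sn_dvd_def)
  ultimately show "multiplicity q j \<le> multiplicity q (sn_value N)" by simp
qed

lemma sn_value_pos:
  assumes "sn_finite N" shows "sn_value N > 0"
  unfolding sn_value_def by (rule prod_pos) (auto intro: prime_gt_0_nat)

lemma finite_divisors:
  assumes "sn_finite N"
  shows "finite {j. sn_dvd j N}"
proof (rule finite_subset)
  show "{j. sn_dvd j N} \<subseteq> {..sn_value N}"
    using dvd_imp_le[OF sn_dvd_value[OF assms] sn_value_pos[OF assms]] by blast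
qed simp

text \<open>Every finite divisor of \<open>N\<close> divides \<open>sn_value N\<close> and hence
  \<open>n\<close>: translation by \<open>n\<close> is invisible on the group.\<close>

lemma zq_add_sn_dvd:
  assumes fin: "sn_finite N" and n: "sn_dvd_int N n"
  shows "zq N (l + n) = zq N l"
proof (rule ZN_eqI[OF zq_in_ZN zq_in_ZN])
  fix j assume j: "sn_dvd j N"
  have "int j dvd n"
    using sn_dvd_value[OF fin j] n unfolding sn_dvd_int_def by (meson dvd_trans int_dvd_int_iff)
  then have "(l + n) mod int j = l mod int j" by (simp add: mod_eq_dvd_iff)
  then show "zq N (l + n) j = zq N l j" using j by (simp add: zq_def)
qed

lemma zshift_sn_dvd:
  assumes fin: "sn_finite N" and n: "sn_dvd_int N n" and x: "x \<in> ZN N"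
  shows "zshift N x (m + n) = zshift N x m"
  unfolding zshift_def zq_add_sn_dvd[OF fin n] ..

lemma finite_ZN:
  assumes "sn_finite N"
  shows "finite (ZN N)"
proof (rule finite_subset)
  show "ZN N \<subseteq> (\<Pi>\<^sub>E j\<in>{j. sn_dvd j N}. {0..<int j})" unfolding ZN_def by blast
qed (intro finite_PiE finite_divisors assms finite_atLeastLessThan_int)

text \<open>As there are finitely many divisors, their least common multiple is itself one, and its
  coordinate determines all others.\<close>

lemma ZN_eq_zq:
  assumes fin: "sn_finite N" and x: "x \<in> ZN N"
  shows "zq N (x (Lcm {j. sn_dvd j N})) = x"
proof (rule ZN_eqI[OF zq_in_ZN x])
  fix j assume j: "sn_dvd j N"
  have "sn_dvd (Lcm {j. sn_dvd j N}) N" by (rule sn_dvd_Lcm[OF finite_divisors[OF fin]]) simp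
  then show "zq N (x (Lcm {j. sn_dvd j N})) j = x j"
    using ZN_mod[OF x j] j by (simp add: zq_def)
qed

text \<open>One coordinate determines the point. Continuity, measurability and boundedness of
  arbitrary functions on the group, \<psi> included, rest on this.\<close>

lemma loc_const_finite:
  assumes fin: "sn_finite N"
  shows "a \<in> loc_const N"
proof -
  have "sn_dvd (Lcm {j. sn_dvd j N}) N" by (rule sn_dvd_Lcm[OF finite_divisors[OF fin]]) simp
  then show ?thesis
    unfolding loc_const_def using ZN_eq_zq[OF fin]
    by (intro CollectI exI[of _ "Lcm {j. sn_dvd j N}"] exI[of _ "\<lambda>t. a (zq N t)"]) simp
qed

section \<open>Atoms, point evaluations and compact multipliers over a finite group\<close>

locale finite_haar_setting = haar_setting +
  assumes fin: "sn_finite N"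
begin

lemma measurable_mu_all: "(f :: _ \<Rightarrow> complex) \<in> borel_measurable \<mu>"
  by (intro continuous_measurable loc_const_continuous loc_const_finite fin)

lemma measurable_gns_all: "(f :: _ \<Rightarrow> complex) \<in> borel_measurable M"
  using measurable_gns_iff measurable_mu_all by blast

lemma measurable_gns_all_real: "(f :: _ \<Rightarrow> real) \<in> borel_measurable M"
  using measurable_compose[OF measurable_gns_all[of "\<lambda>z. complex_of_real (f z)"] borel_measurable_Re] by simp

text \<open>Keeps truncations to finitely many slices inside the domain; these are the approximants
  in the closure argument.\<close>

lemma finite_support_in_gns_domain:
  assumes "finite F" "\<And>m x. m \<notin> F \<Longrightarrow> x \<in> ZN N \<Longrightarrow> f (m, x) = 0"
  shows "f \<in> gns_domain N \<mu>"
proof (rule gns_domainI)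
  let ?c = "\<lambda>m x. if m \<in> F then f (m, x) else 0"
  have "{m. ?c m \<noteq> (\<lambda>_. 0)} \<subseteq> F" by auto
  from finite_subset[OF this assms(1)] show "coeff_family N ?c"
    unfolding coeff_family_def using loc_const_finite[OF fin] by blast
qed (use assms in auto)

lemma singleton_sets:
  assumes "x \<in> ZN N"
  shows "{x} \<in> sets \<mu>"
proof -
  have "closed {y. y j = x j}" for j
    by (rule closed_Collect_eq[OF continuous_on_coordinate[of UNIV "\<lambda>t. t"] continuous_on_const])
  then have "closed (\<Inter>j. {y. y j = x j})" by blast
  moreover have "(\<Inter>j. {y. y j = x j}) = {x}" by (auto simp: fun_eq_iff)
  ultimately have "{x} \<in> sets borel" by (intro borel_closed) simp
  then show ?thesis unfolding sets_mu sets_restrict_space using assms by (intro image_eqI[of _ _ "{x}"]) auto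
qed

text \<open>Translations act transitively on the finitely many points, so one null point would make
  the whole group null.\<close>

lemma measure_singleton_pos:
  assumes x: "x \<in> ZN N"
  shows "measure \<mu> {x} > 0"
proof (rule ccontr)
  assume "\<not> measure \<mu> {x} > 0"
  then have x0: "emeasure \<mu> {x} = 0"
    using measure_nonneg[of \<mu> "{x}"] by (simp add: mu.emeasure_eq_measure)
  have "emeasure \<mu> {y} = 0" if y: "y \<in> ZN N" for y
  proof -
    let ?l = "Lcm {j. sn_dvd j N}"
    define k where "k = y ?l - x ?l"
    have xy: "zshift N x k = y"
      using ZN_eq_zq[OF fin x] ZN_eq_zq[OF fin y] zshift_zq[of N "x ?l" k] by (simp add: k_def)
    have "(\<lambda>x. zshift N x k) -` {y} \<inter> space \<mu> = {x}"
    proof (intro equalityI subsetI)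
      fix z assume "z \<in> (\<lambda>x. zshift N x k) -` {y} \<inter> space \<mu>"
      then have "z \<in> ZN N" "zshift N z k = zshift N x k" using xy by (auto simp: space_mu)
      then have "zshift N (zshift N z k) (- k) = zshift N (zshift N x k) (- k)" by simp
      then show "z \<in> {x}" using x \<open>z \<in> ZN N\<close> by (simp add: zshift_zshift)
    qed (use x xy in \<open>auto simp: space_mu\<close>)
    then have "emeasure (distr \<mu> \<mu> (\<lambda>x. zshift N x k)) {y} = emeasure \<mu> {x}"
      using singleton_sets[OF y] by (simp add: emeasure_distr)
    then show ?thesis using x0 by (simp add: distr_zshift)
  qed
  then have "(\<Sum>y\<in>ZN N. emeasure \<mu> {y}) = 0" by simp
  moreover have "emeasure \<mu> (ZN N) = (\<Sum>y\<in>ZN N. emeasure \<mu> {y})"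
    by (rule emeasure_eq_sum_singleton[OF finite_ZN[OF fin]]) (rule singleton_sets)
  ultimately show False using haar by (simp add: haar_measure_def)
qed

text \<open>Every point of the product has at least the mass \<open>d\<close> of the smallest atom,
  which gives the constant \<open>1 / sqrt d\<close> on all slices at once.\<close>

lemma L2_point_bound:
  obtains c where "c > 0" "\<And>f z. f \<in> L2 M \<Longrightarrow> z \<in> space M \<Longrightarrow> cmod (f z) \<le> c * L2_norm M f"
proof -
  define d where "d = Min ((\<lambda>x. measure \<mu> {x}) ` ZN N)"
  have ne: "ZN N \<noteq> {}" using zq_in_ZN by blast
  have d: "d > 0" "\<And>x. x \<in> ZN N \<Longrightarrow> d \<le> measure \<mu> {x}"
    using finite_ZN[OF fin] ne measure_singleton_pos by (auto simp: d_def)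
  have "cmod (f z) \<le> (1 / sqrt d) * L2_norm M f" if f: "f \<in> L2 M" and z: "z \<in> space M" for f z
  proof -
    obtain m x where mx: "z = (m, x)" "x \<in> ZN N" using z by (auto simp: space_gns)
    have em: "emeasure M {z} = emeasure \<mu> {x}"
      using mu.emeasure_pair_measure_Times[of "{m}" "count_space UNIV" "{x}"] singleton_sets[OF mx(2)]
      by (simp add: gns_measure_def mx(1))
    have zs: "{z} \<in> sets M"
      using pair_measureI[of "{m}" "count_space UNIV" "{x}" \<mu>] singleton_sets[OF mx(2)]
      by (simp add: gns_measure_def mx(1))
    have "(cmod (f z))\<^sup>2 * measure \<mu> {x} = (LINT y|M. (cmod (f z))\<^sup>2 * indicator {z} y)"
      using em zs by (simp add: measure_def)
    also have "\<dots> \<le> (LINT y|M. (cmod (f y))\<^sup>2)"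
    proof (rule integral_mono)
      show "integrable M (\<lambda>y. (cmod (f z))\<^sup>2 * indicator {z} y)"
        using em zs by (intro integrable_mult_right integrable_real_indicator) (auto simp: mu.emeasure_eq_measure)
      show "integrable M (\<lambda>y. (cmod (f y))\<^sup>2)" by (rule L2_integrable[OF f])
    qed (auto split: split_indicator)
    also have "\<dots> = (L2_norm M f)\<^sup>2" by (rule L2_norm_power2[symmetric])
    finally have "(cmod (f z))\<^sup>2 * d \<le> (L2_norm M f)\<^sup>2"
      using d(2)[OF mx(2)] by (meson mult_left_mono order_trans zero_le_power2)
    then have "sqrt ((cmod (f z))\<^sup>2 * d) \<le> sqrt ((L2_norm M f)\<^sup>2)" by (rule real_sqrt_le_mono)
    then show ?thesis using d(1) L2_norm_nonneg[of M f] by (simp add: real_sqrt_mult field_simps)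
  qed
  then show thesis using d(1) that[of "1 / sqrt d"] by simp
qed

text \<open>The space is countable, so enumerating it places the sequence in a countable product of
  closed discs; sequential compactness there replaces a diagonal argument.\<close>

lemma bounded_subsequence_pointwise:
  fixes s :: "nat \<Rightarrow> int \<times> (nat \<Rightarrow> int) \<Rightarrow> complex"
  assumes B: "\<And>k z. z \<in> space M \<Longrightarrow> cmod (s k z) \<le> B"
  obtains r g where "strict_mono (r :: nat \<Rightarrow> nat)" "\<And>z. z \<in> space M \<Longrightarrow> (\<lambda>k. s (r k) z) \<longlonglongrightarrow> g z"
proof -
  have cnt: "countable (space M)"
    unfolding space_gns using countable_finite[OF finite_ZN[OF fin]] by blast
  have ne: "space M \<noteq> {}" unfolding space_gns using zq_in_ZN by blast
  define e where "e = from_nat_into (space M)"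
  have e: "e i \<in> space M" for i unfolding e_def by (rule from_nat_into[OF ne])
  define t where "t k i = s k (e i)" for k i
  have "compactin (product_topology (\<lambda>_. euclidean) UNIV) (PiE UNIV (\<lambda>_ :: nat. cball (0 :: complex) B))"
    unfolding compactin_PiE by simp
  then have "compact (PiE UNIV (\<lambda>_ :: nat. cball (0 :: complex) B))"
    by (simp add: euclidean_product_topology)
  then have "seq_compact (PiE UNIV (\<lambda>_ :: nat. cball (0 :: complex) B))" by (rule compact_imp_seq_compact)
  moreover have "t k \<in> PiE UNIV (\<lambda>_ :: nat. cball (0 :: complex) B)" for k
    using B[OF e] by (simp add: PiE_UNIV_domain t_def)
  ultimately obtain l r where r: "strict_mono (r :: nat \<Rightarrow> nat)" and lim: "(t \<circ> r) \<longlonglongrightarrow> l"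
    unfolding seq_compact_def by metis
  have co: "(\<lambda>k. t (r k) i) \<longlonglongrightarrow> l i" for i
    using continuous_on_tendsto_compose[OF continuous_on_product_coordinates[of i] lim] by (simp add: o_def)
  show thesis
  proof (rule that[OF r])
    fix z assume "z \<in> space M"
    then have "e (to_nat_on (space M) z) = z" unfolding e_def using cnt by simp
    then show "(\<lambda>k. s (r k) z) \<longlonglongrightarrow> l (to_nat_on (space M) z)"
      using co[of "to_nat_on (space M) z"] by (simp add: t_def)
  qed
qed

text \<open>Puts pointwise limits of bounded sequences into L2 before any convergence in norm is
  known.\<close>

lemma L2_Fatou:
  fixes s :: "nat \<Rightarrow> int \<times> (nat \<Rightarrow> int) \<Rightarrow> complex"
  assumes s: "\<And>k. s k \<in> L2 M" "\<And>k. L2_norm M (s k) \<le> K"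
    and lim: "\<And>z. z \<in> space M \<Longrightarrow> (\<lambda>k. s k z) \<longlonglongrightarrow> g z"
  shows "g \<in> L2 M"
proof -
  have K: "0 \<le> K" using s(2)[of 0] L2_norm_nonneg[of M "s 0"] by linarith
  have "(\<integral>\<^sup>+z. ennreal ((cmod (g z))\<^sup>2) \<partial>M) = (\<integral>\<^sup>+z. liminf (\<lambda>k. ennreal ((cmod (s k z))\<^sup>2)) \<partial>M)"
  proof (rule nn_integral_cong)
    fix z assume "z \<in> space M"
    then have "(\<lambda>k. ennreal ((cmod (s k z))\<^sup>2)) \<longlonglongrightarrow> ennreal ((cmod (g z))\<^sup>2)"
      by (intro tendsto_intros lim)
    then show "ennreal ((cmod (g z))\<^sup>2) = liminf (\<lambda>k. ennreal ((cmod (s k z))\<^sup>2))"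
      by (intro lim_imp_Liminf[symmetric]) simp_all
  qed
  also have "\<dots> \<le> liminf (\<lambda>k. \<integral>\<^sup>+z. ennreal ((cmod (s k z))\<^sup>2) \<partial>M)"
    by (rule nn_integral_liminf) (use s(1) in \<open>auto dest!: L2_measurable\<close>)
  also have "\<dots> \<le> ennreal (K\<^sup>2)"
  proof (rule Liminf_le)
    have "(\<integral>\<^sup>+z. ennreal ((cmod (s k z))\<^sup>2) \<partial>M) = ennreal ((L2_norm M (s k))\<^sup>2)" for k
      unfolding L2_norm_power2 using L2_integrable[OF s(1)] by (intro nn_integral_eq_integral) auto
    also have "\<dots> k \<le> ennreal (K\<^sup>2)" for k
      using s(2) L2_norm_nonneg by (intro ennreal_leI power_mono)
    finally show "\<forall>\<^sub>F k in sequentially. (\<integral>\<^sup>+z. ennreal ((cmod (s k z))\<^sup>2) \<partial>M) \<le> ennreal (K\<^sup>2)"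
      by simp
  qed simp
  also have "\<dots> < \<infinity>" by simp
  finally show ?thesis
    using measurable_gns_all[of g] by (simp add: L2_def integrable_iff_bounded)
qed

text \<open>A bounded sequence has a pointwise convergent subsequence. On a window |m| <= L it
  converges in norm by domination; beyond the window the multiplier is small while the sequence
  stays bounded.\<close>

lemma L2_compact_mult:
  fixes r :: "int \<times> (nat \<Rightarrow> int) \<Rightarrow> real"
  assumes r: "\<And>z. 0 \<le> r z \<and> r z \<le> 1"
    and decay: "\<And>\<epsilon>. \<epsilon> > 0 \<Longrightarrow> \<exists>L. \<forall>m x. x \<in> ZN N \<longrightarrow> \<bar>m\<bar> > L \<longrightarrow> r (m, x) \<le> \<epsilon>"
  shows "L2_compact M (\<lambda>f z. complex_of_real (r z) * f z)"
  unfolding L2_compact_def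
proof (intro allI impI)
  fix s :: "nat \<Rightarrow> int \<times> (nat \<Rightarrow> int) \<Rightarrow> complex"
  assume "(\<forall>k. s k \<in> L2 M) \<and> (\<exists>K. \<forall>k. L2_norm M (s k) \<le> K)"
  then obtain K where s: "\<And>k. s k \<in> L2 M" and K: "\<And>k. L2_norm M (s k) \<le> K" by blast
  obtain c where c: "c > 0" "\<And>f z. f \<in> L2 M \<Longrightarrow> z \<in> space M \<Longrightarrow> cmod (f z) \<le> c * L2_norm M f"
    using L2_point_bound by blast
  have B: "cmod (s k z) \<le> c * K" if "z \<in> space M" for k z
    using c(2)[OF s that, of k] K[of k] c(1) by (meson less_imp_le mult_left_mono order_trans)
  obtain \<rho> g where \<rho>: "strict_mono (\<rho> :: nat \<Rightarrow> nat)"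
    and lim: "\<And>z. z \<in> space M \<Longrightarrow> (\<lambda>k. s (\<rho> k) z) \<longlonglongrightarrow> g z"
    using bounded_subsequence_pointwise[of s, OF B] by blast
  have g: "g \<in> L2 M" by (rule L2_Fatou[OF s K lim])
  have gB: "cmod (g z) \<le> c * K" if "z \<in> space M" for z
    by (rule LIMSEQ_le_const2[OF tendsto_norm[OF lim[OF that]]]) (use B[OF that] in auto)
  define d where "d k z = s (\<rho> k) z - g z" for k z
  have dL: "d k \<in> L2 M" for k unfolding d_def by (rule L2_diff[OF s g])
  define K' where "K' = K + L2_norm M g"
  have dK: "L2_norm M (d k) \<le> K'" for k
    unfolding d_def K'_def using L2_norm_triangle_diff[OF s g] K by (meson add_right_mono order_trans)
  have rL: "(\<lambda>z. complex_of_real (r z) * f z) \<in> L2 M" if "f \<in> L2 M" for f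
    by (rule L2_mult_bounded[OF that measurable_gns_all, of _ 1]) (use r in simp)
  have cut: "(\<lambda>k. L2_norm M (\<lambda>z. if \<bar>fst z\<bar> \<le> L then d k z else 0)) \<longlonglongrightarrow> 0" for L
  proof -
    \<comment> \<open>\<open>c * K\<close> bounds the sequence and its limit pointwise, so twice
      this number, cut off to the window, dominates the differences.\<close>
    have "(\<lambda>z. if \<bar>fst z\<bar> \<le> L then complex_of_real (2 * (c * K)) else 0) \<in> gns_domain N \<mu>"
      by (rule finite_support_in_gns_domain[of "{- L..L}"]) auto
    then have int: "integrable M (\<lambda>z. (cmod (if \<bar>fst z\<bar> \<le> L then complex_of_real (2 * (c * K)) else 0))\<^sup>2)"
      by (intro L2_integrable gns_domain_L2)
    have "(\<lambda>k. LINT z|M. (cmod (if \<bar>fst z\<bar> \<le> L then d k z else 0))\<^sup>2) \<longlonglongrightarrow> (LINT z|M. 0)"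
    proof (rule integral_dominated_convergence[OF _ _ int])
      show "AE z in M. (\<lambda>k. (cmod (if \<bar>fst z\<bar> \<le> L then d k z else 0))\<^sup>2) \<longlonglongrightarrow> 0"
      proof (rule AE_I2)
        fix z assume z: "z \<in> space M"
        have "(\<lambda>k. (cmod (d k z))\<^sup>2) \<longlonglongrightarrow> (cmod (g z - g z))\<^sup>2"
          unfolding d_def by (intro tendsto_intros lim z)
        then show "(\<lambda>k. (cmod (if \<bar>fst z\<bar> \<le> L then d k z else 0))\<^sup>2) \<longlonglongrightarrow> 0"
          by (cases "\<bar>fst z\<bar> \<le> L") simp_all
      qed
      show "AE z in M. norm ((cmod (if \<bar>fst z\<bar> \<le> L then d k z else 0))\<^sup>2)
          \<le> (cmod (if \<bar>fst z\<bar> \<le> L then complex_of_real (2 * (c * K)) else 0))\<^sup>2" for k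
      proof (rule AE_I2)
        fix z assume z: "z \<in> space M"
        have "cmod (d k z) \<le> cmod (s (\<rho> k) z) + cmod (g z)" unfolding d_def by (rule norm_triangle_ineq4)
        also have "\<dots> \<le> 2 * (c * K)" using B[OF z, of "\<rho> k"] gB[OF z] by simp
        finally have dk: "cmod (d k z) \<le> 2 * (c * K)" .
        then have "(cmod (d k z))\<^sup>2 \<le> (2 * (c * K))\<^sup>2" by (intro power_mono) auto
        then show "norm ((cmod (if \<bar>fst z\<bar> \<le> L then d k z else 0))\<^sup>2)
            \<le> (cmod (if \<bar>fst z\<bar> \<le> L then complex_of_real (2 * (c * K)) else 0))\<^sup>2"
          by (cases "\<bar>fst z\<bar> \<le> L") (simp_all add: norm_mult power_mult_distrib)
      qed
    qed (rule measurable_gns_all_real)+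
    then show ?thesis unfolding L2_norm_def using tendsto_real_sqrt by fastforce
  qed
  have "(\<lambda>k. L2_norm M (\<lambda>z. complex_of_real (r z) * s (\<rho> k) z - complex_of_real (r z) * g z)) \<longlonglongrightarrow> 0"
  proof (rule LIMSEQ_I)
    fix \<epsilon> :: real assume \<epsilon>: "\<epsilon> > 0"
    have K'0: "0 \<le> K'" using dK[of 0] L2_norm_nonneg[of M "d 0"] by linarith
    \<comment> \<open>Chosen so that the part beyond the window costs less than half of \<epsilon>;
      the summand 1 covers \<open>K' = 0\<close>.\<close>
    define \<epsilon>' where "\<epsilon>' = \<epsilon> / (2 * (K' + 1))"
    have \<epsilon>': "\<epsilon>' > 0" "\<epsilon>' * K' < \<epsilon> / 2" using \<epsilon> K'0 by (auto simp: \<epsilon>'_def field_simps)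
    obtain L where L: "\<And>m x. x \<in> ZN N \<Longrightarrow> \<bar>m\<bar> > L \<Longrightarrow> r (m, x) \<le> \<epsilon>'" using decay[OF \<epsilon>'(1)] by blast
    let ?cut = "\<lambda>k z. if \<bar>fst z\<bar> \<le> L then d k z else 0"
    have cutL: "?cut k \<in> L2 M" for k
      by (rule L2I_bound[OF measurable_gns_all L2_integrable[OF dL[of k]]]) simp
    obtain k0 where k0: "\<And>k. k \<ge> k0 \<Longrightarrow> L2_norm M (?cut k) < \<epsilon> / 2"
      using order_tendstoD(2)[OF cut[of L], of "\<epsilon> / 2"] \<epsilon> unfolding eventually_sequentially by auto
    have main: "L2_norm M (\<lambda>z. complex_of_real (r z) * d k z) \<le> \<epsilon>' * K' + L2_norm M (?cut k)" for k
    proof -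
      let ?u = "\<lambda>z. complex_of_real (\<epsilon>' * cmod (d k z))" and ?v = "\<lambda>z. complex_of_real (cmod (?cut k z))"
      have u: "?u \<in> L2 M"
        using L2_scale[OF dL[of k], of "complex_of_real \<epsilon>'"] measurable_gns_all[of ?u] by (simp add: L2_def norm_mult)
      have v: "?v \<in> L2 M" using cutL[of k] measurable_gns_all[of ?v] by (simp add: L2_def)
      have "L2_norm M (\<lambda>z. complex_of_real (r z) * d k z) \<le> L2_norm M (\<lambda>z. ?u z + ?v z)"
      proof (rule L2_norm_mono[OF rL[OF dL] L2_add[OF u v] AE_I2])
        fix z assume "z \<in> space M"
        then obtain m x where z: "z = (m, x)" "x \<in> ZN N" by (auto simp: space_gns)
        have "r z * cmod (d k z) \<le> \<epsilon>' * cmod (d k z) + cmod (?cut k z)"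
        proof (cases "\<bar>m\<bar> \<le> L")
          case True
          have "r z * cmod (d k z) \<le> cmod (d k z)" using r[of z] by (simp add: mult_left_le_one_le)
          also have "\<dots> \<le> \<epsilon>' * cmod (d k z) + cmod (d k z)" using \<epsilon>' by simp
          finally show ?thesis using True z by simp
        next
          case False
          then show ?thesis using L[OF z(2), of m] z by (simp add: mult_right_mono)
        qed
        moreover have "0 \<le> \<epsilon>' * cmod (d k z) + cmod (?cut k z)" using \<epsilon>' by simp
        ultimately show "cmod (complex_of_real (r z) * d k z) \<le> cmod (?u z + ?v z)"
          using r[of z] unfolding of_real_add[symmetric] norm_of_real by (simp add: norm_mult)
      qed
      also have "\<dots> \<le> L2_norm M ?u + L2_norm M ?v" by (rule L2_norm_triangle[OF u v])
      also have "L2_norm M ?u = \<epsilon>' * L2_norm M (d k)"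
        using L2_norm_scale[of M "complex_of_real \<epsilon>'" "d k"] \<epsilon>' by (simp add: L2_norm_def norm_mult)
      also have "L2_norm M ?v = L2_norm M (?cut k)" by (simp add: L2_norm_def)
      finally show ?thesis using dK[of k] \<epsilon>' mult_left_mono[of "L2_norm M (d k)" K' \<epsilon>'] by linarith
    qed
    have "L2_norm M (\<lambda>z. complex_of_real (r z) * d k z) < \<epsilon>" if "k \<ge> k0" for k
      using main[of k] k0[OF that] \<epsilon>'(2) by linarith
    then show "\<exists>k0. \<forall>k\<ge>k0. norm (L2_norm M (\<lambda>z. complex_of_real (r z) * s (\<rho> k) z - complex_of_real (r z) * g z) - 0) < \<epsilon>"
      by (intro exI[of _ k0]) (simp add: d_def right_diff_distrib L2_norm_nonneg)
  qed
  then show "\<exists>\<rho> h. strict_mono (\<rho> :: nat \<Rightarrow> nat) \<and> h \<in> L2 M \<and>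
      (\<lambda>k. L2_norm M (\<lambda>z. complex_of_real (r z) * s (\<rho> k) z - h z)) \<longlonglongrightarrow> 0"
    using \<rho> rL[OF g] by blast
qed

end

section \<open>Weighted shifts: closure, adjoint and parametrices\<close>

context finite_haar_setting begin

lemma L2_truncation:
  fixes f :: "int \<times> (nat \<Rightarrow> int) \<Rightarrow> complex"
  assumes f: "f \<in> L2 M"
  shows "(\<lambda>k. L2_norm M (\<lambda>z. (if \<bar>fst z\<bar> \<le> int k then f z else 0) - f z)) \<longlonglongrightarrow> 0"
proof -
  have "(\<lambda>k. LINT z|M. (cmod ((if \<bar>fst z\<bar> \<le> int k then f z else 0) - f z))\<^sup>2) \<longlonglongrightarrow> (LINT z|M. 0)"
  proof (rule integral_dominated_convergence[OF _ _ L2_integrable[OF f]])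
    show "AE z in M. (\<lambda>k. (cmod ((if \<bar>fst z\<bar> \<le> int k then f z else 0) - f z))\<^sup>2) \<longlonglongrightarrow> 0"
    proof (rule AE_I2)
      fix z
      have "\<forall>\<^sub>F k in sequentially. (cmod ((if \<bar>fst z\<bar> \<le> int k then f z else 0) - f z))\<^sup>2 = 0"
        by (rule eventually_sequentiallyI[of "nat \<bar>fst z\<bar>"]) auto
      then show "(\<lambda>k. (cmod ((if \<bar>fst z\<bar> \<le> int k then f z else 0) - f z))\<^sup>2) \<longlonglongrightarrow> 0"
        by (rule tendsto_eventually)
    qed
  qed (rule measurable_gns_all_real | rule AE_I2, simp)+
  then show ?thesis unfolding L2_norm_def using tendsto_real_sqrt by fastforce
qed

text \<open>Truncating the input truncates \<open>A z * f z\<close> in the same way, so the error in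
  the image is a shifted tail of that product; both tails tend to 0.\<close>

lemma weighted_shift_closure:
  assumes D: "\<And>f m. f \<in> gns_domain N \<mu> \<Longrightarrow> AE x in \<mu>. D f (m, x) = A (m - n, x) * f (m - n, x)"
    and f: "f \<in> L2 M" and Af: "(\<lambda>z. A z * f z) \<in> L2 M"
  shows "(f, \<lambda>z. A (fst z - n, snd z) * f (fst z - n, snd z)) \<in>
    closure_graph M (gns_domain N \<mu>) D"
proof -
  let ?g = "\<lambda>z. A (fst z - n, snd z) * f (fst z - n, snd z)"
  let ?t = "\<lambda>k f z. if \<bar>fst z\<bar> \<le> int k then f z else (0 :: complex)"
  have g: "?g \<in> L2 M" by (rule L2_shift(1)[OF Af])
  have t: "?t k f \<in> gns_domain N \<mu>" for k
    by (rule finite_support_in_gns_domain[of "{- int k..int k}"]) auto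
  have "L2_norm M (\<lambda>z. D (?t k f) z - ?g z) = L2_norm M (\<lambda>z. ?t k (\<lambda>z. A z * f z) z - A z * f z)" for k
  proof -
    let ?d = "\<lambda>z. ?t k (\<lambda>z. A z * f z) z - A z * f z"
    have "?t k (\<lambda>z. A z * f z) \<in> L2 M"
      by (rule L2I_bound[OF measurable_gns_all L2_integrable[OF Af]]) simp
    then have d: "?d \<in> L2 M" by (rule L2_diff[OF _ Af])
    have "AE z in M. D (?t k f) z - ?g z = ?d (fst z - n, snd z)"
      unfolding AE_gns_iff
    proof
      fix m
      show "AE x in \<mu>. D (?t k f) (m, x) - ?g (m, x) = ?d (fst (m, x) - n, snd (m, x))"
        using D[OF t[of k], of m] by eventually_elim simp
    qed
    then have "L2_norm M (\<lambda>z. D (?t k f) z - ?g z) = L2_norm M (\<lambda>z. ?d (fst z - n, snd z))"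
      by (rule L2_norm_cong_AE[OF measurable_gns_all measurable_gns_all])
    also have "\<dots> = L2_norm M ?d" by (rule L2_shift(2)[OF d])
    finally show ?thesis .
  qed
  then have "(\<lambda>k. L2_norm M (\<lambda>z. D (?t k f) z - ?g z)) \<longlonglongrightarrow> 0"
    using L2_truncation[OF Af] by simp
  then show ?thesis
    unfolding closure_graph_def using f g t L2_truncation[OF f]
    by (intro CollectI case_prodI conjI exI[of _ "\<lambda>k. ?t k f"]) auto
qed

text \<open>Replacing \<open>m\<close> by \<open>m + n\<close> in the pairing moves the shift onto
  \<open>u\<close> and the weight across as its conjugate.\<close>

lemma weighted_shift_adjoint:
  assumes lin: "L2_linear M (gns_domain N \<mu>) D"
    and D: "\<And>f m. f \<in> gns_domain N \<mu> \<Longrightarrow> AE x in \<mu>. D f (m, x) = A (m - n, x) * f (m - n, x)"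
    and u: "u \<in> L2 M" and v: "(\<lambda>z. cnj (A z) * u (fst z + n, snd z)) \<in> L2 M"
  shows "(u, \<lambda>z. cnj (A z) * u (fst z + n, snd z)) \<in>
    adjoint_graph M (closure_graph M (gns_domain N \<mu>) D)"
proof (rule adjoint_closure_graphI[OF _ u v])
  fix f assume f: "f \<in> gns_domain N \<mu>"
  show "f \<in> L2 M \<and> D f \<in> L2 M" using gns_domain_L2[OF f] L2_linear_in_L2[OF lin f] by blast
  let ?g = "\<lambda>z. cnj (A z * f z) * u (fst z + n, snd z)"
  have "AE z in M. D f z = A (fst z - n, snd z) * f (fst z - n, snd z)"
    unfolding AE_gns_iff using D[OF f] by simp
  then have "L2_inner M (D f) u = L2_inner M (\<lambda>z. A (fst z - n, snd z) * f (fst z - n, snd z)) u"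
    by (intro L2_inner_cong_AE measurable_gns_all) simp_all
  also have "\<dots> = (LINT z|M. ?g (fst z - n, snd z))" by (simp add: L2_inner_def)
  also have "\<dots> = (LINT z|M. ?g z)" by (rule integral_shift(1)[OF measurable_gns_all])
  also have "\<dots> = L2_inner M f (\<lambda>z. cnj (A z) * u (fst z + n, snd z))"
    unfolding L2_inner_def by (intro Bochner_Integration.integral_cong) (simp_all add: mult_ac)
  finally show "L2_inner M (D f) u = \<dots>" .
qed

text \<open>\<open>D\<close> is multiplication by \<open>A\<close> followed by the unitary shift by
  \<open>n\<close>, so the two products with the adjoint act as |A|^2 and as its shifted copy. Their
  resolvents have the square roots \<open>r\<close> and \<open>r'\<close>, which decay because
  \<open>A\<close> grows linearly in \<open>m\<close>.\<close>

lemma compact_parametrices_weighted_shift: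
  assumes lin: "L2_linear M (gns_domain N \<mu>) D"
    and D: "\<And>f m. f \<in> gns_domain N \<mu> \<Longrightarrow> AE x in \<mu>. D f (m, x) = A (m - n, x) * f (m - n, x)"
    and C: "C \<noteq> 0" and B: "\<And>m x. x \<in> ZN N \<Longrightarrow> cmod (A (m, x) - C * of_int m) \<le> B"
  shows "compact_parametrices M (gns_domain N \<mu>) D"
proof -
  let ?G = "closure_graph M (gns_domain N \<mu>) D"
  let ?Gs = "adjoint_graph M ?G"
  define r where "r z = 1 / sqrt (1 + (cmod (A z))\<^sup>2)" for z
  define r' where "r' z = r (fst z - n, snd z)" for z :: "int \<times> (nat \<Rightarrow> int)"
  have pos: "0 < 1 + (cmod (A z))\<^sup>2" for z by (simp add: add_pos_nonneg)
  have r01: "0 \<le> r z \<and> r z \<le> 1" for z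
  proof -
    have "1 \<le> sqrt (1 + (cmod (A z))\<^sup>2)" by simp
    then show ?thesis unfolding r_def using pos[of z] by (auto simp: divide_le_eq_1)
  qed
  then have r'01: "0 \<le> r' z \<and> r' z \<le> 1" for z by (simp add: r'_def)
  have rr: "(r z)\<^sup>2 * (1 + (cmod (A z))\<^sup>2) = 1" for z
    using pos[of z] by (simp add: r_def power_divide)
  \<comment> \<open>The resolvent equation r^2 (1 + |A|^2) w = w, bracketed in the order in which
    the operators are composed below.\<close>
  have rrc: "complex_of_real (r z) * (complex_of_real (r z) * w)
      + A z * (cnj (A z) * (complex_of_real (r z) * (complex_of_real (r z) * w))) = w" for z w
  proof -
    have "complex_of_real ((r z)\<^sup>2 * (1 + (cmod (A z))\<^sup>2)) =
        (complex_of_real (r z) * complex_of_real (r z)) * (1 + A z * cnj (A z))"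
      unfolding of_real_mult of_real_add of_real_1 complex_norm_square by (simp add: power2_eq_square)
    then have "(complex_of_real (r z) * complex_of_real (r z)) * (1 + A z * cnj (A z)) * w = w"
      unfolding rr by (metis mult_1 of_real_1)
    then show ?thesis by (simp add: algebra_simps)
  qed
  have b1: "cmod (complex_of_real (r z)) \<le> 1" for z using r01 by simp
  have b2: "cmod (A z * complex_of_real (r z)) \<le> 1" for z
  proof (rule power2_le_imp_le)
    have "(cmod (A z * complex_of_real (r z)))\<^sup>2 = (r z)\<^sup>2 * (cmod (A z))\<^sup>2"
      by (simp add: norm_mult power_mult_distrib)
    also have "\<dots> \<le> (r z)\<^sup>2 * (1 + (cmod (A z))\<^sup>2)" by (intro mult_left_mono) auto
    also have "\<dots> = 1" by (rule rr)
    finally show "(cmod (A z * complex_of_real (r z)))\<^sup>2 \<le> 1\<^sup>2" by simp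
  qed simp
  have mult: "(\<lambda>z. w z * f z) \<in> L2 M" if "f \<in> L2 M" "\<And>z. cmod (w z) \<le> 1" for w f
    by (rule L2_mult_bounded[OF that(1) measurable_gns_all that(2)])
  \<comment> \<open>\<open>A\<close> alone is unbounded, so each factor \<open>A\<close> or its
    conjugate is paired with one factor \<open>r\<close>.\<close>
  have L: "(\<lambda>z. complex_of_real (r z) * (complex_of_real (r z) * f z)) \<in> L2 M"
      "(\<lambda>z. A z * (complex_of_real (r z) * (complex_of_real (r z) * f z))) \<in> L2 M"
      "(\<lambda>z. cnj (A z) * (complex_of_real (r z) * (complex_of_real (r z) * f z))) \<in> L2 M"
      "(\<lambda>z. A z * (cnj (A z) * (complex_of_real (r z) * (complex_of_real (r z) * f z)))) \<in> L2 M"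
    if f: "f \<in> L2 M" for f
  proof -
    show "(\<lambda>z. complex_of_real (r z) * (complex_of_real (r z) * f z)) \<in> L2 M"
      by (intro mult f b1)
    have "(\<lambda>z. (A z * complex_of_real (r z)) * (complex_of_real (r z) * f z)) \<in> L2 M"
      by (intro mult f b1 b2)
    then show "(\<lambda>z. A z * (complex_of_real (r z) * (complex_of_real (r z) * f z))) \<in> L2 M"
      by (simp add: mult.assoc)
    have b3: "cmod (cnj (A z) * complex_of_real (r z)) \<le> 1" for z
      using b2[of z] by (simp add: norm_mult)
    have "(\<lambda>z. (cnj (A z) * complex_of_real (r z)) * (complex_of_real (r z) * f z)) \<in> L2 M"
      by (intro mult f b1 b3)
    then show "(\<lambda>z. cnj (A z) * (complex_of_real (r z) * (complex_of_real (r z) * f z))) \<in> L2 M"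
      by (simp add: mult.assoc)
    have "(\<lambda>z. (A z * complex_of_real (r z)) * ((cnj (A z) * complex_of_real (r z)) * f z)) \<in> L2 M"
      by (intro mult f b2 b3)
    then show "(\<lambda>z. A z * (cnj (A z) * (complex_of_real (r z) * (complex_of_real (r z) * f z)))) \<in> L2 M"
      by (simp add: mult_ac)
  qed
  have GL: "?G \<subseteq> L2 M \<times> L2 M" by (auto dest: closure_graph_L2)
  have GsL: "?Gs \<subseteq> L2 M \<times> L2 M" by (auto dest: adjoint_graph_L2)
  have 1: "inv_sqrt M (?G O ?Gs) (\<lambda>f z. complex_of_real (r z) * f z)"
  proof (rule inv_sqrtI[OF L2_positive_mult[OF measurable_gns_all_real r01]])
    show "?G O ?Gs \<subseteq> L2 M \<times> L2 M" using GL GsL by auto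
    show "(f', h) \<in> ?G O ?Gs" if "(f, h) \<in> ?G O ?Gs" "f' \<in> L2 M" "AE x in M. f x = f' x" for f f' h
      using that closure_graph_cong_AE[OF _ gns_domain_L2] by blast
    fix g assume g: "g \<in> L2 M"
    let ?f = "\<lambda>z. complex_of_real (r z) * (complex_of_real (r z) * g z)"
    let ?u = "\<lambda>z. A (fst z - n, snd z) * ?f (fst z - n, snd z)"
    let ?h = "\<lambda>z. cnj (A z) * ?u (fst z + n, snd z)"
    have fu: "(?f, ?u) \<in> ?G"
      by (rule weighted_shift_closure[OF D L(1)[OF g] L(2)[OF g]])
    have h_eq: "?h = (\<lambda>z. A z * (cnj (A z) * ?f z))" by (simp add: fun_eq_iff mult_ac)
    have hL: "?h \<in> L2 M" unfolding h_eq by (rule L(4)[OF g])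
    have "(?u, ?h) \<in> ?Gs"
      by (rule weighted_shift_adjoint[OF lin D _ hL]) (use closure_graph_L2[OF fu] in blast)+
    moreover have "g x = ?f x + ?h x" for x
      using rrc[of x "g x"] by (simp add: mult_ac)
    then have "AE x in M. g x = ?f x + ?h x" by (rule AE_I2)
    ultimately show "\<exists>h. (?f, h) \<in> ?G O ?Gs \<and> (AE x in M. g x = ?f x + h x)"
      using fu by blast
  qed (rule closure_adjoint_mono)
  have 2: "inv_sqrt M (?Gs O ?G) (\<lambda>f z. complex_of_real (r' z) * f z)"
  proof (rule inv_sqrtI[OF L2_positive_mult[OF measurable_gns_all_real r'01]])
    show "?Gs O ?G \<subseteq> L2 M \<times> L2 M" using GL GsL by auto
    show "(f', h) \<in> ?Gs O ?G" if "(f, h) \<in> ?Gs O ?G" "f' \<in> L2 M" "AE x in M. f x = f' x" for f f' h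
      using that adjoint_graph_cong_AE[OF _ GL] by blast
    fix g assume g: "g \<in> L2 M"
    \<comment> \<open>Shifting the input back turns \<open>r'\<close> into \<open>r\<close>, so the
      integrability facts of the first product apply.\<close>
    let ?g' = "\<lambda>z. g (fst z + n, snd z)"
    have g': "?g' \<in> L2 M" using L2_shift(1)[OF g, of "- n"] by simp
    let ?f = "\<lambda>z. complex_of_real (r' z) * (complex_of_real (r' z) * g z)"
    let ?u = "\<lambda>z. cnj (A z) * ?f (fst z + n, snd z)"
    let ?h = "\<lambda>z. A (fst z - n, snd z) * ?u (fst z - n, snd z)"
    have u_eq: "?u = (\<lambda>z. cnj (A z) * (complex_of_real (r z) * (complex_of_real (r z) * ?g' z)))"
      by (simp add: fun_eq_iff r'_def)
    have u: "?u \<in> L2 M" unfolding u_eq by (rule L(3)[OF g'])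
    have fL: "?f \<in> L2 M" using r'01 by (intro mult g) auto
    have "(?f, ?u) \<in> ?Gs" by (rule weighted_shift_adjoint[OF lin D fL u])
    moreover have "(?u, ?h) \<in> ?G"
    proof (rule weighted_shift_closure[OF D u])
      show "(\<lambda>z. A z * ?u z) \<in> L2 M" using L(4)[OF g'] by (simp add: r'_def)
    qed
    moreover have "?f z + ?h z = g z" for z
      using rrc[of "(fst z - n, snd z)" "g z"] by (simp add: r'_def)
    then have "AE x in M. g x = ?f x + ?h x" by simp
    ultimately show "\<exists>h. (?f, h) \<in> ?Gs O ?G \<and> (AE x in M. g x = ?f x + h x)" by blast
  qed (rule adjoint_closure_mono)
  have decay: "\<exists>L. \<forall>m x. x \<in> ZN N \<longrightarrow> \<bar>m\<bar> > L \<longrightarrow> r (m, x) \<le> \<epsilon>" if \<epsilon>: "\<epsilon> > 0" for \<epsilon>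
  proof (intro exI allI impI)
    \<comment> \<open>The threshold gives |A| >= |C| |m| - B >= 1 / \<epsilon>, and r is at most 1 /
      |A|.\<close>
    fix m :: int and x assume x: "x \<in> ZN N" and m: "\<bar>m\<bar> > \<lceil>(B + 1 / \<epsilon>) / cmod C\<rceil>"
    have "(B + 1 / \<epsilon>) / cmod C \<le> \<bar>real_of_int m\<bar>" using m by linarith
    then have "B + 1 / \<epsilon> \<le> cmod (C * of_int m)" using C by (simp add: field_simps norm_mult)
    also have "\<dots> \<le> cmod (A (m, x)) + cmod (A (m, x) - C * of_int m)"
      by (metis norm_minus_commute norm_triangle_sub)
    finally have A: "1 / \<epsilon> \<le> cmod (A (m, x))" using B[OF x, of m] by linarith
    also have "\<dots> \<le> sqrt (1 + (cmod (A (m, x)))\<^sup>2)" by (rule real_le_rsqrt) simp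
    finally show "r (m, x) \<le> \<epsilon>" using \<epsilon> pos[of "(m, x)"] unfolding r_def by (simp add: field_simps)
  qed
  have decay': "\<exists>L. \<forall>m x. x \<in> ZN N \<longrightarrow> \<bar>m\<bar> > L \<longrightarrow> r' (m, x) \<le> \<epsilon>" if \<epsilon>: "\<epsilon> > 0" for \<epsilon>
  proof -
    obtain L where L: "\<And>m x. x \<in> ZN N \<Longrightarrow> \<bar>m\<bar> > L \<Longrightarrow> r (m, x) \<le> \<epsilon>" using decay[OF \<epsilon>] by blast
    show ?thesis by (intro exI[of _ "L + \<bar>n\<bar>"] allI impI) (auto simp: r'_def intro!: L)
  qed
  show ?thesis
    unfolding compact_parametrices_def Let_def
    using 1 2 L2_compact_mult[OF r01 decay] L2_compact_mult[OF r'01 decay'] by blast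
qed

end

section \<open>Orbit sums and the assembly of the three cases\<close>

lemma (in haar_setting) AE_gns_pair_iff:
  "(AE (m, x) in M. P m x) \<longleftrightarrow> (\<forall>m. AE x in \<mu>. P m x)"
  by (simp add: AE_gns_iff)

text \<open>The increments of \<open>\<eta>t\<close> telescope along the dense orbit; a negative
  range is the nonnegative one started at \<open>l + m\<close>.\<close>

lemma orbit_sum_telescope:
  assumes "\<And>l. gt (zq N l) = \<eta>t (l + 1) - (\<eta>t l :: complex)"
  shows "orbit_sum N gt m (zq N l) = \<eta>t (l + m) - \<eta>t l"
proof -
  have up: "(\<Sum>k\<in>{0..<int i}. gt (zq N (l + k))) = \<eta>t (l + int i) - \<eta>t l" for i l
  proof (induction i)
    case (Suc i)
    have "{0..<int (Suc i)} = insert (int i) {0..<int i}" by auto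
    then show ?case using Suc assms[of "l + int i"] by (simp add: add_ac)
  qed simp
  show ?thesis
  proof (cases "0 \<le> m")
    case True
    then show ?thesis using up[of l "nat m"] by (simp add: orbit_sum_def zshift_zq)
  next
    case False
    have "(\<Sum>k\<in>{m..<0}. gt (zq N (l + k))) = (\<Sum>k\<in>{0..<- m}. gt (zq N (l + m + k)))"
      by (rule sum.reindex_bij_witness[of _ "\<lambda>k. k + m" "\<lambda>k. k - m"]) (auto simp: algebra_simps)
    then show ?thesis using False up[of "l + m" "nat (- m)"] by (simp add: orbit_sum_def zshift_zq)
  qed
qed

lemma continuous_on_orbit_sum:
  "continuous_on (ZN N) gt \<Longrightarrow> continuous_on (ZN N) (orbit_sum N gt m)"
  unfolding orbit_sum_def
  by (cases "0 \<le> m") (auto intro!: continuous_intros continuous_on_zshift_compose)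

theorem theorem5p3:
  fixes N :: supernat and n :: int
    and \<mu> :: "(nat \<Rightarrow> int) measure"
    and \<delta> :: "(ell2 \<Rightarrow>\<^sub>L ell2) \<Rightarrow> (ell2 \<Rightarrow>\<^sub>L ell2)"
    and \<eta> :: "int \<Rightarrow> complex"
    and h gt ht :: "(nat \<Rightarrow> int) \<Rightarrow> complex" and C :: complex
    and D :: "(int \<times> (nat \<Rightarrow> int) \<Rightarrow> complex) \<Rightarrow> int \<times> (nat \<Rightarrow> int) \<Rightarrow> complex"
  assumes haar: "haar_measure N \<mu>"
    and derivation: "covariant_derivation N n \<delta>"
    and eta: "commutator_form N n \<delta> \<eta>"
    and data: "associated_data N \<mu> n \<eta> h C gt ht"
    and implementation: "covariant_implementation N \<mu> n \<delta> D"
  shows "(\<exists>\<psi>\<in>L2 \<mu>. \<forall>f\<in>gns_domain N \<mu>.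
      (\<not> sn_finite N \<and> n \<noteq> 0 \<or> sn_finite N \<and> \<not> sn_dvd_int N n \<longrightarrow>
        (AE (m, x) in gns_measure \<mu>. D f (m, x) =
          h (zshift N x (m - n)) * f (m - n, x) + (\<psi> x - h x) * f (m - n, zshift N x n))) \<and>
      (\<not> sn_finite N \<and> n = 0 \<longrightarrow>
        (AE (m, x) in gns_measure \<mu>. D f (m, x) =
          (C * of_int m + orbit_sum N gt m x + \<psi> x) * f (m, x))) \<and>
      (sn_finite N \<and> sn_dvd_int N n \<longrightarrow>
        (AE (m, x) in gns_measure \<mu>. D f (m, x) =
          (C * of_int (m - n) + ht (zshift N x m) - ht x + \<psi> x) * f (m - n, x)))) \<and>
    (sn_finite N \<and> sn_dvd_int N n \<longrightarrow>
      (compact_parametrices (gns_measure \<mu>) (gns_domain N \<mu>) D \<longleftrightarrow> C \<noteq> 0)) \<and>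
    (\<not> (sn_finite N \<and> sn_dvd_int N n) \<longrightarrow>
      \<not> compact_parametrices (gns_measure \<mu>) (gns_domain N \<mu>) D)"
proof -
  interpret haar_setting N \<mu> by (rule haar_setting.intro[OF haar])
  have lin: "L2_linear M (gns_domain N \<mu>) D"
    using implementation by (simp add: covariant_implementation_def)
  note formula = implementation_formula[OF eta implementation]
  show ?thesis
  proof (cases "inner_case N n")
    case True
    then have h: "continuous_on (ZN N) h" and \<eta>: "\<And>l. \<eta> l = h (zq N l)"
      using data by (auto simp: associated_data_def)
    \<comment> \<open>Here \<eta> itself extends continuously, so the two terms of the commutator
      are kept apart, with \<open>Q = h\<close>.\<close>
    let ?P = "\<lambda>m x. h (zshift N x (m - n))"
    have P: "continuous_on (ZN N) (?P m)" for m by (rule continuous_on_zshift_compose[OF h])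
    obtain \<psi> where \<psi>: "\<psi> \<in> L2 \<mu>"
      and D: "\<And>f m. f \<in> gns_domain N \<mu> \<Longrightarrow> AE x in \<mu>. D f (m, x) =
        ?P m x * f (m - n, x) + (\<psi> x - h x) * f (m - n, zshift N x n)"
    proof (rule formula[where P = ?P and Q = h, OF P h])
      show "\<eta> (l + m - n) * a (zq N l) - \<eta> l * a (zq N (l + n)) =
          ?P m (zq N l) * a (zq N l) - h (zq N l) * a (zq N (l + n))" for m l a
        by (simp add: \<eta> zshift_zq algebra_simps)
    qed blast
    obtain B where B: "\<And>x. x \<in> ZN N \<Longrightarrow> cmod (h x) \<le> B"
      using continuous_ZN_bounded[OF h] by blast
    have "cmod (?P m x - h x) \<le> 2 * B" if "x \<in> ZN N" for m x
      using norm_triangle_ineq4[of "?P m x" "h x"] B[OF that] B[OF zshift_in_ZN[OF that], of "m - n"] by linarith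
    from not_compact_bounded_coefficients[OF lin \<psi> D P h this]
    have nc: "\<not> compact_parametrices M (gns_domain N \<mu>) D" by blast
    have "\<not> (sn_finite N \<and> sn_dvd_int N n)" "\<not> (\<not> sn_finite N \<and> n = 0)"
      using True by (auto simp: inner_case_def)
    then show ?thesis
      unfolding AE_gns_pair_iff using nc \<psi> D by blast
  next
    case not_inner: False
    then obtain \<eta>t where gt: "continuous_on (ZN N) gt"
      and \<eta>: "\<And>l. \<eta> l = C * of_int l + \<eta>t l" and gt_\<eta>t: "\<And>l. gt (zq N l) = \<eta>t (l + 1) - \<eta>t l"
      and ht: "sn_finite N \<and> sn_dvd_int N n \<longrightarrow> continuous_on (ZN N) ht \<and> (\<forall>l. \<eta>t l = ht (zq N l))"
      using data unfolding associated_data_def by blast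
    show ?thesis
    proof (cases "sn_finite N")
      case infinite: False
      then have n: "n = 0" using not_inner by (simp add: inner_case_def)
      \<comment> \<open>With n = 0 the commutator involves only \<eta>(l + m) - \<eta>(l), which
        extends continuously and is put into \<open>P\<close>.\<close>
      let ?P = "\<lambda>m x. C * of_int m + orbit_sum N gt m x"
      have P: "continuous_on (ZN N) (?P m)" for m
        by (intro continuous_intros continuous_on_orbit_sum gt)
      obtain \<psi> where \<psi>: "\<psi> \<in> L2 \<mu>"
        and D: "\<And>f m. f \<in> gns_domain N \<mu> \<Longrightarrow> AE x in \<mu>. D f (m, x) =
          ?P m x * f (m - n, x) + (\<psi> x - 0) * f (m - n, zshift N x n)"
      proof (rule formula[where P = ?P and Q = "\<lambda>_. 0", OF P continuous_on_const])
        show "\<eta> (l + m - n) * a (zq N l) - \<eta> l * a (zq N (l + n)) =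
            ?P m (zq N l) * a (zq N l) - 0 * a (zq N (l + n))" for m l and a :: "_ \<Rightarrow> complex"
          by (simp add: n \<eta> orbit_sum_telescope[of gt N \<eta>t, OF gt_\<eta>t] algebra_simps)
      qed blast
      have D': "AE x in \<mu>. D f (m, x) = (?P m x + \<psi> x) * f (m, x)" if "f \<in> gns_domain N \<mu>" for f m
        using D[OF that, of m] AE_ZN by eventually_elim (simp add: n algebra_simps)
      \<comment> \<open>On slice 0 the linear term and the orbit sum are both absent, which leaves
        \<psi>.\<close>
      have "?P 0 x = 0" for x by (simp add: orbit_sum_def)
      from not_compact_infinite[where P = ?P, OF infinite lin \<psi> D' this]
      have nc: "\<not> compact_parametrices M (gns_domain N \<mu>) D" .
      show ?thesis
        unfolding AE_gns_pair_iff using infinite n \<psi> D' nc by auto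
    next
      case finite: True
      then have n: "sn_dvd_int N n" using not_inner by (simp add: inner_case_def)
      interpret finite_haar_setting N \<mu> by unfold_locales (rule finite)
      have ht: "continuous_on (ZN N) ht" and \<eta>t: "\<And>l. \<eta>t l = ht (zq N l)" using ht finite n by auto
      \<comment> \<open>Translation by \<open>n\<close> is trivial, so both commutator terms carry
        the same coefficient function and the whole difference of \<eta> goes into
        \<open>P\<close>.\<close>
      let ?P = "\<lambda>m x. C * of_int (m - n) + ht (zshift N x m) - ht x"
      have P: "continuous_on (ZN N) (?P m)" for m
        by (intro continuous_intros continuous_on_zshift_compose ht)
      have zq: "zq N (l + n) = zq N l" "zq N (l + m - n) = zq N (l + m)" for l m
        using zq_add_sn_dvd[OF finite n, of l] zq_add_sn_dvd[OF finite n, of "l + m - n"] by simp_all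
      obtain \<psi> where \<psi>: "\<psi> \<in> L2 \<mu>"
        and D: "\<And>f m. f \<in> gns_domain N \<mu> \<Longrightarrow> AE x in \<mu>. D f (m, x) =
          ?P m x * f (m - n, x) + (\<psi> x - 0) * f (m - n, zshift N x n)"
      proof (rule formula[where P = ?P and Q = "\<lambda>_. 0", OF P continuous_on_const])
        show "\<eta> (l + m - n) * a (zq N l) - \<eta> l * a (zq N (l + n)) =
            ?P m (zq N l) * a (zq N l) - 0 * a (zq N (l + n))" for m l and a :: "_ \<Rightarrow> complex"
          unfolding \<eta> \<eta>t zq zshift_zq by (simp add: algebra_simps)
      qed blast
      have zn: "zshift N x n = x" if "x \<in> ZN N" for x
        using zshift_sn_dvd[OF finite n that, of 0] that by simp
      have D': "AE x in \<mu>. D f (m, x) = (?P m x + \<psi> x) * f (m - n, x)" if "f \<in> gns_domain N \<mu>" for f m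
        using D[OF that, of m] AE_ZN by eventually_elim (simp only: zn, simp add: algebra_simps)
      obtain B where B: "\<And>x. x \<in> ZN N \<Longrightarrow> cmod (ht x) \<le> B"
        using continuous_ZN_bounded[OF ht] by blast
      have hB: "cmod (ht (zshift N x m) - ht x) \<le> 2 * B" if "x \<in> ZN N" for m x
        using norm_triangle_ineq4[of "ht (zshift N x m)" "ht x"] B[OF that] B[OF zshift_in_ZN[OF that], of m]
        by linarith
      have "compact_parametrices M (gns_domain N \<mu>) D \<longleftrightarrow> C \<noteq> 0"
      proof
        assume cp: "compact_parametrices M (gns_domain N \<mu>) D"
        show "C \<noteq> 0"
        proof
          assume "C = 0"
          \<comment> \<open>Without the linear term the coefficients are bounded uniformly in
            \<open>m\<close>, so the slice indicators refute compactness.\<close>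
          then have "cmod (?P m x - 0) \<le> 2 * B" if "x \<in> ZN N" for m x
            using hB[OF that, of m] by simp
          from not_compact_bounded_coefficients[OF lin \<psi> D P continuous_on_const this] cp
          show False by blast
        qed
      next
        assume C: "C \<noteq> 0"
        \<comment> \<open>The weight is indexed by the source slice, so the target index of the
          formula becomes \<open>m + n\<close>.\<close>
        let ?A = "\<lambda>(m, x). C * of_int m + ht (zshift N x (m + n)) - ht x + \<psi> x"
        \<comment> \<open>On a finite group \<psi> is locally constant, hence bounded.\<close>
        obtain B' where B': "\<And>x. x \<in> ZN N \<Longrightarrow> cmod (\<psi> x) \<le> B'"
          using continuous_ZN_bounded[OF loc_const_continuous[OF loc_const_finite[OF finite, of \<psi>]]] by blast
        show "compact_parametrices M (gns_domain N \<mu>) D"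
        proof (rule compact_parametrices_weighted_shift[OF lin _ C, where A = ?A and n = n and B = "2 * B + B'"])
          show "AE x in \<mu>. D f (m, x) = ?A (m - n, x) * f (m - n, x)" if "f \<in> gns_domain N \<mu>" for f m
            using D'[OF that, of m] by simp
          show "cmod (?A (m, x) - C * of_int m) \<le> 2 * B + B'" if "x \<in> ZN N" for m x
          proof -
            have eq: "C * of_int m + ht (zshift N x (m + n)) - ht x + \<psi> x - C * of_int m =
                (ht (zshift N x (m + n)) - ht x) + \<psi> x" by simp
            show ?thesis
              unfolding prod.case eq
              using norm_triangle_ineq[of "ht (zshift N x (m + n)) - ht x" "\<psi> x"]
                hB[OF that, of "m + n"] B'[OF that] by linarith
          qed
        qed
      qed
      then show ?thesis
        unfolding AE_gns_pair_iff using finite n \<psi> D' by blast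
    qed
  qed
qed

end
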